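(* Let $(G,P)$ be a quasi-lattice ordered group with unit $e$ ($G$ discrete), let $\mathcal{G}$ be a second-countable locally compact Hausdorff étale groupoid, and let $c:\mathcal{G}\to G$ be an unperforated continuous cocycle; write $\mathcal{G}_g:=c^{-1}(g)$ for $g\in G$, and let $\mathbf{X}(\mathcal{G})$ be the associated product system over $P$ with coefficient algebra $C_r^*(\mathcal{G}_e)$. Consider the condition $$(\ast)\qquad r(\mathcal{G}_p)\cap r(\mathcal{G}_q)=\begin{cases}r(\mathcal{G}_{p\vee q})&\text{if }p\vee q<\infty\\ \emptyset&\text{if }p\vee q=\infty\end{cases}\qquad\text{for each }p,q\in P.$$ If $(\ast)$ holds, then $\mathbf{X}(\mathcal{G})$ is compactly aligned. If $\mathbf{X}(\mathcal{G})$ is compactly aligned and the inclusion of $\mathbf{X}(\mathcal{G})$ in $C_r^*(\mathcal{G})$ is Nica covariant, then $(\ast)$ holds.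
   Context: Groupoids. A cocycle $c:\mathcal{G}\to G$ is a groupoid homomorphism. It is unperforated if, whenever $\gamma\in\mathcal{G}_{pq}$ with $p,q\in P$, there exist composable $\gamma'\in\mathcal{G}_p$, $\gamma''\in\mathcal{G}_q$ with $\gamma=\gamma'\gamma''$. The range map is $r(\gamma)=\gamma\gamma^{-1}$. $C_r^*(\mathcal{G})$ is the reduced groupoid $C^*$-algebra; $C_c(\mathcal{G}_g)$ is identified with $\{f\in C_c(\mathcal{G}):\mathrm{supp}(f)\subseteq\mathcal{G}_g\}$; $C_r^*(\mathcal{G}_e)$ is identified with the closure of $C_c(\mathcal{G}_e)$ in $C_r^*(\mathcal{G})$. Quasi-lattice ordered groups. $(G,P)$ is quasi-lattice ordered if $P$ is a subsemigroup of the group $G$ with $P\cap P^{-1}=\{e\}$ and, for the partial order $p\leq q\Leftrightarrow p^{-1}q\in P$ on $G$, any two elements of $G$ with a common upper bound in $P$ have a least common upper bound in $P$. It is denoted $p\vee q$; write $p\vee q=\infty$ if there is no common upper bound in $P$ and $p\vee q<\infty$ otherwise. Product systems. A Hilbert $A$-bimodule is a right Hilbert $A$-module with a left action of $A$ by adjointable operators; $\mathcal{L}_A(X)$ and $\mathcal{K}_A(X)=\overline{\mathrm{span}}\{\Theta_{x,y}\}$, $\Theta_{x,y}(z)=x\cdot\langle y,z\rangle_A$, are the adjointable and generalised compact operators. A product system over $P$ with coefficient algebra $A$ is a semigroup $\mathbf{X}=\bigsqcup_{p\in P}\mathbf{X}_p$ such that each $\mathbf{X}_p$ is a Hilbert $A$-bimodule,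 $\mathbf{X}_e={}_AA_A$ (i.e. $A$ with $\langle a,b\rangle_A=a^*b$ and left/right multiplication), for $p,q\in P\setminus\{e\}$ the map $x\otimes_Ay\mapsto xy$ extends to a Hilbert $A$-bimodule isomorphism $\mathbf{X}_p\otimes_A\mathbf{X}_q\to\mathbf{X}_{pq}$, and multiplication by elements of $\mathbf{X}_e=A$ implements the left and right actions. $\phi_p:A\to\mathcal{L}_A(\mathbf{X}_p)$ denotes the left action. For $p\in P\setminus\{e\}$, $q\in P$, $\iota_p^{pq}:\mathcal{L}_A(\mathbf{X}_p)\to\mathcal{L}_A(\mathbf{X}_{pq})$ is the homomorphism characterised by $\iota_p^{pq}(S)(xy)=(Sx)y$ ($x\in\mathbf{X}_p$, $y\in\mathbf{X}_q$), and $\iota_e^q:=\phi_q$ on $A\cong\mathcal{K}_A(\mathbf{X}_e)$. The product system $\mathbf{X}(\mathcal{G})$: the fibre $\mathbf{X}(\mathcal{G})_p$ is the closure of $C_c(\mathcal{G}_p)$ in $C_r^*(\mathcal{G})$ (with $\mathbf{X}(\mathcal{G})_e=C_r^*(\mathcal{G}_e)$), with multiplication and $C_r^*(\mathcal{G}_e)$-actions inherited from $C_r^*(\mathcal{G})$ and $\langle\xi,\eta\rangle=\xi^*\eta$; since $c$ is unperforated this is a product system. $\mathbf{X}$ is compactly aligned if, whenever $p,q\in P$ with $p\vee q<\infty$, $\iota_p^{p\vee q}(S)\iota_q^{p\vee q}(T)\in\mathcal{K}_A(\mathbf{X}_{p\vee q})$ for all $S\in\mathcal{K}_A(\mathbf{X}_p)$,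 $T\in\mathcal{K}_A(\mathbf{X}_q)$. A representation of $\mathbf{X}$ in a $C^*$-algebra $B$ is a map $\psi:\mathbf{X}\to B$ such that each $\psi_p:=\psi|_{\mathbf{X}_p}$ is linear, $\psi_e$ is a $*$-homomorphism, $\psi_p(x)\psi_q(y)=\psi_{pq}(xy)$, and $\psi_p(x)^*\psi_p(y)=\psi_e(\langle x,y\rangle_A)$. The inclusion of $\mathbf{X}(\mathcal{G})$ in $C_r^*(\mathcal{G})$ is always a representation. For each $p$ there is a homomorphism $\psi^{(p)}:\mathcal{K}_A(\mathbf{X}_p)\to B$ with $\psi^{(p)}(\Theta_{x,y})=\psi_p(x)\psi_p(y)^*$. A representation $\psi$ of a compactly aligned product system is Nica covariant if for all $p,q\in P$, $S\in\mathcal{K}_A(\mathbf{X}_p)$, $T\in\mathcal{K}_A(\mathbf{X}_q)$, one has $\psi^{(p)}(S)\psi^{(q)}(T)=\psi^{(p\vee q)}(\iota_p^{p\vee q}(S)\iota_q^{p\vee q}(T))$ if $p\vee q<\infty$, and $\psi^{(p)}(S)\psi^{(q)}(T)=0$ otherwise. *)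

theory Defs
  imports "HOL-Analysis.Analysis"
begin

class scaleC =
  fixes scaleC :: "complex \<Rightarrow> 'a \<Rightarrow> 'a"  (infixr \<open>*\<^sub>C\<close> 75)

class complex_normed_vector = scaleC + real_normed_vector +
  assumes scaleC_add_right: "a *\<^sub>C (x + y) = a *\<^sub>C x + a *\<^sub>C y"
    and scaleC_add_left: "(a + b) *\<^sub>C x = a *\<^sub>C x + b *\<^sub>C x"
    and scaleC_scaleC: "a *\<^sub>C b *\<^sub>C x = (a * b) *\<^sub>C x"
    and scaleR_scaleC: "r *\<^sub>R x = complex_of_real r *\<^sub>C x"
    and norm_scaleC: "norm (a *\<^sub>C x) = cmod a * norm x"

class star =
  fixes star :: "'a \<Rightarrow> 'a"  (\<open>(_\<^sup>\<star>)\<close> [1000] 999)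

class cstar_algebra = complex_normed_vector + real_normed_algebra + banach + star +
  assumes mult_scaleC_left: "(a *\<^sub>C x) * y = a *\<^sub>C (x * y)"
    and mult_scaleC_right: "x * (a *\<^sub>C y) = a *\<^sub>C (x * y)"
    and star_star: "(x\<^sup>\<star>)\<^sup>\<star> = x"
    and star_add: "(x + y)\<^sup>\<star> = x\<^sup>\<star> + y\<^sup>\<star>"
    and star_scaleC: "(a *\<^sub>C x)\<^sup>\<star> = cnj a *\<^sub>C x\<^sup>\<star>"
    and star_mult: "(x * y)\<^sup>\<star> = y\<^sup>\<star> * x\<^sup>\<star>"
    and cstar_identity: "norm (x\<^sup>\<star> * x) = (norm x)\<^sup>2"

text \<open>Square-summable families; the norm is induced by the real part of the inner product.\<close>

typedef 'i ell2 = "{f :: 'i \<Rightarrow> complex. (\<lambda>i. (cmod (f i))\<^sup>2) summable_on UNIV}"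
  morphisms ell2_apply Abs_ell2
  by (rule exI[of _ "\<lambda>_. 0"]) simp

setup_lifting type_definition_ell2

lemma ell2_eqI: "(\<And>i. ell2_apply x i = ell2_apply y i) \<Longrightarrow> x = y"
  by transfer auto

lemma ell2_summable: "(\<lambda>i. (cmod (ell2_apply x i))\<^sup>2) summable_on UNIV"
  using ell2_apply[of x] by simp

lemma square_summable_add:
  fixes f g :: "'i \<Rightarrow> complex"
  assumes f: "(\<lambda>i. (cmod (f i))\<^sup>2) summable_on UNIV" and g: "(\<lambda>i. (cmod (g i))\<^sup>2) summable_on UNIV"
  shows "(\<lambda>i. (cmod (f i + g i))\<^sup>2) summable_on UNIV"
proof (rule summable_on_comparison_test)
  show "(\<lambda>i. 2 * (cmod (f i))\<^sup>2 + 2 * (cmod (g i))\<^sup>2) summable_on UNIV"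
    by (intro summable_on_add summable_on_cmult_right f g)
  fix i
  have "(cmod (f i + g i))\<^sup>2 \<le> (cmod (f i) + cmod (g i))\<^sup>2"
    by (intro power_mono norm_triangle_ineq) auto
  also have "\<dots> \<le> 2 * (cmod (f i))\<^sup>2 + 2 * (cmod (g i))\<^sup>2"
    using sum_squares_bound[of "cmod (f i)" "cmod (g i)"] by (simp add: power2_sum)
  finally show "(cmod (f i + g i))\<^sup>2 \<le> 2 * (cmod (f i))\<^sup>2 + 2 * (cmod (g i))\<^sup>2" .
qed auto

lemma square_summable_mult:
  fixes f :: "'i \<Rightarrow> complex"
  assumes "(\<lambda>i. (cmod (f i))\<^sup>2) summable_on UNIV"
  shows "(\<lambda>i. (cmod (c * f i))\<^sup>2) summable_on UNIV"
  by (simp add: norm_mult power_mult_distrib summable_on_cmult_right assms)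

lemma ell2_mult_summable:
  fixes x y :: "'i ell2"
  shows "(\<lambda>i. norm (cnj (ell2_apply x i) * ell2_apply y i)) summable_on UNIV"
proof (rule summable_on_comparison_test)
  show "(\<lambda>i. (cmod (ell2_apply x i))\<^sup>2 + (cmod (ell2_apply y i))\<^sup>2) summable_on UNIV"
    by (intro summable_on_add ell2_summable)
  fix i
  have "2 * (cmod (ell2_apply x i) * cmod (ell2_apply y i)) \<le> (cmod (ell2_apply x i))\<^sup>2 + (cmod (ell2_apply y i))\<^sup>2"
    using sum_squares_bound[of "cmod (ell2_apply x i)" "cmod (ell2_apply y i)"] by simp
  moreover have "0 \<le> cmod (ell2_apply x i) * cmod (ell2_apply y i)" by simp
  ultimately show "norm (cnj (ell2_apply x i) * ell2_apply y i) \<le> (cmod (ell2_apply x i))\<^sup>2 + (cmod (ell2_apply y i))\<^sup>2"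
    unfolding norm_mult complex_mod_cnj by linarith
qed auto

lemmas ell2_mult_summable' = ell2_mult_summable[THEN abs_summable_summable]

text \<open>Inner products are conjugate-linear in the first variable.\<close>

definition cinner :: "'i ell2 \<Rightarrow> 'i ell2 \<Rightarrow> complex"
  where "cinner x y = (\<Sum>\<^sub>\<infinity>i. cnj (ell2_apply x i) * ell2_apply y i)"

instantiation ell2 :: (type) real_vector
begin

lift_definition zero_ell2 :: "'a ell2" is "\<lambda>_. 0" by simp

lift_definition plus_ell2 :: "'a ell2 \<Rightarrow> 'a ell2 \<Rightarrow> 'a ell2" is "\<lambda>f g i. f i + g i"
  by (rule square_summable_add)

lift_definition uminus_ell2 :: "'a ell2 \<Rightarrow> 'a ell2" is "\<lambda>f i. - f i"
  by simp

lift_definition minus_ell2 :: "'a ell2 \<Rightarrow> 'a ell2 \<Rightarrow> 'a ell2" is "\<lambda>f g i. f i - g i"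
  subgoal for f g using square_summable_add[of f "\<lambda>i. - g i"] by simp
  done

lift_definition scaleR_ell2 :: "real \<Rightarrow> 'a ell2 \<Rightarrow> 'a ell2" is "\<lambda>r f i. complex_of_real r * f i"
  by (rule square_summable_mult)

instance
  by standard (transfer; simp add: algebra_simps fun_eq_iff)+

end

instantiation ell2 :: (type) real_inner
begin

definition inner_ell2 :: "'a ell2 \<Rightarrow> 'a ell2 \<Rightarrow> real"
  where "inner_ell2 x y = Re (cinner x y)"

definition norm_ell2 :: "'a ell2 \<Rightarrow> real"
  where "norm_ell2 x = sqrt (inner x x)"

definition sgn_ell2 :: "'a ell2 \<Rightarrow> 'a ell2"
  where "sgn_ell2 x = scaleR (inverse (norm x)) x"

definition dist_ell2 :: "'a ell2 \<Rightarrow> 'a ell2 \<Rightarrow> real"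
  where "dist_ell2 x y = norm (x - y)"

definition
  "(uniformity :: ('a ell2 \<times> 'a ell2) filter) = (INF e\<in>{0<..}. principal {(x, y). dist x y < e})"

definition open_ell2 :: "'a ell2 set \<Rightarrow> bool"
  where "open_ell2 S = (\<forall>x\<in>S. \<forall>\<^sub>F (x', y) in uniformity. x' = x \<longrightarrow> y \<in> S)"

instance
proof
  fix x y z :: "'a ell2" and r s :: real
  show "inner x y = inner y x"
  proof -
    have "cinner x y = (\<Sum>\<^sub>\<infinity>i. cnj (cnj (ell2_apply y i) * ell2_apply x i))"
      by (simp add: cinner_def mult.commute)
    also have "\<dots> = cnj (cinner y x)" unfolding cinner_def by (rule infsum_cnj)
    finally show ?thesis by (simp add: inner_ell2_def)
  qed
  show "inner (x + y) z = inner x z + inner y z"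
    by (simp add: inner_ell2_def cinner_def plus_ell2.rep_eq distrib_right
        infsum_add ell2_mult_summable')
  show "inner (scaleR r x) y = r * inner x y"
    by (simp add: inner_ell2_def cinner_def scaleR_ell2.rep_eq mult.assoc infsum_cmult_right')
  have sq: "inner x x = (\<Sum>\<^sub>\<infinity>i. (cmod (ell2_apply x i))\<^sup>2)"
  proof -
    have "Re (cinner x x) = (\<Sum>\<^sub>\<infinity>i. Re (cnj (ell2_apply x i) * ell2_apply x i))"
      unfolding cinner_def by (rule infsum_Re[symmetric]) (rule ell2_mult_summable')
    also have "\<dots> = (\<Sum>\<^sub>\<infinity>i. (cmod (ell2_apply x i))\<^sup>2)"
      by (rule infsum_cong) (simp add: cmod_def power2_eq_square)
    finally show ?thesis by (simp add: inner_ell2_def)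
  qed
  show "0 \<le> inner x x" by (simp add: sq infsum_nonneg)
  show "inner x x = 0 \<longleftrightarrow> x = 0"
  proof
    assume "inner x x = 0"
    then have "(cmod (ell2_apply x i))\<^sup>2 = 0" for i
      using nonneg_infsum_le_0D[of "\<lambda>i. (cmod (ell2_apply x i))\<^sup>2" UNIV i] ell2_summable[of x]
      by (simp add: sq)
    then show "x = 0" by (intro ell2_eqI) (simp add: zero_ell2.rep_eq)
  next
    assume "x = 0"
    then show "inner x x = 0" unfolding sq by (simp add: zero_ell2.rep_eq)
  qed
qed (simp_all add: norm_ell2_def dist_ell2_def sgn_ell2_def open_ell2_def uniformity_ell2_def)

end


lemma ell2_norm_eq: "(norm (x :: 'i ell2))\<^sup>2 = (\<Sum>\<^sub>\<infinity>i. (cmod (ell2_apply x i))\<^sup>2)"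
proof -
  have "inner x x = (\<Sum>\<^sub>\<infinity>i. Re (cnj (ell2_apply x i) * ell2_apply x i))"
    unfolding inner_ell2_def cinner_def by (rule infsum_Re[symmetric]) (rule ell2_mult_summable')
  also have "\<dots> = (\<Sum>\<^sub>\<infinity>i. (cmod (ell2_apply x i))\<^sup>2)"
    by (rule infsum_cong) (simp add: cmod_def power2_eq_square)
  finally show ?thesis by (simp add: power2_norm_eq_inner)
qed

instantiation ell2 :: (type) complex_normed_vector
begin

lift_definition scaleC_ell2 :: "complex \<Rightarrow> 'a ell2 \<Rightarrow> 'a ell2" is "\<lambda>z f i. z * f i"
  by (rule square_summable_mult)

instance
proof
  fix a :: complex and x :: "'a ell2"
  have "(norm (a *\<^sub>C x))\<^sup>2 = (cmod a)\<^sup>2 * (norm x)\<^sup>2"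
    unfolding ell2_norm_eq scaleC_ell2.rep_eq norm_mult power_mult_distrib by (rule infsum_cmult_right')
  then show "norm (a *\<^sub>C x) = cmod a * norm x"
    unfolding power_mult_distrib[symmetric] by (rule power2_eq_imp_eq) simp_all
qed (transfer, simp add: algebra_simps)+

end

lemma cinner_commute: "cinner y x = cnj (cinner x y)"
proof -
  have "cinner y x = (\<Sum>\<^sub>\<infinity>i. cnj (cnj (ell2_apply x i) * ell2_apply y i))"
    by (simp add: cinner_def mult.commute)
  also have "\<dots> = cnj (cinner x y)" unfolding cinner_def by (rule infsum_cnj)
  finally show ?thesis .
qed

lemma cinner_scaleC_right: "cinner x (a *\<^sub>C y) = a * cinner x y"
proof -
  have "cinner x (a *\<^sub>C y) = (\<Sum>\<^sub>\<infinity>i. a * (cnj (ell2_apply x i) * ell2_apply y i))"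
    by (simp add: cinner_def scaleC_ell2.rep_eq mult_ac)
  then show ?thesis by (simp add: cinner_def infsum_cmult_right')
qed

lemma cinner_scaleC_left: "cinner (a *\<^sub>C x) y = cnj a * cinner x y"
  by (subst (1 2) cinner_commute) (simp add: cinner_scaleC_right)

lemma cinner_inner: "cinner x y = Complex (inner x y) (inner (\<i> *\<^sub>C x) y)"
  by (simp add: complex_eq_iff inner_ell2_def cinner_scaleC_left)

lemma cinner_add_left: "cinner (x + y) z = cinner x z + cinner y z"
  by (simp add: cinner_inner complex_eq_iff scaleC_add_right inner_add_left)

lemma cinner_add_right: "cinner x (y + z) = cinner x y + cinner x z"
  by (simp add: cinner_inner complex_eq_iff inner_add_right)

lemma cinner_eqI: "(\<And>y. cinner x y = cinner x' y) \<Longrightarrow> x = x'"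
  by (rule vector_eq_rdot[THEN iffD1]) (simp add: inner_ell2_def)

lemma ell2_apply_le_norm: "cmod (ell2_apply x i) \<le> norm x"
proof -
  have "(cmod (ell2_apply x i))\<^sup>2 \<le> (norm x)\<^sup>2"
    using finite_sum_le_infsum[OF ell2_summable, of "{i}" x] by (simp add: ell2_norm_eq)
  then show ?thesis by (rule power2_le_imp_le) simp
qed

instance ell2 :: (type) banach
proof
  fix X :: "nat \<Rightarrow> 'a ell2"
  assume X: "Cauchy X"
  have Ci: "Cauchy (\<lambda>n. ell2_apply (X n) i)" for i
  proof (rule CauchyI)
    fix e :: real assume "0 < e"
    then obtain M where M: "\<And>m n. m \<ge> M \<Longrightarrow> n \<ge> M \<Longrightarrow> norm (X m - X n) < e"
      using CauchyD[OF X] by blast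
    show "\<exists>M. \<forall>m\<ge>M. \<forall>n\<ge>M. norm (ell2_apply (X m) i - ell2_apply (X n) i) < e"
    proof (intro exI allI impI)
      fix m n assume "m \<ge> M" "n \<ge> M"
      then show "norm (ell2_apply (X m) i - ell2_apply (X n) i) < e"
        using M[of m n] ell2_apply_le_norm[of "X m - X n" i] by (simp add: minus_ell2.rep_eq)
    qed
  qed
  then obtain l where l: "\<And>i. (\<lambda>n. ell2_apply (X n) i) \<longlonglongrightarrow> l i"
    unfolding Cauchy_convergent_iff convergent_def by metis
  have fin: "(\<Sum>i\<in>F. (cmod (ell2_apply (X n) i - l i))\<^sup>2) \<le> e\<^sup>2"
    if "finite F" and e: "\<forall>m\<ge>M. norm (X n - X m) \<le> e" for F n e M
  proof (rule tendsto_upperbound)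
    show "(\<lambda>m. \<Sum>i\<in>F. (cmod (ell2_apply (X n) i - ell2_apply (X m) i))\<^sup>2)
        \<longlonglongrightarrow> (\<Sum>i\<in>F. (cmod (ell2_apply (X n) i - l i))\<^sup>2)"
      by (intro tendsto_intros l)
    show "\<forall>\<^sub>F m in sequentially. (\<Sum>i\<in>F. (cmod (ell2_apply (X n) i - ell2_apply (X m) i))\<^sup>2) \<le> e\<^sup>2"
    proof (rule eventually_sequentiallyI)
      fix m assume "m \<ge> M"
      have "(\<Sum>i\<in>F. (cmod (ell2_apply (X n) i - ell2_apply (X m) i))\<^sup>2) \<le> (norm (X n - X m))\<^sup>2"
        using finite_sum_le_infsum[OF ell2_summable \<open>finite F\<close>, of "X n - X m"]
        by (simp add: ell2_norm_eq minus_ell2.rep_eq)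
      also have "\<dots> \<le> e\<^sup>2"
        using e \<open>m \<ge> M\<close> by (simp add: power_mono)
      finally show "(\<Sum>i\<in>F. (cmod (ell2_apply (X n) i - ell2_apply (X m) i))\<^sup>2) \<le> e\<^sup>2" .
    qed
  qed simp
  have summ: "(\<lambda>i. (cmod (ell2_apply (X n) i - l i))\<^sup>2) summable_on UNIV"
    if e: "\<forall>m\<ge>M. norm (X n - X m) \<le> e" for n e M
  proof (rule nonneg_bdd_above_summable_on)
    show "bdd_above (sum (\<lambda>i. (cmod (ell2_apply (X n) i - l i))\<^sup>2) ` {F. F \<subseteq> UNIV \<and> finite F})"
      by (rule bdd_aboveI2[where M = "e\<^sup>2"]) (simp add: fin[OF _ e])
  qed simp
  obtain M1 where M1: "\<And>m n. m \<ge> M1 \<Longrightarrow> n \<ge> M1 \<Longrightarrow> norm (X m - X n) < 1"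
    using CauchyD[OF X zero_less_one] by blast
  have "\<forall>m\<ge>M1. norm (X M1 - X m) \<le> 1"
    using M1 by (simp add: less_imp_le)
  from summ[OF this]
  have "(\<lambda>i. (cmod (ell2_apply (X M1) i + (-1) * (ell2_apply (X M1) i - l i)))\<^sup>2) summable_on UNIV"
    by (intro square_summable_add ell2_summable square_summable_mult)
  then have "(\<lambda>i. (cmod (l i))\<^sup>2) summable_on UNIV" by simp
  then have lim: "ell2_apply (Abs_ell2 l) = l" by (simp add: Abs_ell2_inverse)
  have "X \<longlonglongrightarrow> Abs_ell2 l"
  proof (rule LIMSEQ_I)
    fix e :: real assume "0 < e"
    then obtain M where M: "\<And>m n. m \<ge> M \<Longrightarrow> n \<ge> M \<Longrightarrow> norm (X m - X n) < e / 2"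
      using CauchyD[OF X, of "e / 2"] half_gt_zero by blast
    show "\<exists>M. \<forall>n\<ge>M. norm (X n - Abs_ell2 l) < e"
    proof (intro exI allI impI)
      fix n assume "n \<ge> M"
      then have e: "\<forall>m\<ge>M. norm (X n - X m) \<le> e / 2" using M by (simp add: less_imp_le)
      have "(norm (X n - Abs_ell2 l))\<^sup>2 = (\<Sum>\<^sub>\<infinity>i. (cmod (ell2_apply (X n) i - l i))\<^sup>2)"
        by (simp add: ell2_norm_eq minus_ell2.rep_eq lim)
      also have "\<dots> \<le> (e / 2)\<^sup>2"
        by (rule infsum_le_finite_sums[OF summ[OF e] fin[OF _ e]])
      finally have "norm (X n - Abs_ell2 l) \<le> e / 2"
        by (rule power2_le_imp_le) (use \<open>0 < e\<close> in simp)
      then show "norm (X n - Abs_ell2 l) < e" using \<open>0 < e\<close> by simp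
    qed
  qed
  then show "convergent X" by (auto simp: convergent_def)
qed

lift_definition ket :: "'i \<Rightarrow> 'i ell2" is "\<lambda>i j. of_bool (i = j)"
  subgoal for i by (rule finite_nonzero_values_imp_summable_on) (auto intro!: finite_subset[of _ "{i}"])
  done

lemma ket_sum_apply:
  "finite F \<Longrightarrow> ell2_apply (\<Sum>i\<in>F. a i *\<^sub>C ket i) j = (if j \<in> F then a j else 0)"
  by (induction F rule: finite_induct)
    (auto simp: zero_ell2.rep_eq plus_ell2.rep_eq scaleC_ell2.rep_eq ket.rep_eq)

lemma cinner_ket: "cinner x (ket i) = cnj (ell2_apply x i)"
proof -
  have "cinner x (ket i) = (\<Sum>\<^sub>\<infinity>j\<in>{i}. cnj (ell2_apply x j) * ell2_apply (ket i) j)"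
    unfolding cinner_def by (rule infsum_cong_neutral) (auto simp: ket.rep_eq)
  then show ?thesis by (simp add: ket.rep_eq)
qed

lemma ell2_has_sum_ket: "((\<lambda>i. ell2_apply x i *\<^sub>C ket i) has_sum x) UNIV"
  unfolding has_sum_def
proof (rule tendstoI)
  fix e :: real assume "0 < e"
  let ?f = "\<lambda>i. (cmod (ell2_apply x i))\<^sup>2"
  have "(?f has_sum (norm x)\<^sup>2) UNIV"
    by (simp add: ell2_norm_eq ell2_summable)
  then have "\<forall>\<^sub>F F in finite_subsets_at_top UNIV. dist (sum ?f F) ((norm x)\<^sup>2) < e\<^sup>2"
    unfolding has_sum_def using \<open>0 < e\<close> by (intro tendstoD) auto
  moreover have "\<forall>\<^sub>F F in finite_subsets_at_top (UNIV :: 'a set). finite F"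
    by (rule eventually_finite_subsets_at_top_weakI) auto
  ultimately show "\<forall>\<^sub>F F in finite_subsets_at_top UNIV. dist (\<Sum>i\<in>F. ell2_apply x i *\<^sub>C ket i) x < e"
  proof eventually_elim
    case (elim F)
    let ?y = "\<Sum>i\<in>F. ell2_apply x i *\<^sub>C ket i"
    have "(norm (x - ?y))\<^sup>2 = (\<Sum>\<^sub>\<infinity>i. ?f i - of_bool (i \<in> F) * ?f i)"
      using elim(2) by (auto simp: ell2_norm_eq minus_ell2.rep_eq ket_sum_apply intro!: infsum_cong)
    also have "\<dots> = infsum ?f UNIV + infsum (\<lambda>i. - (of_bool (i \<in> F) * ?f i)) UNIV"
      using elim(2)
    proof (subst infsum_add[symmetric])
      show "(\<lambda>i. - (of_bool (i \<in> F) * ?f i)) summable_on UNIV"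
        by (rule finite_nonzero_values_imp_summable_on, rule finite_subset[OF _ elim(2)]) auto
    qed (auto simp: ell2_summable)
    also have "infsum (\<lambda>i. - (of_bool (i \<in> F) * ?f i)) UNIV = - infsum (\<lambda>i. of_bool (i \<in> F) * ?f i) UNIV"
      by (rule infsum_uminus)
    also have "infsum (\<lambda>i. of_bool (i \<in> F) * ?f i) UNIV = infsum ?f F"
      by (rule infsum_cong_neutral) auto
    finally have "(norm (x - ?y))\<^sup>2 = (norm x)\<^sup>2 - sum ?f F"
      using elim(2) by (simp add: ell2_norm_eq)
    then have "(norm (x - ?y))\<^sup>2 < e\<^sup>2" using elim(1) by (simp add: dist_real_def)
    then have "norm (x - ?y) < e" using \<open>0 < e\<close> by (simp add: power2_less_imp_less)
    then show ?case by (simp add: dist_norm norm_minus_commute)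
  qed
qed

text \<open>
  The bounded complex-linear operators on \<open>\<ell>\<^sup>2\<close> with the operator norm, inherited from the
  real-linear ones.
\<close>

typedef 'i ell2_op = "{T :: 'i ell2 \<Rightarrow>\<^sub>L 'i ell2. \<forall>a x. blinfun_apply T (a *\<^sub>C x) = a *\<^sub>C blinfun_apply T x}"
  morphisms blinfun_of_op Abs_ell2_op
  by (rule exI[of _ id_blinfun]) simp

definition op_apply :: "'i ell2_op \<Rightarrow> 'i ell2 \<Rightarrow> 'i ell2"
  where "op_apply T = blinfun_apply (blinfun_of_op T)"

setup_lifting type_definition_ell2_op

lemma op_eqI: "(\<And>x. op_apply S x = op_apply T x) \<Longrightarrow> S = T"
  unfolding op_apply_def by transfer (simp add: blinfun_eqI)

lemma op_apply_scaleC: "op_apply T (a *\<^sub>C x) = a *\<^sub>C op_apply T x"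
  unfolding op_apply_def by transfer simp

lemma bounded_linear_op_apply: "bounded_linear (op_apply T)"
  unfolding op_apply_def by (rule blinfun.bounded_linear_right)

lemma bounded_linear_scaleC: "bounded_linear (\<lambda>x :: 'a :: complex_normed_vector. a *\<^sub>C x)"
  by (rule bounded_linear_intro[of _ "cmod a"])
    (simp_all add: scaleC_add_right scaleR_scaleC scaleC_scaleC norm_scaleC mult.commute)


instantiation ell2_op :: (type) real_vector
begin

lift_definition zero_ell2_op :: "'a ell2_op" is 0 by (simp add: bounded_linear_scaleC[THEN linear_simps(3)])
lift_definition plus_ell2_op :: "'a ell2_op \<Rightarrow> 'a ell2_op \<Rightarrow> 'a ell2_op" is "(+)"
  by (simp add: blinfun.add_left scaleC_add_right)
lift_definition uminus_ell2_op :: "'a ell2_op \<Rightarrow> 'a ell2_op" is uminus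
  by (simp add: blinfun.minus_left bounded_linear_scaleC[THEN linear_simps(4)])
lift_definition minus_ell2_op :: "'a ell2_op \<Rightarrow> 'a ell2_op \<Rightarrow> 'a ell2_op" is "(-)"
  by (simp add: blinfun.diff_left bounded_linear_scaleC[THEN linear_simps(2)])
lift_definition scaleR_ell2_op :: "real \<Rightarrow> 'a ell2_op \<Rightarrow> 'a ell2_op" is scaleR
  by (simp add: blinfun.scaleR_left scaleR_scaleC scaleC_scaleC mult.commute)

instance
  by standard (transfer; simp add: algebra_simps)+

end

instantiation ell2_op :: (type) real_normed_vector
begin

lift_definition norm_ell2_op :: "'a ell2_op \<Rightarrow> real" is norm .

definition sgn_ell2_op :: "'a ell2_op \<Rightarrow> 'a ell2_op"
  where "sgn_ell2_op x = scaleR (inverse (norm x)) x"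

definition dist_ell2_op :: "'a ell2_op \<Rightarrow> 'a ell2_op \<Rightarrow> real"
  where "dist_ell2_op x y = norm (x - y)"

definition
  "(uniformity :: ('a ell2_op \<times> 'a ell2_op) filter) = (INF e\<in>{0<..}. principal {(x, y). dist x y < e})"

definition open_ell2_op :: "'a ell2_op set \<Rightarrow> bool"
  where "open_ell2_op S = (\<forall>x\<in>S. \<forall>\<^sub>F (x', y) in uniformity. x' = x \<longrightarrow> y \<in> S)"

instance
proof
  fix x y :: "'a ell2_op" and r :: real
  show "norm x = 0 \<longleftrightarrow> x = 0" by transfer simp
  show "norm (x + y) \<le> norm x + norm y" by transfer (rule norm_triangle_ineq)
  show "norm (r *\<^sub>R x) = \<bar>r\<bar> * norm x" by transfer simp
qed (simp_all add: dist_ell2_op_def sgn_ell2_op_def open_ell2_op_def uniformity_ell2_op_def)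

end

instantiation ell2_op :: (type) complex_normed_vector
begin

lift_definition scaleC_ell2_op :: "complex \<Rightarrow> 'a ell2_op \<Rightarrow> 'a ell2_op"
  is "\<lambda>a T. Blinfun (\<lambda>x. a *\<^sub>C blinfun_apply T x)"
  by (simp add: bounded_linear_Blinfun_apply bounded_linear_compose[OF bounded_linear_scaleC]
      blinfun.bounded_linear_right scaleC_scaleC mult.commute)

lemma op_apply_scaleC_left: "op_apply (a *\<^sub>C T) x = a *\<^sub>C op_apply T x"
  unfolding op_apply_def
  by transfer (simp add: bounded_linear_Blinfun_apply
      bounded_linear_compose[OF bounded_linear_scaleC] blinfun.bounded_linear_right)

lemma op_apply_add_left: "op_apply (S + T) x = op_apply S x + op_apply T x"
  unfolding op_apply_def by transfer (simp add: blinfun.add_left)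

lemma op_apply_scaleR_left: "op_apply (r *\<^sub>R T) x = r *\<^sub>R op_apply T x"
  unfolding op_apply_def by transfer (simp add: blinfun.scaleR_left)

lemma norm_op_apply: "norm (op_apply T x) \<le> norm T * norm x"
  unfolding op_apply_def by transfer (rule norm_blinfun)

lemma norm_op_bound: "0 \<le> b \<Longrightarrow> (\<And>x. norm (op_apply T x) \<le> b * norm x) \<Longrightarrow> norm T \<le> b"
  unfolding op_apply_def by transfer (rule norm_blinfun_bound)

instance
proof
  fix a b :: complex and r :: real and x y :: "'a ell2_op"
  show "a *\<^sub>C (x + y) = a *\<^sub>C x + a *\<^sub>C y"
    by (rule op_eqI) (simp add: op_apply_scaleC_left op_apply_add_left scaleC_add_right)
  show "(a + b) *\<^sub>C x = a *\<^sub>C x + b *\<^sub>C x"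
    by (rule op_eqI) (simp add: op_apply_scaleC_left op_apply_add_left scaleC_add_left)
  show "a *\<^sub>C b *\<^sub>C x = (a * b) *\<^sub>C x"
    by (rule op_eqI) (simp add: op_apply_scaleC_left scaleC_scaleC)
  show "r *\<^sub>R x = complex_of_real r *\<^sub>C x"
    by (rule op_eqI) (simp add: op_apply_scaleC_left op_apply_scaleR_left scaleR_scaleC)
  have le: "norm (c *\<^sub>C z) \<le> cmod c * norm z" for c and z :: "'a ell2_op"
  proof (rule norm_op_bound)
    fix v
    have "cmod c * norm (op_apply z v) \<le> cmod c * (norm z * norm v)"
      by (intro mult_left_mono norm_op_apply) auto
    then show "norm (op_apply (c *\<^sub>C z) v) \<le> cmod c * norm z * norm v"
      by (simp add: op_apply_scaleC_left norm_scaleC mult.assoc)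
  qed simp
  show "norm (a *\<^sub>C x) = cmod a * norm x"
  proof (cases "a = 0")
    case True
    then show ?thesis using le[of a x] by simp
  next
    case False
    have "x = inverse a *\<^sub>C (a *\<^sub>C x)"
      using False by (intro op_eqI) (simp add: op_apply_scaleC_left scaleC_scaleC scaleR_scaleC[of 1, simplified, symmetric])
    then have "norm x \<le> cmod (inverse a) * norm (a *\<^sub>C x)"
      using le[of "inverse a" "a *\<^sub>C x"] by simp
    then have "cmod a * norm x \<le> norm (a *\<^sub>C x)"
      using False by (simp add: norm_divide field_simps)
    then show ?thesis using le[of a x] by simp
  qed
qed

end

instantiation ell2_op :: (type) real_normed_algebra
begin

lift_definition times_ell2_op :: "'a ell2_op \<Rightarrow> 'a ell2_op \<Rightarrow> 'a ell2_op" is "(o\<^sub>L)"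
  by simp

lemma op_apply_mult: "op_apply (S * T) x = op_apply S (op_apply T x)"
  unfolding op_apply_def by transfer simp

instance
proof
  fix x y z :: "'a ell2_op" and r :: real
  interpret L: bounded_linear "op_apply T" for T :: "'a ell2_op" by (rule bounded_linear_op_apply)
  show "x * y * z = x * (y * z)"
    by (rule op_eqI) (simp add: op_apply_mult)
  show "(x + y) * z = x * z + y * z"
    by (rule op_eqI) (simp add: op_apply_mult op_apply_add_left)
  show "x * (y + z) = x * y + x * z"
    by (rule op_eqI) (simp add: op_apply_mult op_apply_add_left L.add)
  show "r *\<^sub>R x * y = r *\<^sub>R (x * y)"
    by (rule op_eqI) (simp add: op_apply_mult op_apply_scaleR_left)
  show "x * r *\<^sub>R y = r *\<^sub>R (x * y)"
    by (rule op_eqI) (simp add: op_apply_mult op_apply_scaleR_left L.scaleR)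
  show "norm (x * y) \<le> norm x * norm y"
    by transfer (rule norm_blinfun_compose)
qed

end

instance ell2_op :: (type) banach
proof
  fix X :: "nat \<Rightarrow> 'a ell2_op"
  assume X: "Cauchy X"
  have dist: "dist (blinfun_of_op S) (blinfun_of_op T) = dist S T" for S T :: "'a ell2_op"
    unfolding dist_norm by transfer simp
  have "Cauchy (\<lambda>n. blinfun_of_op (X n))"
    using X by (simp add: Cauchy_def dist)
  then obtain L where L: "(\<lambda>n. blinfun_of_op (X n)) \<longlonglongrightarrow> L"
    unfolding Cauchy_convergent_iff convergent_def by blast
  have "blinfun_apply L (a *\<^sub>C x) = a *\<^sub>C blinfun_apply L x" for a x
  proof (rule LIMSEQ_unique)
    show "(\<lambda>n. blinfun_apply (blinfun_of_op (X n)) (a *\<^sub>C x)) \<longlonglongrightarrow> blinfun_apply L (a *\<^sub>C x)"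
      by (intro tendsto_intros L)
    have "(\<lambda>n. a *\<^sub>C blinfun_apply (blinfun_of_op (X n)) x) \<longlonglongrightarrow> a *\<^sub>C blinfun_apply L x"
      by (intro bounded_linear.tendsto[OF bounded_linear_scaleC] tendsto_intros L)
    then show "(\<lambda>n. blinfun_apply (blinfun_of_op (X n)) (a *\<^sub>C x)) \<longlonglongrightarrow> a *\<^sub>C blinfun_apply L x"
      by (simp add: op_apply_scaleC[unfolded op_apply_def])
  qed
  then have "blinfun_of_op (Abs_ell2_op L) = L" by (simp add: Abs_ell2_op_inverse)
  then have "X \<longlonglongrightarrow> Abs_ell2_op L"
    using L by (simp add: tendsto_iff dist[symmetric])
  then show "convergent X" by (auto simp: convergent_def)
qed

lemma op_adjoint_exists: "\<exists>S. \<forall>x y. cinner (op_apply S x) y = cinner x (op_apply T y)"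
proof -
  interpret L: bounded_linear "op_apply T" by (rule bounded_linear_op_apply)
  have ex: "\<exists>z. (\<forall>y. cinner z y = cinner x (op_apply T y)) \<and> norm z \<le> norm T * norm x" for x
  proof -
    define f where "f i = cnj (cinner x (op_apply T (ket i)))" for i
    have fin: "(\<Sum>i\<in>F. (cmod (f i))\<^sup>2) \<le> (norm T * norm x)\<^sup>2" if F: "finite F" for F
    proof -
      define v where "v = (\<Sum>i\<in>F. f i *\<^sub>C ket i)"
      define s where "s = (\<Sum>i\<in>F. (cmod (f i))\<^sup>2)"
      have "(norm v)\<^sup>2 = (\<Sum>\<^sub>\<infinity>i\<in>F. (cmod (f i))\<^sup>2)"
        unfolding ell2_norm_eq v_def
        by (rule infsum_cong_neutral) (auto simp: ket_sum_apply F)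
      then have v: "(norm v)\<^sup>2 = s" using F by (simp add: s_def)
      have "inner x (op_apply T v) = (\<Sum>i\<in>F. inner x (f i *\<^sub>C op_apply T (ket i)))"
        by (simp add: v_def L.sum inner_sum_right op_apply_scaleC)
      also have "\<dots> = (\<Sum>i\<in>F. Re (f i * cinner x (op_apply T (ket i))))"
        by (simp only: inner_ell2_def cinner_scaleC_right)
      also have "\<dots> = s"
        unfolding s_def by (rule sum.cong) (simp_all add: f_def cmod_def power2_eq_square)
      finally have "s \<le> norm x * norm (op_apply T v)"
        using norm_cauchy_schwarz[of x "op_apply T v"] by simp
      also have "\<dots> \<le> norm x * (norm T * norm v)"
        by (intro mult_left_mono norm_op_apply) auto
      finally have "norm v * norm v \<le> (norm T * norm x) * norm v"
        using v by (simp add: power2_eq_square mult_ac)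
      then have "norm v \<le> norm T * norm x"
        by (cases "v = 0") (auto dest: mult_right_le_imp_le)
      then have "(norm v)\<^sup>2 \<le> (norm T * norm x)\<^sup>2" by (rule power_mono) simp
      then show ?thesis unfolding v s_def .
    qed
    have sf: "(\<lambda>i. (cmod (f i))\<^sup>2) summable_on UNIV"
    proof (rule nonneg_bdd_above_summable_on)
      show "bdd_above (sum (\<lambda>i. (cmod (f i))\<^sup>2) ` {F. F \<subseteq> UNIV \<and> finite F})"
        by (rule bdd_aboveI2[where M = "(norm T * norm x)\<^sup>2"]) (simp add: fin)
    qed simp
    define z where "z = Abs_ell2 f"
    have z: "ell2_apply z = f" using sf by (simp add: z_def Abs_ell2_inverse)
    have "cinner z y = cinner x (op_apply T y)" for y
    proof -
      have lin: "bounded_linear (\<lambda>y. cinner w (op_apply U y))" for w and U :: "'a ell2_op"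
      proof -
        interpret U: bounded_linear "op_apply U" by (rule bounded_linear_op_apply)
        show ?thesis
          unfolding cinner_inner Complex_eq
          by (intro bounded_linear_add bounded_linear_mult_const bounded_linear_const_mult
              bounded_linear_compose[OF bounded_linear_of_real]
              bounded_linear_compose[OF bounded_linear_inner_right] U.bounded_linear_axioms)
      qed
      have "bounded_linear (\<lambda>y. cinner z y)"
        unfolding cinner_inner Complex_eq
        by (intro bounded_linear_add bounded_linear_mult_const bounded_linear_const_mult
            bounded_linear_compose[OF bounded_linear_of_real] bounded_linear_inner_right)
      from has_sum_bounded_linear[OF this ell2_has_sum_ket, of y]
      have 1: "((\<lambda>i. cinner z (ell2_apply y i *\<^sub>C ket i)) has_sum cinner z y) UNIV" by (simp add: o_def)
      from has_sum_bounded_linear[OF lin ell2_has_sum_ket, of x T y]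
      have 2: "((\<lambda>i. cinner x (op_apply T (ell2_apply y i *\<^sub>C ket i))) has_sum cinner x (op_apply T y)) UNIV"
        by (simp add: o_def)
      have "cinner z (ell2_apply y i *\<^sub>C ket i) = cinner x (op_apply T (ell2_apply y i *\<^sub>C ket i))" for i
        by (simp add: cinner_scaleC_right op_apply_scaleC cinner_ket z f_def)
      with 1 2 show ?thesis by (simp add: has_sum_unique)
    qed
    moreover have "(norm z)\<^sup>2 \<le> (norm T * norm x)\<^sup>2"
      unfolding ell2_norm_eq z by (rule infsum_le_finite_sums[OF sf fin])
    then have "norm z \<le> norm T * norm x"
      by (rule power2_le_imp_le) simp
    ultimately show ?thesis by blast
  qed
  then obtain S where S: "\<And>x y. cinner (S x) y = cinner x (op_apply T y)"
    and nS: "\<And>x. norm (S x) \<le> norm T * norm x" by metis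
  have add': "S (x + y) = S x + S y" for x y
    by (rule cinner_eqI) (simp add: S cinner_add_left)
  have sc: "S (a *\<^sub>C x) = a *\<^sub>C S x" for a x
    by (rule cinner_eqI) (simp add: S cinner_scaleC_left)
  have bl: "bounded_linear S"
    by (rule bounded_linear_intro[of _ "norm T"]) (simp_all add: add' sc scaleR_scaleC nS mult.commute[of _ "norm T"])
  have "op_apply (Abs_ell2_op (Blinfun S)) = S"
    unfolding op_apply_def by (subst Abs_ell2_op_inverse) (simp_all add: bounded_linear_Blinfun_apply bl sc)
  with S show ?thesis by metis
qed

instantiation ell2_op :: (type) cstar_algebra
begin

definition star_ell2_op :: "'a ell2_op \<Rightarrow> 'a ell2_op"
  where "star_ell2_op T = (THE S. \<forall>x y. cinner (op_apply S x) y = cinner x (op_apply T y))"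

lemma op_adjoint_eqI:
  assumes "\<And>x y. cinner (op_apply S x) y = cinner x (op_apply T y)"
  shows "T\<^sup>\<star> = S"
  unfolding star_ell2_op_def
proof (rule the_equality)
  fix S' assume "\<forall>x y. cinner (op_apply S' x) y = cinner x (op_apply T y)"
  with assms show "S' = S" by (intro op_eqI cinner_eqI) simp
qed (use assms in blast)

lemma cinner_star: "cinner (op_apply (T\<^sup>\<star>) x) y = cinner x (op_apply T y)"
  using op_adjoint_exists[of T] op_adjoint_eqI[of _ T] by metis

lemma cinner_star': "cinner (op_apply T x) y = cinner x (op_apply (T\<^sup>\<star>) y)"
  by (metis cinner_commute cinner_star)

instance
proof
  fix a :: complex and x y :: "'a ell2_op"
  interpret L: bounded_linear "op_apply T" for T :: "'a ell2_op" by (rule bounded_linear_op_apply)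
  show "a *\<^sub>C x * y = a *\<^sub>C (x * y)"
    by (rule op_eqI) (simp add: op_apply_mult op_apply_scaleC_left)
  show "x * a *\<^sub>C y = a *\<^sub>C (x * y)"
    by (rule op_eqI) (simp add: op_apply_mult op_apply_scaleC_left op_apply_scaleC)
  show ss: "(x\<^sup>\<star>)\<^sup>\<star> = x" for x :: "'a ell2_op"
    by (rule op_adjoint_eqI) (rule cinner_star')
  show "(x + y)\<^sup>\<star> = x\<^sup>\<star> + y\<^sup>\<star>"
    by (rule op_adjoint_eqI) (simp add: op_apply_add_left cinner_add_left cinner_add_right cinner_star)
  show "(a *\<^sub>C x)\<^sup>\<star> = cnj a *\<^sub>C x\<^sup>\<star>"
    by (rule op_adjoint_eqI) (simp add: op_apply_scaleC_left cinner_scaleC_left cinner_scaleC_right cinner_star)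
  show "(x * y)\<^sup>\<star> = y\<^sup>\<star> * x\<^sup>\<star>"
    by (rule op_adjoint_eqI) (simp add: op_apply_mult cinner_star)
  have ge: "(norm x)\<^sup>2 \<le> norm (x\<^sup>\<star> * x)" for x :: "'a ell2_op"
  proof -
    have "norm x \<le> sqrt (norm (x\<^sup>\<star> * x))"
    proof (rule norm_op_bound)
      fix v
      have "(norm (op_apply x v))\<^sup>2 = inner v (op_apply (x\<^sup>\<star> * x) v)"
        by (simp add: power2_norm_eq_inner inner_ell2_def op_apply_mult cinner_star')
      also have "\<dots> \<le> norm v * norm (op_apply (x\<^sup>\<star> * x) v)" by (rule norm_cauchy_schwarz)
      also have "\<dots> \<le> norm v * (norm (x\<^sup>\<star> * x) * norm v)"
        by (intro mult_left_mono norm_op_apply) auto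
      also have "\<dots> = (sqrt (norm (x\<^sup>\<star> * x)) * norm v)\<^sup>2"
        by (simp add: power_mult_distrib power2_eq_square)
      finally show "norm (op_apply x v) \<le> sqrt (norm (x\<^sup>\<star> * x)) * norm v"
        by (rule power2_le_imp_le) simp
    qed simp
    then have "(norm x)\<^sup>2 \<le> (sqrt (norm (x\<^sup>\<star> * x)))\<^sup>2" by (rule power_mono) simp
    then show ?thesis by simp
  qed
  have le: "norm x \<le> norm (x\<^sup>\<star>)" for x :: "'a ell2_op"
  proof (cases "x = 0")
    case False
    have "norm x * norm x \<le> norm (x\<^sup>\<star>) * norm x"
      using ge[of x] norm_mult_ineq[of "x\<^sup>\<star>" x] by (simp add: power2_eq_square)
    then show ?thesis using False by (simp add: mult_right_le_imp_le)
  qed simp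
  have "norm (x\<^sup>\<star>) = norm x" using le[of x] le[of "x\<^sup>\<star>"] by (simp add: ss)
  then have "norm (x\<^sup>\<star> * x) \<le> (norm x)\<^sup>2"
    using norm_mult_ineq[of "x\<^sup>\<star>" x] by (simp add: power2_eq_square)
  with ge[of x] show "norm (x\<^sup>\<star> * x) = (norm x)\<^sup>2" by simp
qed

end


section \<open>Quasi-lattice ordered groups\<close>

text \<open>
  Groups are written additively, following \<^class>\<open>group_add\<close>, which does not assume commutativity:
  \<open>- p + q\<close> is \<open>p\<^sup>-\<^sup>1q\<close> and \<open>0\<close> is the unit.
\<close>

definition ple :: "'p :: group_add set \<Rightarrow> 'p \<Rightarrow> 'p \<Rightarrow> bool"
  where "ple P p q \<longleftrightarrow> - p + q \<in> P"

definition common_upper_bounds :: "'p :: group_add set \<Rightarrow> 'p \<Rightarrow> 'p \<Rightarrow> 'p set"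
  where "common_upper_bounds P p q = {r \<in> P. ple P p r \<and> ple P q r}"

definition is_join :: "'p :: group_add set \<Rightarrow> 'p \<Rightarrow> 'p \<Rightarrow> 'p \<Rightarrow> bool"
  where "is_join P p q r \<longleftrightarrow>
    r \<in> common_upper_bounds P p q \<and> (\<forall>s \<in> common_upper_bounds P p q. ple P r s)"

definition quasi_lattice_ordered :: "'p :: group_add set \<Rightarrow> bool"
  where "quasi_lattice_ordered P \<longleftrightarrow>
    (\<forall>p \<in> P. \<forall>q \<in> P. p + q \<in> P) \<and> P \<inter> uminus ` P = {0} \<and>
    (\<forall>p q. common_upper_bounds P p q \<noteq> {} \<longrightarrow> (\<exists>r. is_join P p q r))"

definition join_finite :: "'p :: group_add set \<Rightarrow> 'p \<Rightarrow> 'p \<Rightarrow> bool"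
  where "join_finite P p q \<longleftrightarrow> common_upper_bounds P p q \<noteq> {}"

definition join :: "'p :: group_add set \<Rightarrow> 'p \<Rightarrow> 'p \<Rightarrow> 'p"
  where "join P p q = (THE r. is_join P p q r)"


section \<open>Product systems\<close>

text \<open>
  The data of a product system. Every fibre is a set of elements of one ambient vector space, and
  all operations carry the indices of the fibres they act on, so that fibres over different
  indices need not be disjoint. The fibre over \<open>0\<close> is the coefficient algebra \<open>A\<close>, its product is
  \<open>ps_mult X 0 0\<close> and its involution \<open>ps_star X\<close>; the left and right actions of \<open>A\<close> on the fibre
  over \<open>p\<close> are \<open>ps_mult X 0 p\<close> and \<open>ps_mult X p 0\<close>.
\<close>

record ('p, 'x) product_system =
  fibre :: "'p \<Rightarrow> 'x set"
  ps_mult :: "'p \<Rightarrow> 'p \<Rightarrow> 'x \<Rightarrow> 'x \<Rightarrow> 'x"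
  ps_inner :: "'p \<Rightarrow> 'x \<Rightarrow> 'x \<Rightarrow> 'x"
  ps_star :: "'x \<Rightarrow> 'x"

definition fibre_norm :: "('p, 'x :: complex_normed_vector) product_system \<Rightarrow> 'p \<Rightarrow> 'x \<Rightarrow> real"
  where "fibre_norm X p x = sqrt (norm (ps_inner X p x x))"

text \<open>Operators on a fibre are functions that are \<^const>\<open>undefined\<close> outside of it.\<close>

definition adjoint_pair :: "('p, 'x) product_system \<Rightarrow> 'p \<Rightarrow> ('x \<Rightarrow> 'x) \<Rightarrow> ('x \<Rightarrow> 'x) \<Rightarrow> bool"
  where "adjoint_pair X p S T \<longleftrightarrow>
    S \<in> fibre X p \<rightarrow>\<^sub>E fibre X p \<and> T \<in> fibre X p \<rightarrow>\<^sub>E fibre X p \<and>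
    (\<forall>x \<in> fibre X p. \<forall>y \<in> fibre X p. ps_inner X p (S x) y = ps_inner X p x (T y))"

definition adjointable :: "('p, 'x) product_system \<Rightarrow> 'p \<Rightarrow> ('x \<Rightarrow> 'x) set"
  where "adjointable X p = {S. \<exists>T. adjoint_pair X p S T}"

definition rank_one :: "('p :: group_add, 'x) product_system \<Rightarrow> 'p \<Rightarrow> 'x \<Rightarrow> 'x \<Rightarrow> 'x \<Rightarrow> 'x"
  where "rank_one X p x y = (\<lambda>z \<in> fibre X p. ps_mult X p 0 x (ps_inner X p y z))"

definition finite_rank ::
    "('p :: group_add, 'x :: complex_normed_vector) product_system \<Rightarrow> 'p \<Rightarrow> ('x \<Rightarrow> 'x) set"
  where "finite_rank X p =
    {\<lambda>z \<in> fibre X p. \<Sum>i<n. a i *\<^sub>C rank_one X p (x i) (y i) z | (n :: nat) a x y.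
      \<forall>i<n. x i \<in> fibre X p \<and> y i \<in> fibre X p}"

definition op_norm_le ::
    "('p, 'x :: complex_normed_vector) product_system \<Rightarrow> 'p \<Rightarrow> ('x \<Rightarrow> 'x) \<Rightarrow> real \<Rightarrow> bool"
  where "op_norm_le X p T C \<longleftrightarrow>
    0 \<le> C \<and> (\<forall>z \<in> fibre X p. fibre_norm X p (T z) \<le> C * fibre_norm X p z)"

definition compacts ::
    "('p :: group_add, 'x :: complex_normed_vector) product_system \<Rightarrow> 'p \<Rightarrow> ('x \<Rightarrow> 'x) set"
  where "compacts X p =
    {T \<in> adjointable X p. \<forall>e>0. \<exists>S \<in> finite_rank X p. op_norm_le X p (\<lambda>z. T z - S z) e}"

definition left_action :: "('p :: group_add, 'x) product_system \<Rightarrow> 'p \<Rightarrow> 'x \<Rightarrow> 'x \<Rightarrow> 'x"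
  where "left_action X p a = (\<lambda>x \<in> fibre X p. ps_mult X 0 p a x)"

text \<open>
  \<open>iota X p q\<close> is the homomorphism \<open>\<iota>\<^sub>p\<^sup>p\<^sup>q\<close> into the operators on the fibre over \<open>p + q\<close>. For \<open>p = 0\<close>
  the element \<open>a\<close> of \<open>A\<close> is identified with the compact operator \<open>b \<mapsto> ab\<close> on the fibre over \<open>0\<close>.
\<close>

definition iota ::
    "('p :: group_add, 'x) product_system \<Rightarrow> 'p \<Rightarrow> 'p \<Rightarrow> ('x \<Rightarrow> 'x) \<Rightarrow> 'x \<Rightarrow> 'x"
  where "iota X p q S =
    (if p = 0
     then (THE R. \<exists>a \<in> fibre X 0. S = left_action X 0 a \<and> R = left_action X q a)
     else (THE R. R \<in> adjointable X (p + q) \<and>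
       (\<forall>x \<in> fibre X p. \<forall>y \<in> fibre X q. R (ps_mult X p q x y) = ps_mult X p q (S x) y)))"

definition iota_prod ::
    "'p :: group_add set \<Rightarrow> ('p, 'x) product_system \<Rightarrow> 'p \<Rightarrow> 'p \<Rightarrow> ('x \<Rightarrow> 'x) \<Rightarrow> ('x \<Rightarrow> 'x) \<Rightarrow> 'x \<Rightarrow> 'x"
  where "iota_prod P X p q S T =
    compose (fibre X (join P p q)) (iota X p (- p + join P p q) S) (iota X q (- q + join P p q) T)"

definition compactly_aligned ::
    "'p :: group_add set \<Rightarrow> ('p, 'x :: complex_normed_vector) product_system \<Rightarrow> bool"
  where "compactly_aligned P X \<longleftrightarrow>
    (\<forall>p \<in> P. \<forall>q \<in> P. join_finite P p q \<longrightarrow>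
      (\<forall>S \<in> compacts X p. \<forall>T \<in> compacts X q. iota_prod P X p q S T \<in> compacts X (join P p q)))"

text \<open>
  Representations take values in a C*-subalgebra \<open>B\<close> of the ambient C*-algebra. Multiplicativity of
  \<open>\<psi> 0\<close> is the case \<open>p = q = 0\<close> of the fourth condition.
\<close>

definition representation ::
    "'p :: group_add set \<Rightarrow> ('p, 'x :: complex_normed_vector) product_system \<Rightarrow>
      'b :: cstar_algebra set \<Rightarrow> ('p \<Rightarrow> 'x \<Rightarrow> 'b) \<Rightarrow> bool"
  where "representation P X B \<psi> \<longleftrightarrow>
    (\<forall>p \<in> P. \<forall>x \<in> fibre X p. \<psi> p x \<in> B) \<and>
    (\<forall>p \<in> P. \<forall>x \<in> fibre X p. \<forall>y \<in> fibre X p. \<forall>a.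
      \<psi> p (x + y) = \<psi> p x + \<psi> p y \<and> \<psi> p (a *\<^sub>C x) = a *\<^sub>C \<psi> p x) \<and>
    (\<forall>x \<in> fibre X 0. \<psi> 0 (ps_star X x) = (\<psi> 0 x)\<^sup>\<star>) \<and>
    (\<forall>p \<in> P. \<forall>q \<in> P. \<forall>x \<in> fibre X p. \<forall>y \<in> fibre X q.
      \<psi> p x * \<psi> q y = \<psi> (p + q) (ps_mult X p q x y)) \<and>
    (\<forall>p \<in> P. \<forall>x \<in> fibre X p. \<forall>y \<in> fibre X p.
      (\<psi> p x)\<^sup>\<star> * \<psi> p y = \<psi> 0 (ps_inner X p x y))"

text \<open>
  A homomorphism of C*-algebras is automatically norm-decreasing; the bound is stated so that the
  homomorphism is visibly determined by its values on the rank-one operators.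
\<close>

definition compacts_hom ::
    "('p :: group_add, 'x :: complex_normed_vector) product_system \<Rightarrow>
      'b :: cstar_algebra set \<Rightarrow> 'p \<Rightarrow> (('x \<Rightarrow> 'x) \<Rightarrow> 'b) \<Rightarrow> bool"
  where "compacts_hom X B p h \<longleftrightarrow>
    h \<in> compacts X p \<rightarrow>\<^sub>E B \<and>
    (\<forall>S \<in> compacts X p. \<forall>T \<in> compacts X p. h (\<lambda>z \<in> fibre X p. S z + T z) = h S + h T) \<and>
    (\<forall>a. \<forall>S \<in> compacts X p. h (\<lambda>z \<in> fibre X p. a *\<^sub>C S z) = a *\<^sub>C h S) \<and>
    (\<forall>S \<in> compacts X p. \<forall>T \<in> compacts X p. h (compose (fibre X p) S T) = h S * h T) \<and>
    (\<forall>S \<in> compacts X p. \<forall>T \<in> compacts X p. adjoint_pair X p S T \<longrightarrow> h T = (h S)\<^sup>\<star>) \<and>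
    (\<forall>S \<in> compacts X p. \<forall>C. op_norm_le X p S C \<longrightarrow> norm (h S) \<le> C)"

definition rep_compacts ::
    "('p :: group_add, 'x :: complex_normed_vector) product_system \<Rightarrow>
      'b :: cstar_algebra set \<Rightarrow> ('p \<Rightarrow> 'x \<Rightarrow> 'b) \<Rightarrow> 'p \<Rightarrow> ('x \<Rightarrow> 'x) \<Rightarrow> 'b"
  where "rep_compacts X B \<psi> p =
    (THE h. compacts_hom X B p h \<and>
      (\<forall>x \<in> fibre X p. \<forall>y \<in> fibre X p. h (rank_one X p x y) = \<psi> p x * (\<psi> p y)\<^sup>\<star>))"

definition nica_covariant ::
    "'p :: group_add set \<Rightarrow> ('p, 'x :: complex_normed_vector) product_system \<Rightarrow>
      'b :: cstar_algebra set \<Rightarrow> ('p \<Rightarrow> 'x \<Rightarrow> 'b) \<Rightarrow> bool"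
  where "nica_covariant P X B \<psi> \<longleftrightarrow>
    representation P X B \<psi> \<and>
    (\<forall>p \<in> P. \<forall>q \<in> P. \<forall>S \<in> compacts X p. \<forall>T \<in> compacts X q.
      rep_compacts X B \<psi> p S * rep_compacts X B \<psi> q T =
        (if join_finite P p q then rep_compacts X B \<psi> (join P p q) (iota_prod P X p q S T) else 0))"


section \<open>Groupoids\<close>

text \<open>The arrows of a groupoid form a whole type; units are identified with their identity arrows.\<close>

record 'g groupoid =
  composable :: "('g \<times> 'g) set"
  gmult :: "'g \<Rightarrow> 'g \<Rightarrow> 'g"
  ginv :: "'g \<Rightarrow> 'g"

definition is_groupoid :: "'g groupoid \<Rightarrow> bool"
  where "is_groupoid G \<longleftrightarrow>
    (\<forall>a b c. (a, b) \<in> composable G \<longrightarrow> (b, c) \<in> composable G \<longrightarrow>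
      (gmult G a b, c) \<in> composable G \<and> (a, gmult G b c) \<in> composable G \<and>
      gmult G (gmult G a b) c = gmult G a (gmult G b c)) \<and>
    (\<forall>a. ginv G (ginv G a) = a \<and> (a, ginv G a) \<in> composable G) \<and>
    (\<forall>a b. (a, b) \<in> composable G \<longrightarrow>
      gmult G (ginv G a) (gmult G a b) = b \<and> gmult G (gmult G a b) (ginv G b) = a)"

definition grange :: "'g groupoid \<Rightarrow> 'g \<Rightarrow> 'g"
  where "grange G a = gmult G a (ginv G a)"

definition topological_groupoid :: "'g :: topological_space groupoid \<Rightarrow> bool"
  where "topological_groupoid G \<longleftrightarrow> is_groupoid G \<and>
    continuous_on (composable G) (\<lambda>(a, b). gmult G a b) \<and> continuous_on UNIV (ginv G)"

text \<open>Etale: the range map is a local homeomorphism onto the unit space.\<close>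

definition etale_groupoid :: "'g :: topological_space groupoid \<Rightarrow> bool"
  where "etale_groupoid G \<longleftrightarrow> topological_groupoid G \<and>
    (\<forall>a. \<exists>U. open U \<and> a \<in> U \<and>
      openin (top_of_set (range (grange G))) (grange G ` U) \<and>
      (\<exists>h. homeomorphism U (grange G ` U) (grange G) h))"

definition cocycle :: "'g groupoid \<Rightarrow> ('g \<Rightarrow> 'p :: group_add) \<Rightarrow> bool"
  where "cocycle G c \<longleftrightarrow> (\<forall>(a, b) \<in> composable G. c (gmult G a b) = c a + c b)"

definition unperforated :: "'p :: group_add set \<Rightarrow> 'g groupoid \<Rightarrow> ('g \<Rightarrow> 'p) \<Rightarrow> bool"
  where "unperforated P G c \<longleftrightarrow>
    (\<forall>p \<in> P. \<forall>q \<in> P. \<forall>a. c a = p + q \<longrightarrow>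
      (\<exists>(a', a'') \<in> composable G. c a' = p \<and> c a'' = q \<and> a = gmult G a' a''))"

definition Cc :: "'g :: topological_space set \<Rightarrow> ('g \<Rightarrow> complex) set"
  where "Cc U = {f. continuous_on UNIV f \<and> compact (closure {a. f a \<noteq> 0}) \<and> closure {a. f a \<noteq> 0} \<subseteq> U}"

text \<open>
  The direct sum over all units \<open>x\<close> of the left regular representations of \<open>Cc UNIV\<close> on
  \<open>\<ell>\<^sup>2(Gx)\<close>, where \<open>Gx\<close> is the set of arrows with source \<open>x\<close>: convolution by \<open>f\<close> on \<open>\<ell>\<^sup>2\<close> of the
  disjoint union of all \<open>Gx\<close>. For \<open>f\<close> in \<open>Cc UNIV\<close> the sum has finitely many nonzero terms.
\<close>

definition left_regular :: "'g groupoid \<Rightarrow> ('g \<Rightarrow> complex) \<Rightarrow> 'g ell2_op"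
  where "left_regular G f =
    (THE T. \<forall>\<xi> c. ell2_apply (op_apply T \<xi>) c =
      (\<Sum>\<^sub>\<infinity>(a, b) \<in> {(a, b) \<in> composable G. gmult G a b = c}. f a * ell2_apply \<xi> b))"

definition reduced_cstar :: "'g :: topological_space groupoid \<Rightarrow> 'g ell2_op set"
  where "reduced_cstar G = closure (left_regular G ` Cc UNIV)"

definition groupoid_product_system ::
    "'g :: topological_space groupoid \<Rightarrow> ('g \<Rightarrow> 'p) \<Rightarrow> ('p, 'g ell2_op) product_system"
  where "groupoid_product_system G c =
    \<lparr>fibre = (\<lambda>p. closure (left_regular G ` Cc (c -` {p}))),
     ps_mult = (\<lambda>p q x y. x * y),
     ps_inner = (\<lambda>p x y. x\<^sup>\<star> * y),
     ps_star = star\<rparr>"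

definition range_condition :: "'p :: group_add set \<Rightarrow> 'g groupoid \<Rightarrow> ('g \<Rightarrow> 'p) \<Rightarrow> bool"
  where "range_condition P G c \<longleftrightarrow>
    (\<forall>p \<in> P. \<forall>q \<in> P. grange G ` (c -` {p}) \<inter> grange G ` (c -` {q}) =
      (if join_finite P p q then grange G ` (c -` {join P p q}) else {}))"

end

theory Submission
  imports Defs
begin

text \<open>
  The fibre of the product system over \<open>p\<close> is a subspace \<open>A p\<close> of operators on the square-summable
  families indexed by the arrows, and the rank-one operator given by \<open>x\<close> and \<open>y\<close> in \<open>A p\<close> is left
  multiplication by \<open>x y\<^sup>\<star>\<close>. Let \<open>K p\<close> be the closed span of the products \<open>x y\<^sup>\<star>\<close> with \<open>x, y\<close> in \<open>A p\<close>.
  Left multiplication represents \<open>K p\<close> isometrically on \<open>A p\<close>, so the compact operators on the fibre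
  are exactly the left multiplications by elements of \<open>K p\<close> (\<open>compacts_eq\<close>). Under this
  identification the homomorphism belonging to the inclusion is the identity of \<open>K p\<close>
  (\<open>rep_compacts_inclusion\<close>), and the maps \<open>\<iota>\<close> change nothing but the fibre on which \<open>k\<close> acts
  (\<open>iota_lmult\<close>). With \<open>t\<close> the join of \<open>p\<close> and \<open>q\<close>, compact alignment and Nica covariance
  become statements about the products \<open>k l\<close> with \<open>k\<close> in \<open>K p\<close> and \<open>l\<close> in \<open>K q\<close>: if \<open>k l\<close> lies in
  \<open>K t\<close> for all these products, then the system is compactly aligned, and if it is compactly aligned
  and the inclusion is Nica covariant, then \<open>k l\<close> lies in \<open>K t\<close>, or is \<open>0\<close> if there is no join.

  The range condition yields such products through local units. Let \<open>\<phi>\<close> be supported in a bisection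
  of degree \<open>t\<close>. Then \<open>\<phi> \<phi>\<^sup>\<star>\<close> acts as multiplication by a function of the range of an arrow, and a
  partition of unity provides for every compact set of ranges of arrows of degree \<open>t\<close> an element
  of \<open>K t\<close> that acts as the identity over this set (\<open>local_unit\<close>). In a product
  \<open>(f\<^sub>1 f\<^sub>2\<^sup>\<star>) (g\<^sub>1 g\<^sub>2\<^sup>\<star>)\<close> the two middle factors meet only over ranges that belong both to arrows of degree
  \<open>p\<close> and to arrows of degree \<open>q\<close>, hence to arrows of degree \<open>t\<close>; inserting a local unit
  between them shows that the product is in \<open>K t\<close> (\<open>K_mult_K\<close>). The same local units show that products
  \<open>x y\<close> with \<open>x\<close> in \<open>A p\<close> and \<open>y\<close> in \<open>A q\<close> span a dense subspace of \<open>A (p + q)\<close>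
  (\<open>products_dense\<close>), which makes the maps \<open>\<iota>\<close> well defined.

  Conversely let the unit \<open>u\<close> be the range of arrows of degrees \<open>p\<close> and \<open>q\<close>. Nonnegative bump
  functions at these arrows give \<open>k\<close> in \<open>K p\<close> and \<open>l\<close> in \<open>K q\<close> with nonnegative matrix
  entries and with positive diagonal entry at \<open>u\<close> (\<open>positive_element_at_range\<close>), so the entry of \<open>k l\<close>
  at \<open>u\<close> does not vanish. Hence \<open>p\<close> and \<open>q\<close> have a join \<open>t\<close>, and \<open>u\<close> is the range of an arrow of
  degree \<open>t\<close> because otherwise all elements of \<open>K t\<close> have entry \<open>0\<close> at \<open>u\<close> (\<open>K_entry_zero\<close>). The
  other inclusion comes from factorising arrows: an arrow whose degree is the join of \<open>p\<close> and \<open>q\<close> has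
  a first factor of degree \<open>p\<close>, and one of degree \<open>q\<close>, with the same range (\<open>unperforated_range\<close>).
\<close>

section \<open>The involution of a C*-algebra\<close>

lemma star_zero [simp]: "(0 :: 'b :: cstar_algebra)\<^sup>\<star> = 0"
  using star_add[of "0 :: 'b" 0] by simp

lemma star_uminus: "(- x)\<^sup>\<star> = - (x\<^sup>\<star> :: 'b :: cstar_algebra)"
  using star_add[of x "- x"] by (simp add: eq_neg_iff_add_eq_0 add.commute)

lemma star_diff: "(x - y)\<^sup>\<star> = x\<^sup>\<star> - (y\<^sup>\<star> :: 'b :: cstar_algebra)"
  using star_add[of x "- y"] by (simp add: star_uminus)

lemma norm_star [simp]: "norm (x\<^sup>\<star>) = norm (x :: 'b :: cstar_algebra)"
proof -
  have le: "norm x \<le> norm (x\<^sup>\<star>)" for x :: 'b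
  proof (cases "x = 0")
    case False
    have "norm x * norm x \<le> norm (x\<^sup>\<star>) * norm x"
      using cstar_identity[of x] norm_mult_ineq[of "x\<^sup>\<star>" x] by (simp add: power2_eq_square)
    then show ?thesis using False by (simp add: mult_right_le_imp_le)
  qed simp
  from le[of x] le[of "x\<^sup>\<star>"] show ?thesis by (simp add: star_star)
qed

lemma bounded_linear_star: "bounded_linear (star :: 'b :: cstar_algebra \<Rightarrow> 'b)"
  by (rule bounded_linear_intro[of _ 1]) (simp_all add: star_add scaleR_scaleC star_scaleC)

lemma star_mult_eq_0_iff: "x\<^sup>\<star> * x = 0 \<longleftrightarrow> x = (0 :: 'b :: cstar_algebra)"
  using cstar_identity[of x] by auto

text \<open>
  Statements about spans and about compactly supported functions pass to norm closures in this form,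
  because a closed set has a closed preimage.
\<close>

lemma bounded_linear_closure_in:
  assumes f: "bounded_linear f" and x: "x \<in> closure S"
    and S: "\<And>y. y \<in> S \<Longrightarrow> f y \<in> T" and T: "closed T"
  shows "f x \<in> T"
proof -
  have "closed (f -` T)"
    by (intro closed_vimage T linear_continuous_on continuous_at_imp_continuous_on ballI linear_continuous_at f)
  then have "closure S \<subseteq> f -` T" using S by (intro closure_minimal) auto
  with x show ?thesis by auto
qed

lemma subspace_closure:
  fixes S :: "'a :: real_normed_vector set"
  assumes S: "subspace S"
  shows "subspace (closure S)"
proof (rule subspaceI)
  show "0 \<in> closure S" using subspace_0[OF S] closure_subset by blast
  fix x assume "x \<in> closure S"
  then obtain u where u: "\<And>n. u n \<in> S" "u \<longlonglongrightarrow> x" unfolding closure_sequential by blast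
  show "c *\<^sub>R x \<in> closure S" for c
    unfolding closure_sequential
    by (rule exI[of _ "\<lambda>n. c *\<^sub>R u n"]) (intro conjI allI subspace_scale[OF S] u tendsto_intros)
  fix y assume "y \<in> closure S"
  then obtain v where v: "\<And>n. v n \<in> S" "v \<longlonglongrightarrow> y" unfolding closure_sequential by blast
  show "x + y \<in> closure S"
    unfolding closure_sequential
    by (rule exI[of _ "\<lambda>n. u n + v n"]) (intro conjI allI subspace_add[OF S] u v tendsto_intros)
qed

section \<open>Product systems inside a C*-algebra\<close>

text \<open>
  The spectral subspaces of a grading of a C*-algebra, which form a Fell bundle over the group. The
  degrees range over the whole group and not only over a positive cone, because the adjoint of an
  element of degree \<open>g\<close> has degree \<open>- g\<close>; in particular \<open>x y\<^sup>\<star>\<close> has degree \<open>0\<close> for \<open>x, y\<close> of equal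
  degree.
\<close>

locale graded_subspaces =
  fixes A :: "'p :: group_add \<Rightarrow> 'b :: cstar_algebra set"
  assumes closed_fibre: "closed (A g)"
    and zero_fibre: "0 \<in> A g"
    and add_fibre: "x \<in> A g \<Longrightarrow> y \<in> A g \<Longrightarrow> x + y \<in> A g"
    and scaleC_fibre: "x \<in> A g \<Longrightarrow> a *\<^sub>C x \<in> A g"
    and mult_fibre: "x \<in> A g \<Longrightarrow> y \<in> A h \<Longrightarrow> x * y \<in> A (g + h)"
    and star_fibre: "x \<in> A g \<Longrightarrow> x\<^sup>\<star> \<in> A (- g)"
begin

abbreviation X :: "('p, 'b) product_system"
  where "X \<equiv> \<lparr>fibre = A, ps_mult = (\<lambda>p q x y. x * y), ps_inner = (\<lambda>p x y. x\<^sup>\<star> * y), ps_star = star\<rparr>"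

definition finite_K :: "'p \<Rightarrow> 'b set"
  where "finite_K p = span {x * y\<^sup>\<star> | x y. x \<in> A p \<and> y \<in> A p}"

definition K :: "'p \<Rightarrow> 'b set"
  where "K p = closure (finite_K p)"

text \<open>Restricted to the fibre, in agreement with the encoding of operators on fibres.\<close>

definition lmult :: "'p \<Rightarrow> 'b \<Rightarrow> 'b \<Rightarrow> 'b"
  where "lmult p k = (\<lambda>z \<in> A p. k * z)"

lemma scaleR_fibre: "x \<in> A g \<Longrightarrow> r *\<^sub>R x \<in> A g"
  by (simp add: scaleR_scaleC scaleC_fibre)

lemma subspace_fibre: "subspace (A g)"
  by (auto intro: subspaceI zero_fibre add_fibre scaleR_fibre)

lemma diff_fibre: "x \<in> A g \<Longrightarrow> y \<in> A g \<Longrightarrow> x - y \<in> A g"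
  by (rule subspace_diff[OF subspace_fibre])

lemma mult_star_fibre: "x \<in> A g \<Longrightarrow> y \<in> A g \<Longrightarrow> x * y\<^sup>\<star> \<in> A 0"
  using mult_fibre[OF _ star_fibre, of x g y g] by simp

lemma coeff_mult_fibre: "a \<in> A 0 \<Longrightarrow> x \<in> A g \<Longrightarrow> a * x \<in> A g"
  using mult_fibre[of a 0 x g] by simp

lemma finite_K_base: "x \<in> A p \<Longrightarrow> y \<in> A p \<Longrightarrow> x * y\<^sup>\<star> \<in> finite_K p"
  unfolding finite_K_def by (rule span_base) blast

lemma finite_K_induct [consumes 1, case_names zero add base]:
  assumes "k \<in> finite_K p" "P 0" "\<And>k l. P k \<Longrightarrow> P l \<Longrightarrow> P (k + l)"
    "\<And>x y. x \<in> A p \<Longrightarrow> y \<in> A p \<Longrightarrow> P (x * y\<^sup>\<star>)"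
  shows "P k"
  using assms(1) unfolding finite_K_def
proof (induction rule: span_induct_alt)
  case (step c v w)
  then obtain x y where xy: "v = x * y\<^sup>\<star>" "x \<in> A p" "y \<in> A p" by blast
  have "P ((c *\<^sub>R x) * y\<^sup>\<star>)" by (intro assms(4) scaleR_fibre xy)
  with step(2) show ?case by (simp add: assms(3) xy(1))
qed (rule assms(2))

lemma finite_K_subset_K: "finite_K p \<subseteq> K p"
  unfolding K_def by (rule closure_subset)

lemma subspace_finite_K: "subspace (finite_K p)"
  unfolding finite_K_def by (rule subspace_span)

lemma subspace_K: "subspace (K p)"
  unfolding K_def by (intro subspace_closure subspace_finite_K)

lemma closed_K: "closed (K p)"
  unfolding K_def by simp

lemma K_base: "x \<in> A p \<Longrightarrow> y \<in> A p \<Longrightarrow> x * y\<^sup>\<star> \<in> K p"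
  using finite_K_base finite_K_subset_K by blast

lemma finite_K_scaleC: "k \<in> finite_K p \<Longrightarrow> a *\<^sub>C k \<in> finite_K p"
proof (induction rule: finite_K_induct)
  case (base x y)
  then show ?case
    using finite_K_base[OF scaleC_fibre[of x p a], of y] by (simp add: mult_scaleC_left)
next
  case zero
  then show ?case
    using subspace_0[OF subspace_finite_K] by (simp add: bounded_linear_scaleC[THEN linear_simps(3)])
qed (simp add: scaleC_add_right subspace_add[OF subspace_finite_K])

lemma K_continuous_induct:
  assumes "bounded_linear f" "k \<in> K p" "\<And>k. k \<in> finite_K p \<Longrightarrow> f k \<in> T" "closed T"
  shows "f k \<in> T"
  using bounded_linear_closure_in[OF assms(1) assms(2)[unfolded K_def] assms(3,4)] .

lemma K_scaleC: "k \<in> K p \<Longrightarrow> a *\<^sub>C k \<in> K p"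
  by (erule K_continuous_induct[OF bounded_linear_scaleC _ _ closed_K])
    (simp add: finite_K_scaleC finite_K_subset_K[THEN subsetD])

lemma K_star: "k \<in> K p \<Longrightarrow> k\<^sup>\<star> \<in> K p"
proof -
  have "k\<^sup>\<star> \<in> finite_K p" if "k \<in> finite_K p" for k
    using that
    by (induction rule: finite_K_induct)
      (auto simp: star_add star_mult star_star intro: finite_K_base subspace_add subspace_0 subspace_finite_K)
  then show "k \<in> K p \<Longrightarrow> k\<^sup>\<star> \<in> K p"
    by (elim K_continuous_induct[OF bounded_linear_star _ _ closed_K])
      (simp add: finite_K_subset_K[THEN subsetD])
qed

lemma K_subset_coeff: "K p \<subseteq> A 0"
proof -
  have "k \<in> A 0" if "k \<in> finite_K p" for k
    using that by (induction rule: finite_K_induct) (auto intro: zero_fibre add_fibre mult_star_fibre)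
  then show ?thesis unfolding K_def by (intro closure_minimal closed_fibre) blast
qed

lemma K_mult_fibre: "k \<in> K p \<Longrightarrow> x \<in> A g \<Longrightarrow> k * x \<in> A g"
  using K_subset_coeff coeff_mult_fibre by blast

lemma coeff_mult_finite_K:
  assumes "a \<in> A 0" "k \<in> finite_K p" shows "a * k \<in> finite_K p"
  using assms(2)
proof (induction rule: finite_K_induct)
  case (base x y)
  then show ?case
    using finite_K_base[OF coeff_mult_fibre[OF assms(1)], of x p y] by (simp add: mult.assoc)
qed (auto simp: distrib_left intro: subspace_add subspace_0 subspace_finite_K)

lemma coeff_mult_K: "a \<in> A 0 \<Longrightarrow> k \<in> K p \<Longrightarrow> a * k \<in> K p"
  by (erule K_continuous_induct[OF bounded_linear_mult_right _ _ closed_K])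
    (simp add: coeff_mult_finite_K finite_K_subset_K[THEN subsetD])

text \<open>
  For \<open>j = x y\<^sup>\<star>\<close> one has \<open>norm (w j) \<le> norm (w x) * norm y\<close>, which is controlled by the action of
  \<open>w\<close> on the fibre. The constant \<open>M\<close> depends on \<open>j\<close>, but not on \<open>w\<close>.
\<close>

lemma finite_K_norm_right_mult:
  assumes "j \<in> finite_K p"
  shows "\<exists>M\<ge>0. \<forall>w C. 0 \<le> C \<longrightarrow> (\<forall>z \<in> A p. norm (w * z) \<le> C * norm z) \<longrightarrow> norm (w * j) \<le> C * M"
  using assms
proof (induction rule: finite_K_induct)
  case (add k l)
  from add(1) obtain M where M: "M \<ge> 0"
      "\<forall>w C. 0 \<le> C \<longrightarrow> (\<forall>z \<in> A p. norm (w * z) \<le> C * norm z) \<longrightarrow> norm (w * k) \<le> C * M"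
    by (elim exE conjE)
  from add(2) obtain N where N: "N \<ge> 0"
      "\<forall>w C. 0 \<le> C \<longrightarrow> (\<forall>z \<in> A p. norm (w * z) \<le> C * norm z) \<longrightarrow> norm (w * l) \<le> C * N"
    by (elim exE conjE)
  show ?case
  proof (intro exI[of _ "M + N"] conjI allI impI)
    fix w and C :: real assume "0 \<le> C" "\<forall>z \<in> A p. norm (w * z) \<le> C * norm z"
    then have "norm (w * k) \<le> C * M" "norm (w * l) \<le> C * N" using M(2) N(2) by simp_all
    then show "norm (w * (k + l)) \<le> C * (M + N)"
      using norm_triangle_ineq[of "w * k" "w * l"] by (simp add: distrib_left)
  qed (use M N in simp)
next
  case (base x y)
  show ?case
  proof (intro exI[of _ "norm x * norm y"] conjI allI impI)
    fix w and C :: real assume "0 \<le> C" and *: "\<forall>z \<in> A p. norm (w * z) \<le> C * norm z"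
    have "norm (w * (x * y\<^sup>\<star>)) \<le> norm (w * x) * norm y"
      using norm_mult_ineq[of "w * x" "y\<^sup>\<star>"] by (simp add: mult.assoc)
    also have "\<dots> \<le> (C * norm x) * norm y"
      using * base by (intro mult_right_mono) auto
    finally show "norm (w * (x * y\<^sup>\<star>)) \<le> C * (norm x * norm y)" by (simp add: mult.assoc)
  qed simp
qed auto

text \<open>
  The powers of \<open>t\<close> act on the fibre with norm at most \<open>D\<^sup>n\<close>, so by the previous lemma \<open>norm (t\<^sup>n)\<close>
  is at most a constant multiple of \<open>D\<^sup>n\<close>. On the other hand \<open>norm (t\<^sup>n) = (norm t)\<^sup>n\<close>
  for \<open>n = 2\<^sup>m\<close> by the C*-identity, since \<open>t\<close> is self-adjoint. Comparing the growth rates removes the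
  constant. This replaces the theorem that injective homomorphisms of C*-algebras are isometric.
\<close>

lemma selfadjoint_finite_K_norm_le:
  assumes T: "t \<in> finite_K p" "t\<^sup>\<star> = t"
    and D: "0 \<le> D" "\<And>z. z \<in> A p \<Longrightarrow> norm (t * z) \<le> D * norm z"
  shows "norm t \<le> D"
proof (rule ccontr)
  assume "\<not> norm t \<le> D"
  then have less: "D < norm t" by simp
  \<comment> \<open>\<open>pw n\<close> is the power with exponent \<open>n + 1\<close>; the algebra need not have a unit.\<close>
  define pw where "pw n = ((\<lambda>x. t * x) ^^ n) t" for n :: nat
  have pw0: "pw 0 = t" and pwS: "pw (Suc n) = t * pw n" for n by (simp_all add: pw_def)
  have pw_add: "pw m * pw n = pw (Suc (m + n))" for m n
    by (induction m) (simp_all add: pw0 pwS mult.assoc)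
  have pw_star: "(pw n)\<^sup>\<star> = pw n" for n
  proof (induction n)
    case (Suc n)
    have "(pw (Suc n))\<^sup>\<star> = pw n * pw 0" by (simp add: pwS star_mult Suc T pw0)
    then show ?case by (simp only: pw_add) simp
  qed (simp add: pw0 T)
  have norm_pw: "norm (pw (2 ^ m - 1)) = norm t ^ (2 ^ m)" for m
  proof (induction m)
    case (Suc m)
    have "Suc ((n - 1) + (n - 1)) = 2 * n - 1" if "1 \<le> n" for n :: nat
      using that by linarith
    then have "Suc ((2 ^ m - 1) + (2 ^ m - 1)) = 2 ^ Suc m - (1 :: nat)"
      by (simp only: power_Suc one_le_power one_le_numeral)
    then have "pw (2 ^ Suc m - 1) = (pw (2 ^ m - 1))\<^sup>\<star> * pw (2 ^ m - 1)"
      unfolding pw_star pw_add by simp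
    then have "norm (pw (2 ^ Suc m - 1)) = (norm t ^ (2 ^ m))\<^sup>2"
      by (simp only: cstar_identity Suc)
    also have "\<dots> = norm t ^ (2 ^ Suc m)"
      by (simp only: power_mult[symmetric] power_Suc mult.commute)
    finally show ?case .
  qed (simp add: pw0)
  have t0: "t \<in> A 0" using T finite_K_subset_K K_subset_coeff by blast
  have pw_bound: "norm (pw n * z) \<le> D ^ Suc n * norm z" if "z \<in> A p" for n z
    using that
  proof (induction n arbitrary: z)
    case (Suc n)
    have "norm (pw (Suc n) * z) = norm (pw n * (t * z))"
      using pw_add[of n 0] by (simp add: pw0 mult.assoc[symmetric])
    also have "\<dots> \<le> D ^ Suc n * norm (t * z)"
      by (intro Suc coeff_mult_fibre t0)
    also have "\<dots> \<le> D ^ Suc n * (D * norm z)"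
      by (intro mult_left_mono D Suc) (simp add: D)
    finally show ?case by (simp add: mult_ac)
  qed (simp add: pw0 D)
  obtain M where M: "M \<ge> 0"
      "\<forall>w C. 0 \<le> C \<longrightarrow> (\<forall>z \<in> A p. norm (w * z) \<le> C * norm z) \<longrightarrow> norm (w * t) \<le> C * M"
    using finite_K_norm_right_mult[OF T(1)] by (elim exE conjE)
  have growth: "norm (pw (Suc n)) \<le> D ^ Suc n * M" for n
    using M(2)[rule_format, of "D ^ Suc n" "pw n"] pw_bound[of _ n] pw_add[of n 0] D
    by (simp add: pw0)
  define q where "q = D / norm t"
  have tpos: "norm t > 0" using less D by linarith
  have q: "0 \<le> q" "q < 1" using less D tpos by (auto simp: q_def)
  have key: "norm t \<le> q ^ (2 ^ Suc m - 1) * M" for m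
  proof -
    have "n - 1 = Suc (n - 2)" if "2 \<le> n" for n :: nat
      using that by linarith
    then have e: "2 ^ Suc m - 1 = Suc (2 ^ Suc m - 2 :: nat)"
      using self_le_power[of "2 :: nat" "Suc m"] by simp
    define n where "n = 2 ^ Suc m - (1 :: nat)"
    have n: "Suc n = 2 ^ Suc m" by (simp add: n_def)
    have "norm (pw n) \<le> D ^ n * M" using growth[of "2 ^ Suc m - 2"] by (simp only: e n_def)
    moreover have "norm (pw n) = norm t ^ Suc n" using norm_pw[of "Suc m"] by (simp only: n) (simp only: n_def)
    ultimately have "norm t * norm t ^ n \<le> D ^ n * M" by simp
    then have "norm t \<le> D ^ n * M / norm t ^ n"
      using tpos by (simp add: pos_le_divide_eq)
    then show ?thesis by (simp add: q_def power_divide n_def)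
  qed
  have "(\<lambda>n. q ^ n * M) \<longlonglongrightarrow> 0 * M"
    by (intro tendsto_intros LIMSEQ_realpow_zero q)
  then obtain N where N: "\<And>n. n \<ge> N \<Longrightarrow> q ^ n * M < norm t"
    using order_tendstoD(2)[of _ "0 * M" sequentially "norm t"] tpos
    by (auto simp: eventually_sequentially)
  have "N \<le> 2 ^ Suc N - (1 :: nat)"
    using less_exp[of "Suc N"] by linarith
  from N[OF this] key[of N] show False by simp
qed

text \<open>The general case is reduced to the self-adjoint element \<open>k\<^sup>\<star>k\<close>, with bound \<open>C\<^sup>2\<close>.\<close>

lemma finite_K_norm_le:
  assumes k: "k \<in> finite_K p" and C: "0 \<le> C" "\<And>z. z \<in> A p \<Longrightarrow> norm (k * z) \<le> C * norm z"
  shows "norm k \<le> C"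
proof -
  have kK: "k \<in> K p" "k\<^sup>\<star> \<in> A 0"
    using k finite_K_subset_K K_star K_subset_coeff by blast+
  have "norm (k\<^sup>\<star> * k) \<le> C\<^sup>2"
  proof (rule selfadjoint_finite_K_norm_le)
    show "k\<^sup>\<star> * k \<in> finite_K p" by (rule coeff_mult_finite_K[OF kK(2) k])
    show "(k\<^sup>\<star> * k)\<^sup>\<star> = k\<^sup>\<star> * k" by (simp add: star_mult star_star)
    fix z assume z: "z \<in> A p"
    \<comment> \<open>The adjoint has the same bound on the fibre, since \<open>(k\<^sup>\<star>w)\<^sup>\<star>(k\<^sup>\<star>w) = w\<^sup>\<star>(k(k\<^sup>\<star>w))\<close>.\<close>
    have adj: "norm (k\<^sup>\<star> * w) \<le> C * norm w" if "w \<in> A p" for w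
    proof (cases "k\<^sup>\<star> * w = 0")
      case False
      have "norm (k\<^sup>\<star> * w) * norm (k\<^sup>\<star> * w) = norm (w\<^sup>\<star> * (k * (k\<^sup>\<star> * w)))"
        using cstar_identity[of "k\<^sup>\<star> * w"] by (simp add: star_mult star_star mult.assoc power2_eq_square)
      also have "\<dots> \<le> norm w * norm (k * (k\<^sup>\<star> * w))"
        using norm_mult_ineq[of "w\<^sup>\<star>"] by simp
      also have "\<dots> \<le> norm w * (C * norm (k\<^sup>\<star> * w))"
        by (intro mult_left_mono C coeff_mult_fibre kK that) simp
      finally show ?thesis using False by (simp add: mult_ac)
    qed (use C in simp)
    have kz: "k * z \<in> A p" using K_mult_fibre[OF kK(1) z] .
    have "norm (k\<^sup>\<star> * k * z) \<le> C * norm (k * z)" using adj[OF kz] by (simp add: mult.assoc)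
    also have "\<dots> \<le> C * (C * norm z)" by (intro mult_left_mono C z)
    finally show "norm (k\<^sup>\<star> * k * z) \<le> C\<^sup>2 * norm z" by (simp add: power2_eq_square mult.assoc)
  qed simp
  then have "(norm k)\<^sup>2 \<le> C\<^sup>2" by (simp only: cstar_identity)
  then show ?thesis using C(1) by (rule power2_le_imp_le)
qed

lemma K_norm_le:
  assumes k: "k \<in> K p" and C: "0 \<le> C" "\<And>z. z \<in> A p \<Longrightarrow> norm (k * z) \<le> C * norm z"
  shows "norm k \<le> C"
proof (rule field_le_epsilon)
  fix e :: real assume "0 < e"
  from k have "\<forall>e>0. \<exists>l\<in>finite_K p. dist l k < e" by (simp only: K_def closure_approachable)
  with half_gt_zero[OF \<open>0 < e\<close>] obtain l where l: "l \<in> finite_K p" "dist l k < e / 2" by blast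
  have "norm l \<le> C + norm (l - k)"
  proof (rule finite_K_norm_le[OF l(1)])
    fix z assume "z \<in> A p"
    have "norm (l * z) \<le> norm (k * z) + norm ((l - k) * z)"
      using norm_triangle_ineq[of "k * z" "(l - k) * z"] by (simp add: left_diff_distrib)
    also have "\<dots> \<le> C * norm z + norm (l - k) * norm z"
      by (intro add_mono C \<open>z \<in> A p\<close> norm_mult_ineq)
    finally show "norm (l * z) \<le> (C + norm (l - k)) * norm z" by (simp add: distrib_right)
  qed (use C in simp)
  moreover have "norm k \<le> norm l + norm (l - k)"
    using norm_triangle_ineq4[of l "l - k"] by simp
  ultimately show "norm k \<le> C + e" using l(2) by (simp add: dist_norm)
qed

lemma K_eq_0: "k \<in> K p \<Longrightarrow> (\<And>z. z \<in> A p \<Longrightarrow> k * z = 0) \<Longrightarrow> k = 0"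
  using K_norm_le[of k p 0] by simp

lemma lmult_inject: "k \<in> K p \<Longrightarrow> l \<in> K p \<Longrightarrow> lmult p k = lmult p l \<Longrightarrow> k = l"
proof -
  assume kl: "k \<in> K p" "l \<in> K p" and eq: "lmult p k = lmult p l"
  have "k - l = 0"
  proof (rule K_eq_0)
    show "k - l \<in> K p" by (rule subspace_diff[OF subspace_K kl])
    fix z assume "z \<in> A p"
    then show "(k - l) * z = 0" using fun_cong[OF eq, of z] by (simp add: lmult_def left_diff_distrib)
  qed
  then show ?thesis by simp
qed

lemma fibre_norm_X [simp]: "fibre_norm X p x = norm x"
  by (simp add: fibre_norm_def cstar_identity)

lemma op_norm_le_lmult_iff:
  "k \<in> K p \<Longrightarrow> op_norm_le X p (lmult p k) C \<longleftrightarrow> norm k \<le> C"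
proof
  assume k: "k \<in> K p"
  show "norm k \<le> C" if "op_norm_le X p (lmult p k) C"
    using that by (intro K_norm_le[OF k]) (auto simp: op_norm_le_def lmult_def)
  show "op_norm_le X p (lmult p k) C" if "norm k \<le> C"
  proof -
    have "norm (k * z) \<le> C * norm z" for z
      using norm_mult_ineq[of k z] mult_right_mono[OF that norm_ge_zero, of z] by linarith
    moreover have "0 \<le> C" using that norm_ge_zero[of k] by linarith
    ultimately show ?thesis by (simp add: op_norm_le_def lmult_def)
  qed
qed

lemma coeff_lmult_adjoint_pair:
  assumes "a \<in> A 0" shows "adjoint_pair X p (lmult p a) (lmult p (a\<^sup>\<star>))"
proof -
  have "a\<^sup>\<star> \<in> A 0" using star_fibre[OF assms] by simp
  with assms show ?thesis
    by (auto simp: adjoint_pair_def lmult_def coeff_mult_fibre star_mult mult.assoc)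
qed

lemma lmult_adjointable: "k \<in> K q \<Longrightarrow> lmult p k \<in> adjointable X p"
  using coeff_lmult_adjoint_pair[of k p] K_subset_coeff by (auto simp: adjointable_def simp del: product_system.simps)

lemma adjoint_pair_lmult_iff:
  assumes "k \<in> K p" "l \<in> K p"
  shows "adjoint_pair X p (lmult p k) (lmult p l) \<longleftrightarrow> l = k\<^sup>\<star>"
proof
  assume adj: "adjoint_pair X p (lmult p k) (lmult p l)"
  have K: "k\<^sup>\<star> - l \<in> K p" using subspace_diff[OF subspace_K K_star] assms by blast
  have "k\<^sup>\<star> - l = 0"
  proof (rule K_eq_0[OF K])
    fix z assume z: "z \<in> A p"
    define w where "w = (k\<^sup>\<star> - l) * z"
    have w: "w \<in> A p" using K_mult_fibre[OF K z] by (simp add: w_def)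
    have "(k * w)\<^sup>\<star> * z = w\<^sup>\<star> * (l * z)"
      using adj w z by (simp add: adjoint_pair_def lmult_def)
    then have "w\<^sup>\<star> * (k\<^sup>\<star> * z) = w\<^sup>\<star> * (l * z)" by (simp only: star_mult mult.assoc)
    moreover have "x * w = x * (k\<^sup>\<star> * z) - x * (l * z)" for x
      by (simp add: w_def left_diff_distrib right_diff_distrib)
    ultimately have "w\<^sup>\<star> * w = 0" by (metis right_minus_eq)
    then show "(k\<^sup>\<star> - l) * z = 0" by (simp add: star_mult_eq_0_iff w_def)
  qed
  then show "l = k\<^sup>\<star>" by simp
next
  assume "l = k\<^sup>\<star>"
  then show "adjoint_pair X p (lmult p k) (lmult p l)"
    using coeff_lmult_adjoint_pair K_subset_coeff assms by blast
qed

lemma finite_rank_eq: "finite_rank X p = lmult p ` finite_K p"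
proof (intro equalityI subsetI)
  fix S assume "S \<in> finite_rank X p"
  then obtain n :: nat and a x y where xy: "\<And>i. i < n \<Longrightarrow> x i \<in> A p \<and> y i \<in> A p"
    and S: "S = (\<lambda>z \<in> A p. \<Sum>i<n. a i *\<^sub>C rank_one X p (x i) (y i) z)"
    unfolding finite_rank_def product_system.simps by blast
  have "S = lmult p (\<Sum>i<n. a i *\<^sub>C (x i * (y i)\<^sup>\<star>))"
    unfolding S lmult_def
    by (rule restrict_ext) (simp add: rank_one_def sum_distrib_right mult_scaleC_left mult.assoc)
  moreover have "(\<Sum>i<n. a i *\<^sub>C (x i * (y i)\<^sup>\<star>)) \<in> finite_K p"
    by (rule subspace_sum[OF subspace_finite_K]) (use xy in \<open>auto intro: finite_K_scaleC finite_K_base\<close>)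
  ultimately show "S \<in> lmult p ` finite_K p" by blast
next
  fix S assume "S \<in> lmult p ` finite_K p"
  then obtain k where k: "k \<in> finite_K p" and S: "S = lmult p k" by blast
  define rep where "rep k n x y \<longleftrightarrow> (\<forall>i<n. x i \<in> A p \<and> y i \<in> A p) \<and> k = (\<Sum>i<n. x i * (y i)\<^sup>\<star>)"
    for k and n :: nat and x y
  have "\<exists>n x y. rep k n x y"
    using k
  proof (induction rule: finite_K_induct)
    case zero
    show ?case by (rule exI[of _ 0]) (simp add: rep_def)
  next
    case (add k l)
    then obtain m x y n u v where k: "rep k m x y" and l: "rep l n u v" by blast
    let ?x = "\<lambda>i. if i < m then x i else u (i - m)" and ?y = "\<lambda>i. if i < m then y i else v (i - m)"
    have "(\<Sum>i<m + n. ?x i * (?y i)\<^sup>\<star>) = (\<Sum>i<m. x i * (y i)\<^sup>\<star>) + (\<Sum>i<n. u i * (v i)\<^sup>\<star>)"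
      by (induction n) (simp_all add: add.assoc[symmetric])
    then have "rep (k + l) (m + n) ?x ?y" using k l by (auto simp: rep_def)
    then show ?case by blast
  next
    case (base x y)
    then have "rep (x * y\<^sup>\<star>) 1 (\<lambda>_. x) (\<lambda>_. y)" by (simp add: rep_def)
    then show ?case by blast
  qed
  then obtain n :: nat and x y where xy: "\<forall>i<n. x i \<in> A p \<and> y i \<in> A p"
    and k: "k = (\<Sum>i<n. x i * (y i)\<^sup>\<star>)" unfolding rep_def by blast
  have one: "1 *\<^sub>C z = z" for z :: 'b using scaleR_scaleC[of 1 z] by simp
  have "S = (\<lambda>z \<in> fibre X p. \<Sum>i<n. 1 *\<^sub>C rank_one X p (x i) (y i) z)"
    unfolding S lmult_def k product_system.simps
    by (rule restrict_ext) (simp add: rank_one_def sum_distrib_right mult.assoc one)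
  then show "S \<in> finite_rank X p"
    unfolding finite_rank_def using xy by (intro CollectI exI[of _ n] exI[of _ "\<lambda>_. 1"] exI[of _ x] exI[of _ y]) simp
qed

text \<open>
  Finite-rank operators are the left multiplications by elements of \<open>finite_K p\<close>. As their norm as
  operators on the fibre is the norm in the algebra, an operator approximated by them comes from a
  Cauchy sequence in \<open>finite_K p\<close>, whose limit in \<open>K p\<close> then multiplies like the given operator.
\<close>

theorem compacts_eq: "compacts X p = lmult p ` K p"
proof (intro equalityI subsetI)
  fix S assume "S \<in> lmult p ` K p"
  then obtain k where k: "k \<in> K p" and S: "S = lmult p k" by blast
  have "\<exists>R \<in> finite_rank X p. op_norm_le X p (\<lambda>z. S z - R z) e" if e: "e > 0" for e
  proof -
    from k have "\<forall>e>0. \<exists>l\<in>finite_K p. dist l k < e" by (simp only: K_def closure_approachable)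
    with e obtain l where l: "l \<in> finite_K p" "dist l k < e" by blast
    have K: "k - l \<in> K p"
      using subspace_diff[OF subspace_K k] l finite_K_subset_K by blast
    have "norm (k - l) \<le> e" using l by (simp add: dist_norm norm_minus_commute)
    then have "op_norm_le X p (lmult p (k - l)) e" by (simp add: op_norm_le_lmult_iff K)
    then have "op_norm_le X p (\<lambda>z. S z - lmult p l z) e"
      by (simp add: op_norm_le_def S lmult_def left_diff_distrib)
    then show ?thesis using l unfolding finite_rank_eq by blast
  qed
  moreover have "S \<in> adjointable X p"
    using lmult_adjointable k S by blast
  ultimately show "S \<in> compacts X p" by (simp add: compacts_def)
next
  fix S assume S: "S \<in> compacts X p"
  then have "\<forall>e>0. \<exists>R \<in> lmult p ` finite_K p. op_norm_le X p (\<lambda>z. S z - R z) e"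
    unfolding compacts_def finite_rank_eq mem_Collect_eq by (elim conjE)
  then have "\<forall>e>0. \<exists>k \<in> finite_K p. op_norm_le X p (\<lambda>z. S z - lmult p k z) e"
    by blast
  then have "\<exists>k. k \<in> finite_K p \<and> op_norm_le X p (\<lambda>z. S z - lmult p k z) (1 / 2 ^ n)" for n :: nat
    by (simp only: Bex_def zero_less_divide_1_iff zero_less_power zero_less_numeral)
  then obtain k where k: "\<And>n :: nat. k n \<in> finite_K p"
    and kS: "\<And>n. op_norm_le X p (\<lambda>z. S z - lmult p (k n) z) (1 / 2 ^ n)"
    using choice[of "\<lambda>n k. k \<in> finite_K p \<and> op_norm_le X p (\<lambda>z. S z - lmult p k z) (1 / 2 ^ n)"] by blast
  have kS': "norm (S z - k n * z) \<le> 1 / 2 ^ n * norm z" if "z \<in> A p" for z n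
    using kS[of n] that by (simp add: op_norm_le_def lmult_def)
  have step: "norm (k n - k m) \<le> 1 / 2 ^ n + 1 / 2 ^ m" for m n
  proof (rule finite_K_norm_le)
    show "k n - k m \<in> finite_K p" by (rule subspace_diff[OF subspace_finite_K k k])
    fix z assume z: "z \<in> A p"
    have "norm ((k n - k m) * z) = norm ((S z - k m * z) - (S z - k n * z))"
      by (simp add: left_diff_distrib)
    also have "\<dots> \<le> 1 / 2 ^ m * norm z + 1 / 2 ^ n * norm z"
      by (rule order_trans[OF norm_triangle_ineq4 add_mono[OF kS' kS']]) (rule z)+
    finally show "norm ((k n - k m) * z) \<le> (1 / 2 ^ n + 1 / 2 ^ m) * norm z"
      by (simp add: distrib_right)
  qed simp
  have half: "(\<lambda>n. 1 / 2 ^ n :: real) \<longlonglongrightarrow> 0"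
    using LIMSEQ_realpow_zero[of "1 / 2 :: real"] by (simp add: power_divide)
  have "Cauchy k"
  proof (rule CauchyI)
    fix e :: real assume "e > 0"
    then obtain N where N: "\<And>n. n \<ge> N \<Longrightarrow> 1 / 2 ^ n < e / 2"
      using order_tendstoD(2)[OF half, of "e / 2"] by (auto simp: eventually_sequentially)
    show "\<exists>M. \<forall>m\<ge>M. \<forall>n\<ge>M. norm (k m - k n) < e"
    proof (intro exI[of _ N] allI impI)
      fix m n assume "m \<ge> N" "n \<ge> N"
      then show "norm (k m - k n) < e" using N[of m] N[of n] step[of m n] by linarith
    qed
  qed
  then obtain l where l: "k \<longlonglongrightarrow> l" unfolding Cauchy_convergent_iff convergent_def by blast
  then have lK: "l \<in> K p" unfolding K_def closure_sequential using k by blast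
  have "S z = l * z" if z: "z \<in> A p" for z
  proof (rule LIMSEQ_unique)
    show "(\<lambda>n. k n * z) \<longlonglongrightarrow> l * z" by (intro tendsto_intros l)
    have lim: "(\<lambda>n. 1 / 2 ^ n * norm z) \<longlonglongrightarrow> 0"
      using tendsto_mult[OF half tendsto_const, of "norm z"] by simp
    have "(\<lambda>n. S z - k n * z) \<longlonglongrightarrow> 0"
      by (rule Lim_null_comparison[OF always_eventually lim]) (rule allI, rule kS'[OF z])
    from tendsto_diff[OF tendsto_const this, of "S z"]
    show "(\<lambda>n. k n * z) \<longlonglongrightarrow> S z" by simp
  qed
  moreover have "S \<in> extensional (A p)"
    using S unfolding compacts_def adjointable_def adjoint_pair_def PiE_def by auto
  ultimately have "S = lmult p l"
    unfolding lmult_def by (intro extensionalityI[of S "A p"]) auto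
  then show "S \<in> lmult p ` K p" using lK by blast
qed

text \<open>
  The homomorphism \<open>\<psi>\<^sup>(\<^sup>p\<^sup>)\<close> belonging to the inclusion takes the operator of left multiplication by \<open>k\<close>
  to \<open>k\<close>. This is a contractive homomorphism because left multiplication is isometric, and it is
  determined by its values on the rank-one operators because \<open>finite_K p\<close> is dense in \<open>K p\<close>.
\<close>

theorem rep_compacts_inclusion:
  assumes B: "K p \<subseteq> B" and k: "k \<in> K p"
  shows "rep_compacts X B (\<lambda>p x. x) p (lmult p k) = k"
proof -
  define h where "h = (\<lambda>S \<in> compacts X p. THE k. k \<in> K p \<and> S = lmult p k)"
  have h: "h (lmult p k) = k" if "k \<in> K p" for k
  proof -
    have "(THE l. l \<in> K p \<and> lmult p k = lmult p l) = k"
      by (rule the_equality) (use that lmult_inject in blast)+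
    then show ?thesis using that by (simp add: h_def compacts_eq)
  qed
  have sum: "(\<lambda>z \<in> A p. lmult p k z + lmult p l z) = lmult p (k + l)" for k l
    by (auto simp: lmult_def distrib_right)
  have scale: "(\<lambda>z \<in> A p. a *\<^sub>C lmult p k z) = lmult p (a *\<^sub>C k)" for a k
    by (auto simp: lmult_def mult_scaleC_left)
  have comp: "compose (A p) (lmult p k) (lmult p l) = lmult p (k * l)" if "l \<in> K p" for k l
    using that by (auto simp: compose_def lmult_def K_mult_fibre mult.assoc)
  have rank: "rank_one X p x y = lmult p (x * y\<^sup>\<star>)" for x y
    by (auto simp: rank_one_def lmult_def mult.assoc)
  have h_hom: "compacts_hom X B p h"
    unfolding compacts_hom_def compacts_eq ball_simps
  proof (intro conjI ballI allI impI)
    show "h \<in> lmult p ` K p \<rightarrow>\<^sub>E B"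
    proof (rule PiE_I)
      fix S assume "S \<in> lmult p ` K p"
      then show "h S \<in> B" using B h by auto
    qed (simp add: h_def compacts_eq)
    fix k l assume kl: "k \<in> K p" "l \<in> K p"
    show "h (\<lambda>z\<in>fibre X p. lmult p k z + lmult p l z) = h (lmult p k) + h (lmult p l)"
      using kl subspace_add[OF subspace_K] by (simp add: sum h)
    show "h (compose (fibre X p) (lmult p k) (lmult p l)) = h (lmult p k) * h (lmult p l)"
      using kl coeff_mult_K[OF subsetD[OF K_subset_coeff]] by (simp add: comp h)
    show "h (lmult p l) = (h (lmult p k))\<^sup>\<star>" if "adjoint_pair X p (lmult p k) (lmult p l)"
      using that kl by (simp add: adjoint_pair_lmult_iff h)
  next
    fix a k assume k: "k \<in> K p"
    show "h (\<lambda>z\<in>fibre X p. a *\<^sub>C lmult p k z) = a *\<^sub>C h (lmult p k)"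
      using k K_scaleC by (simp add: scale h)
  next
    fix k C assume "k \<in> K p" "op_norm_le X p (lmult p k) C"
    then show "norm (h (lmult p k)) \<le> C" by (simp add: op_norm_le_lmult_iff h)
  qed
  have h_rank: "\<forall>x\<in>A p. \<forall>y\<in>A p. h (rank_one X p x y) = x * y\<^sup>\<star>"
    by (simp add: rank h K_base)
  have h_unique: "g = h" if g: "compacts_hom X B p g" "\<forall>x\<in>A p. \<forall>y\<in>A p. g (rank_one X p x y) = x * y\<^sup>\<star>" for g
  proof -
    have g_add: "g (lmult p (k + l)) = g (lmult p k) + g (lmult p l)" if "k \<in> K p" "l \<in> K p" for k l
    proof -
      have "\<forall>S \<in> compacts X p. \<forall>T \<in> compacts X p. g (\<lambda>z \<in> fibre X p. S z + T z) = g S + g T"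
        using g(1) unfolding compacts_hom_def by (elim conjE)
      then show ?thesis using that by (simp add: compacts_eq sum)
    qed
    have fin: "g (lmult p k) = k" if "k \<in> finite_K p" for k
    proof -
      have "k \<in> K p \<and> g (lmult p k) = k" using that
      proof (induction rule: finite_K_induct)
        case zero
        show ?case using g_add[of 0 0] subspace_0[OF subspace_K] by simp
      next
        case (add k l)
        then show ?case using g_add[of k l] subspace_add[OF subspace_K] by simp
      next
        case (base x y)
        then show ?case using g(2) K_base by (simp add: rank)
      qed
      then show ?thesis ..
    qed
    have "g (lmult p k) = k" if k: "k \<in> K p" for k
    proof -
      have "norm (g (lmult p k) - k) \<le> 0 + e" if "0 < e" for e
      proof -
        from k have "\<forall>e>0. \<exists>l\<in>finite_K p. dist l k < e" by (simp only: K_def closure_approachable)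
        with half_gt_zero[OF \<open>0 < e\<close>] obtain l where l: "l \<in> finite_K p" "dist l k < e / 2" by blast
        have lK: "l \<in> K p" using l finite_K_subset_K by blast
        have klK: "k - l \<in> K p" by (rule subspace_diff[OF subspace_K k lK])
        have "norm (g (lmult p (k - l))) \<le> norm (k - l)"
        proof -
          have "\<forall>S \<in> compacts X p. \<forall>C. op_norm_le X p S C \<longrightarrow> norm (g S) \<le> C"
            using g(1) unfolding compacts_hom_def by (elim conjE)
          moreover have "lmult p (k - l) \<in> compacts X p" using klK by (simp add: compacts_eq)
          ultimately show ?thesis using op_norm_le_lmult_iff[OF klK, of "norm (k - l)"] by blast
        qed
        moreover have "g (lmult p k) - k = g (lmult p (k - l)) - (k - l)"
          using g_add[OF lK klK] fin[OF l(1)] by simp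
        ultimately have "norm (g (lmult p k) - k) \<le> norm (k - l) + norm (k - l)"
          by (simp only: order_trans[OF norm_triangle_ineq4] add_right_mono)
        then show ?thesis using l(2) by (simp add: dist_norm norm_minus_commute)
      qed
      then have "norm (g (lmult p k) - k) \<le> 0" by (rule field_le_epsilon)
      then show ?thesis by simp
    qed
    moreover have "g \<in> extensional (compacts X p)" using g(1) unfolding compacts_hom_def PiE_def by (elim conjE IntE)
    moreover have "h \<in> extensional (compacts X p)" by (simp add: h_def)
    ultimately show ?thesis
      by (intro extensionalityI[of g "compacts X p" h]) (auto simp: compacts_eq h)
  qed
  have "(THE h. compacts_hom X B p h \<and> (\<forall>x\<in>A p. \<forall>y\<in>A p. h (rank_one X p x y) = x * y\<^sup>\<star>)) = h"
    by (rule the_equality) (use h_hom h_rank h_unique in blast)+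
  then have "rep_compacts X B (\<lambda>p x. x) p = h"
    unfolding rep_compacts_def product_system.simps .
  then show ?thesis by (simp add: h k)
qed

lemma left_action_eq: "left_action X p a = lmult p a"
  by (simp add: left_action_def lmult_def)

text \<open>
  Since the products of elements of \<open>A p\<close> and \<open>A q\<close> span a dense subspace of \<open>A (p + q)\<close>, an operator
  with an adjoint is determined by its values on them. For \<open>p = 0\<close> the
  coefficient \<open>k\<close> itself is recovered from its action on \<open>A 0\<close>, because \<open>A 0\<close> is closed under adjoints.
\<close>

theorem iota_lmult:
  assumes dense: "A (p + q) \<subseteq> closure (span {x * y | x y. x \<in> A p \<and> y \<in> A q})"
    and k: "k \<in> K p"
  shows "iota X p q (lmult p k) = lmult (p + q) k"
proof (cases "p = 0")
  case True
  have unique: "a = k" if a: "a \<in> A 0" "lmult 0 k = lmult 0 a" for a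
  proof -
    have ak: "a - k \<in> A 0" using a(1) k K_subset_coeff diff_fibre by blast
    have "lmult 0 k ((a - k)\<^sup>\<star>) = lmult 0 a ((a - k)\<^sup>\<star>)" by (simp only: a(2))
    moreover have "(a - k)\<^sup>\<star> \<in> A 0" using star_fibre[OF ak] by simp
    ultimately have "k * (a - k)\<^sup>\<star> = a * (a - k)\<^sup>\<star>" by (simp add: lmult_def)
    then have "((a - k)\<^sup>\<star>)\<^sup>\<star> * (a - k)\<^sup>\<star> = 0" by (simp add: star_star left_diff_distrib)
    then have "norm ((a - k)\<^sup>\<star>) = 0" by (simp only: star_mult_eq_0_iff norm_zero)
    then show ?thesis by simp
  qed
  show ?thesis
  proof -
    have "(THE R. \<exists>a \<in> A 0. lmult 0 k = lmult 0 a \<and> R = lmult q a) = lmult q k"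
      by (rule the_equality) (use k K_subset_coeff unique in blast)+
    with True show ?thesis by (simp add: iota_def left_action_eq)
  qed
next
  case False
  have "(THE R. R \<in> adjointable X (p + q) \<and>
       (\<forall>x \<in> A p. \<forall>y \<in> A q. R (x * y) = lmult p k x * y)) = lmult (p + q) k"
  proof (rule the_equality)
    have "lmult (p + q) k \<in> adjointable X (p + q)"
      using lmult_adjointable k by blast
    then show "lmult (p + q) k \<in> adjointable X (p + q) \<and>
        (\<forall>x \<in> A p. \<forall>y \<in> A q. lmult (p + q) k (x * y) = lmult p k x * y)"
      by (auto simp: lmult_def mult_fibre mult.assoc)
    fix R assume R: "R \<in> adjointable X (p + q) \<and> (\<forall>x \<in> A p. \<forall>y \<in> A q. R (x * y) = lmult p k x * y)"
    then obtain T where T: "adjoint_pair X (p + q) R T" by (auto simp: adjointable_def)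
    have RT: "(R x)\<^sup>\<star> * y = x\<^sup>\<star> * T y" if "x \<in> A (p + q)" "y \<in> A (p + q)" for x y
      using T that by (auto simp: adjoint_pair_def)
    have R_in: "R \<in> A (p + q) \<rightarrow>\<^sub>E A (p + q)" and T_in: "T y \<in> A (p + q)" if "y \<in> A (p + q)" for y
      using T that by (auto simp: adjoint_pair_def)
    \<comment> \<open>The adjoints agree because \<open>T w - k\<^sup>\<star>w\<close> is orthogonal to all products, hence to itself.\<close>
    have T_eq: "T w = k\<^sup>\<star> * w" if w: "w \<in> A (p + q)" for w
    proof -
      define d where "d = T w - k\<^sup>\<star> * w"
      have d: "d \<in> A (p + q)"
        unfolding d_def by (intro diff_fibre T_in w K_mult_fibre[OF K_star[OF k]])
      have prod: "z\<^sup>\<star> * d = 0" if "z \<in> {x * y | x y. x \<in> A p \<and> y \<in> A q}" for z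
      proof -
        from that obtain x y where xy: "z = x * y" "x \<in> A p" "y \<in> A q" by blast
        have "(k * z)\<^sup>\<star> * w = z\<^sup>\<star> * T w"
          using R xy RT[OF mult_fibre[OF xy(2,3)] w] by (simp add: lmult_def mult.assoc)
        then show ?thesis by (simp add: d_def right_diff_distrib star_mult mult.assoc)
      qed
      have "z\<^sup>\<star> * d = 0" if "z \<in> span {x * y | x y. x \<in> A p \<and> y \<in> A q}" for z
        using that
      proof (induction rule: span_induct_alt)
        case (step c x y)
        have "(c *\<^sub>R x)\<^sup>\<star> = c *\<^sub>R x\<^sup>\<star>"
          using linear_simps(5)[OF bounded_linear_star] .
        with step(2) prod[OF step(1)] show ?case by (simp add: star_add distrib_right)
      qed simp
      moreover have "bounded_linear (\<lambda>z. z\<^sup>\<star> * d)"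
        by (rule bounded_linear_compose[OF bounded_linear_mult_left bounded_linear_star])
      ultimately have "d\<^sup>\<star> * d \<in> {0}"
        using dense d by (intro bounded_linear_closure_in[of "\<lambda>z. z\<^sup>\<star> * d" d]) auto
      then show ?thesis by (simp add: star_mult_eq_0_iff d_def)
    qed
    have "R z = k * z" if z: "z \<in> A (p + q)" for z
    proof -
      define d where "d = R z - k * z"
      have d: "d \<in> A (p + q)"
        unfolding d_def using R_in[OF z] z by (intro diff_fibre K_mult_fibre[OF k]) auto
      have "d\<^sup>\<star> * x = (R z)\<^sup>\<star> * x - z\<^sup>\<star> * (k\<^sup>\<star> * x)" for x
        by (simp add: d_def star_diff star_mult left_diff_distrib mult.assoc)
      then have "d\<^sup>\<star> * d = 0" using RT[OF z d] T_eq[OF d] by simp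
      then show ?thesis by (simp add: star_mult_eq_0_iff d_def)
    qed
    moreover have "R \<in> extensional (A (p + q))" using R_in[OF zero_fibre] by (simp add: PiE_def)
    ultimately show "R = lmult (p + q) k"
      unfolding lmult_def by (intro extensionalityI[of R "A (p + q)"]) auto
  qed
  then show ?thesis using False by (simp add: iota_def)
qed

lemma iota_prod_lmult:
  assumes dense: "\<And>p q. p \<in> P \<Longrightarrow> q \<in> P \<Longrightarrow> A (p + q) \<subseteq> closure (span {x * y | x y. x \<in> A p \<and> y \<in> A q})"
    and "p \<in> P" "q \<in> P" "- p + join P p q \<in> P" "- q + join P p q \<in> P"
    and "k \<in> K p" "l \<in> K q"
  shows "iota_prod P X p q (lmult p k) (lmult q l) = lmult (join P p q) (k * l)"
proof -
  have "iota X p (- p + join P p q) (lmult p k) = lmult (join P p q) k"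
    using iota_lmult[OF dense, of p "- p + join P p q" k] assms by (simp add: add.assoc[symmetric])
  moreover have "iota X q (- q + join P p q) (lmult q l) = lmult (join P p q) l"
    using iota_lmult[OF dense, of q "- q + join P p q" l] assms by (simp add: add.assoc[symmetric])
  ultimately show ?thesis
    using assms(7) by (auto simp: iota_prod_def compose_def lmult_def K_mult_fibre mult.assoc)
qed

end

section \<open>Matrices of operators on square-summable families\<close>

lemma op_eq_ketI:
  fixes S T :: "'i ell2_op"
  assumes "\<And>b d. ell2_apply (op_apply S (ket b)) d = ell2_apply (op_apply T (ket b)) d"
  shows "S = T"
proof (rule op_eqI)
  fix x
  have eq: "op_apply S (ket b) = op_apply T (ket b)" for b
    by (rule ell2_eqI) (rule assms)
  have *: "((\<lambda>b. ell2_apply x b *\<^sub>C op_apply U (ket b)) has_sum op_apply U x) UNIV" for U :: "'i ell2_op"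
    using has_sum_bounded_linear[OF bounded_linear_op_apply ell2_has_sum_ket, of U x]
    by (simp add: o_def op_apply_scaleC)
  show "op_apply S x = op_apply T x"
    using *[of S] *[of T] unfolding eq by (rule has_sum_unique)
qed

lemma bounded_linear_ell2_apply: "bounded_linear (\<lambda>x. ell2_apply x i)"
  by (rule bounded_linear_intro[of _ 1])
    (simp_all add: plus_ell2.rep_eq scaleR_ell2.rep_eq scaleR_conv_of_real ell2_apply_le_norm)

lemma op_apply_has_sum:
  "((\<lambda>b. ell2_apply \<xi> b * ell2_apply (op_apply T (ket b)) d) has_sum ell2_apply (op_apply T \<xi>) d) UNIV"
proof -
  have "bounded_linear (\<lambda>x. ell2_apply (op_apply T x) d)"
    by (rule bounded_linear_compose[OF bounded_linear_ell2_apply bounded_linear_op_apply])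
  from has_sum_bounded_linear[OF this ell2_has_sum_ket, of \<xi>] show ?thesis
    by (simp add: o_def op_apply_scaleC scaleC_ell2.rep_eq)
qed

lemma star_entry: "ell2_apply (op_apply (T\<^sup>\<star>) (ket b)) d = cnj (ell2_apply (op_apply T (ket d)) b)"
proof -
  have "cnj (ell2_apply (op_apply (T\<^sup>\<star>) (ket b)) d) = cinner (op_apply (T\<^sup>\<star>) (ket b)) (ket d)"
    by (simp add: cinner_ket)
  also have "\<dots> = cinner (ket b) (op_apply T (ket d))" by (rule cinner_star)
  also have "\<dots> = ell2_apply (op_apply T (ket d)) b" by (subst cinner_commute) (simp add: cinner_ket)
  finally show ?thesis by (metis complex_cnj_cnj)
qed

text \<open>
  Convolution by a function supported in a bisection is an operator of this form, so this is the
  only boundedness argument that the left regular representation needs.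
\<close>

lemma weighted_composition_operator:
  fixes w :: "'i \<Rightarrow> complex" and \<phi> :: "'i \<Rightarrow> 'i"
  assumes M: "\<And>d. cmod (w d) \<le> M" and inj: "inj_on \<phi> {d. w d \<noteq> 0}"
  shows "\<exists>T. \<forall>\<xi> d. ell2_apply (op_apply T \<xi>) d = w d * ell2_apply \<xi> (\<phi> d)"
proof -
  have M0: "M \<ge> 0" using M[of undefined] norm_ge_zero order_trans by blast
  have fin: "(\<Sum>d\<in>F. (cmod (w d * ell2_apply \<xi> (\<phi> d)))\<^sup>2) \<le> M\<^sup>2 * (norm \<xi>)\<^sup>2" if F: "finite F" for F \<xi>
  proof -
    let ?F = "F \<inter> {d. w d \<noteq> 0}"
    have "(\<Sum>d\<in>F. (cmod (w d * ell2_apply \<xi> (\<phi> d)))\<^sup>2) = (\<Sum>d\<in>?F. (cmod (w d * ell2_apply \<xi> (\<phi> d)))\<^sup>2)"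
      by (rule sum.mono_neutral_right) (use F in auto)
    also have "\<dots> \<le> (\<Sum>d\<in>?F. M\<^sup>2 * (cmod (ell2_apply \<xi> (\<phi> d)))\<^sup>2)"
      by (intro sum_mono) (simp add: norm_mult power_mult_distrib mult_right_mono power_mono M)
    also have "\<dots> = M\<^sup>2 * (\<Sum>b\<in>\<phi> ` ?F. (cmod (ell2_apply \<xi> b))\<^sup>2)"
      by (subst sum.reindex) (auto simp: sum_distrib_left intro: inj_on_subset[OF inj])
    also have "\<dots> \<le> M\<^sup>2 * (norm \<xi>)\<^sup>2"
      unfolding ell2_norm_eq
      by (intro mult_left_mono finite_sum_le_infsum ell2_summable) (use F in auto)
    finally show ?thesis .
  qed
  have sum: "(\<lambda>d. (cmod (w d * ell2_apply \<xi> (\<phi> d)))\<^sup>2) summable_on UNIV" for \<xi>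
  proof (rule nonneg_bdd_above_summable_on)
    show "bdd_above (sum (\<lambda>d. (cmod (w d * ell2_apply \<xi> (\<phi> d)))\<^sup>2) ` {F. F \<subseteq> UNIV \<and> finite F})"
      by (rule bdd_aboveI2[where M = "M\<^sup>2 * (norm \<xi>)\<^sup>2"]) (simp add: fin)
  qed simp
  define S where "S \<xi> = Abs_ell2 (\<lambda>d. w d * ell2_apply \<xi> (\<phi> d))" for \<xi>
  have S: "ell2_apply (S \<xi>) d = w d * ell2_apply \<xi> (\<phi> d)" for \<xi> d
    using sum by (simp add: S_def Abs_ell2_inverse)
  have bound: "norm (S \<xi>) \<le> norm \<xi> * M" for \<xi>
  proof -
    have "(norm (S \<xi>))\<^sup>2 \<le> M\<^sup>2 * (norm \<xi>)\<^sup>2"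
      unfolding ell2_norm_eq[of "S \<xi>"] S by (rule infsum_le_finite_sums[OF sum fin])
    then have "(norm (S \<xi>))\<^sup>2 \<le> (norm \<xi> * M)\<^sup>2" by (simp add: power_mult_distrib mult.commute)
    then show ?thesis by (rule power2_le_imp_le) (simp add: M0)
  qed
  have "bounded_linear S"
    by (rule bounded_linear_intro[OF _ _ bound])
      (auto intro!: ell2_eqI simp: S plus_ell2.rep_eq scaleR_ell2.rep_eq distrib_left)
  moreover have "S (a *\<^sub>C x) = a *\<^sub>C S x" for a x
    by (rule ell2_eqI) (simp add: S scaleC_ell2.rep_eq)
  ultimately have "op_apply (Abs_ell2_op (Blinfun S)) = S"
    unfolding op_apply_def by (subst Abs_ell2_op_inverse) (simp_all add: bounded_linear_Blinfun_apply)
  then show ?thesis using S by metis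
qed

section \<open>Groupoid algebra\<close>

locale groupoid_laws =
  fixes G :: "'g groupoid"
  assumes is_groupoid: "is_groupoid G"
begin

abbreviation cmp :: "'g \<Rightarrow> 'g \<Rightarrow> bool" where "cmp a b \<equiv> (a, b) \<in> composable G"
abbreviation mul :: "'g \<Rightarrow> 'g \<Rightarrow> 'g"  (infixl \<open>\<odot>\<close> 70) where "a \<odot> b \<equiv> gmult G a b"
abbreviation iv :: "'g \<Rightarrow> 'g" where "iv \<equiv> ginv G"
abbreviation r :: "'g \<Rightarrow> 'g" where "r \<equiv> grange G"
abbreviation s :: "'g \<Rightarrow> 'g" where "s a \<equiv> grange G (ginv G a)"

lemma cmp_mult: "cmp a b \<Longrightarrow> cmp b d \<Longrightarrow> cmp (a \<odot> b) d" "cmp a b \<Longrightarrow> cmp b d \<Longrightarrow> cmp a (b \<odot> d)"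
  and mult_assoc: "cmp a b \<Longrightarrow> cmp b d \<Longrightarrow> a \<odot> b \<odot> d = a \<odot> (b \<odot> d)"
  and inv_inv [simp]: "iv (iv a) = a"
  and cmp_inv_right: "cmp a (iv a)"
  and cancel_left: "cmp a b \<Longrightarrow> iv a \<odot> (a \<odot> b) = b"
  and cancel_right: "cmp a b \<Longrightarrow> a \<odot> b \<odot> iv b = a"
  using is_groupoid unfolding is_groupoid_def by blast+

lemma cmp_inv_left: "cmp (iv a) a"
  using cmp_inv_right[of "iv a"] by simp

lemma r_eq: "r a = a \<odot> iv a" and s_eq: "s a = iv a \<odot> a"
  by (simp_all add: grange_def)

text \<open>
  The axioms determine composability through sources and ranges: units can be inserted between
  composable arrows and cancelled again.
\<close>

lemma cmp_iff: "cmp a b \<longleftrightarrow> s a = r b"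
proof
  assume ab: "cmp a b"
  have "(iv a \<odot> a) \<odot> b = b"
    using mult_assoc[OF cmp_inv_left ab] cancel_left[OF ab] by simp
  moreover have "cmp (iv a \<odot> a) b" by (rule cmp_mult(1)[OF cmp_inv_left ab])
  ultimately show "s a = r b" using cancel_right[of "iv a \<odot> a" b] by (simp add: r_eq)
next
  assume eq: "s a = r b"
  have "cmp a (iv a \<odot> a)" by (rule cmp_mult(2)[OF cmp_inv_right cmp_inv_left])
  then have "cmp a (b \<odot> iv b)" using eq by (simp add: r_eq)
  moreover have "cmp (b \<odot> iv b) b" by (rule cmp_mult(1)[OF cmp_inv_right cmp_inv_left])
  moreover have "b \<odot> iv b \<odot> b = b" using cancel_right[OF cmp_inv_right[of b]] by simp
  ultimately show "cmp a b" using cmp_mult(2)[of a "b \<odot> iv b" b] by simp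
qed

lemma r_mult: "cmp a b \<Longrightarrow> r (a \<odot> b) = r a"
  using cmp_mult(2)[OF cmp_inv_left, of a b] unfolding cmp_iff[of "iv a"] by simp

lemma s_mult: "cmp a b \<Longrightarrow> s (a \<odot> b) = s b"
  using cmp_mult(1)[OF _ cmp_inv_right, of a b] unfolding cmp_iff[of _ "iv b"] .

lemma r_r [simp]: "r (r a) = r a"
  unfolding r_eq[of a] by (subst r_mult[OF cmp_inv_right]) (simp add: r_eq)

lemma r_unit: "r a \<odot> a = a"
  using cancel_right[OF cmp_inv_right[of a]] by (simp add: r_eq)

lemma s_unit: "a \<odot> s a = a"
  using cancel_left[OF cmp_inv_left[of a]] by (simp add: s_eq)

lemma inv_mult: assumes "cmp a b" shows "iv (a \<odot> b) = iv b \<odot> iv a"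
proof -
  have ba: "cmp (iv b) (iv a)" using assms by (simp add: cmp_iff)
  have ab: "cmp (a \<odot> b) (iv b)" by (rule cmp_mult(1)[OF assms cmp_inv_right])
  have x: "cmp (a \<odot> b) (iv b \<odot> iv a)" by (rule cmp_mult(2)[OF ab ba])
  have "(a \<odot> b) \<odot> (iv b \<odot> iv a) = r a"
    by (simp add: mult_assoc[OF ab ba, symmetric] cancel_right[OF assms] r_eq)
  then have "iv b \<odot> iv a = iv (a \<odot> b) \<odot> r (a \<odot> b)"
    using cancel_left[OF x] by (simp add: r_mult[OF assms])
  then show ?thesis using s_unit[of "iv (a \<odot> b)"] by simp
qed

lemma inv_r [simp]: "iv (r a) = r a"
  unfolding r_eq[of a] by (subst inv_mult[OF cmp_inv_right]) simp

text \<open>Left division: \<open>b = a\<^sup>-\<^sup>1d\<close> is the unique solution of \<open>ab = d\<close>.\<close>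

lemma left_div:
  assumes "r a = r d"
  shows "cmp (iv a) d" "cmp a (iv a \<odot> d)" "a \<odot> (iv a \<odot> d) = d" "s (iv a \<odot> d) = s d" "r (iv a \<odot> d) = s a"
    "d \<odot> iv (iv a \<odot> d) = a"
proof -
  show 1: "cmp (iv a) d" using assms by (simp add: cmp_iff)
  show 2: "cmp a (iv a \<odot> d)" by (rule cmp_mult(2)[OF cmp_inv_right 1])
  show 3: "a \<odot> (iv a \<odot> d) = d" using cancel_left[OF 1] by simp
  show "s (iv a \<odot> d) = s d" by (rule s_mult[OF 1])
  show "r (iv a \<odot> d) = s a" by (rule r_mult[OF 1])
  show "d \<odot> iv (iv a \<odot> d) = a" using cancel_right[OF 2] 3 by simp
qed

lemma right_div:
  assumes "s d = s b"
  shows "cmp d (iv b)" "cmp (d \<odot> iv b) b" "d \<odot> iv b \<odot> b = d" "r (d \<odot> iv b) = r d" "s (d \<odot> iv b) = r b"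
    "iv (d \<odot> iv b) \<odot> d = b"
proof -
  show 1: "cmp d (iv b)" using assms by (simp add: cmp_iff)
  show 2: "cmp (d \<odot> iv b) b" using cmp_mult(1)[OF 1, of b] cmp_inv_left by simp
  show 3: "d \<odot> iv b \<odot> b = d" using cancel_right[OF 1] by simp
  show "r (d \<odot> iv b) = r d" by (rule r_mult[OF 1])
  show "s (d \<odot> iv b) = r b" using s_mult[OF 1] by simp
  show "iv (d \<odot> iv b) \<odot> d = b" using cancel_left[OF 2] 3 by simp
qed

section \<open>Convolution operators\<close>

text \<open>
  The matrix of convolution by \<open>f\<close>: the entry in row \<open>d\<close> and column \<open>b\<close> is \<open>f (db\<^sup>-\<^sup>1)\<close>. Comparing
  matrices replaces all manipulations of convolution sums.
\<close>

definition has_kernel :: "('g \<Rightarrow> complex) \<Rightarrow> 'g ell2_op \<Rightarrow> bool"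
  where "has_kernel f T \<longleftrightarrow>
    (\<forall>b d. ell2_apply (op_apply T (ket b)) d = (if s d = s b then f (d \<odot> iv b) else 0))"

lemma has_kernel_unique: "has_kernel f S \<Longrightarrow> has_kernel f T \<Longrightarrow> S = T"
  by (rule op_eq_ketI) (simp add: has_kernel_def)

lemma has_kernel_zero: "has_kernel (\<lambda>_. 0) 0"
  by (simp add: has_kernel_def op_apply_def zero_ell2_op.rep_eq zero_ell2.rep_eq)

lemma has_kernel_add: "has_kernel f S \<Longrightarrow> has_kernel g T \<Longrightarrow> has_kernel (\<lambda>a. f a + g a) (S + T)"
  by (simp add: has_kernel_def op_apply_add_left plus_ell2.rep_eq)

lemma has_kernel_scaleC: "has_kernel f S \<Longrightarrow> has_kernel (\<lambda>a. z * f a) (z *\<^sub>C S)"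
  by (simp add: has_kernel_def op_apply_scaleC_left scaleC_ell2.rep_eq)

lemma has_kernel_star: "has_kernel f S \<Longrightarrow> has_kernel (\<lambda>a. cnj (f (iv a))) (S\<^sup>\<star>)"
  by (auto simp: has_kernel_def star_entry inv_mult[OF right_div(1)])

text \<open>
  Expanding a vector in the standard basis turns its image into the convolution sum, with the pairs
  \<open>ab = d\<close> parametrised by \<open>b\<close>.
\<close>

lemma left_regular_eq:
  assumes T: "has_kernel f T" shows "left_regular G f = T"
proof -
  have 1: "ell2_apply (op_apply T \<xi>) d =
      (\<Sum>\<^sub>\<infinity>(a, b) \<in> {(a, b) \<in> composable G. a \<odot> b = d}. f a * ell2_apply \<xi> b)" for \<xi> d
  proof -
    let ?S = "{(a, b) \<in> composable G. a \<odot> b = d}"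
    have "((\<lambda>b. ell2_apply \<xi> b * (if s d = s b then f (d \<odot> iv b) else 0)) has_sum ell2_apply (op_apply T \<xi>) d) UNIV"
      using op_apply_has_sum[of \<xi> T d] T unfolding has_kernel_def by simp
    then have "((\<lambda>b. f (d \<odot> iv b) * ell2_apply \<xi> b) has_sum ell2_apply (op_apply T \<xi>) d) {b. s d = s b}"
      by (rule has_sum_cong_neutral[THEN iffD1, rotated -1]) auto
    moreover have "bij_betw (\<lambda>b. (d \<odot> iv b, b)) {b. s d = s b} ?S"
    proof (rule bij_betw_imageI)
      show "inj_on (\<lambda>b. (d \<odot> iv b, b)) {b. s d = s b}" by (rule inj_onI) simp
      have "(a, b) \<in> (\<lambda>b. (d \<odot> iv b, b)) ` {b. s d = s b}" if "cmp a b" "a \<odot> b = d" for a b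
        using that cancel_right s_mult by force
      then show "(\<lambda>b. (d \<odot> iv b, b)) ` {b. s d = s b} = ?S" by (auto simp: right_div)
    qed
    ultimately have "((\<lambda>(a, b). f a * ell2_apply \<xi> b) has_sum ell2_apply (op_apply T \<xi>) d) ?S"
      using has_sum_reindex_bij_betw[of "\<lambda>b. (d \<odot> iv b, b)" _ ?S "\<lambda>(a, b). f a * ell2_apply \<xi> b"] by simp
    then show ?thesis by (rule infsumI[symmetric])
  qed
  show ?thesis
    unfolding left_regular_def
  proof (rule the_equality)
    show "\<forall>\<xi> c. ell2_apply (op_apply T \<xi>) c =
      (\<Sum>\<^sub>\<infinity>(a, b) \<in> {(a, b) \<in> composable G. a \<odot> b = c}. f a * ell2_apply \<xi> b)" using 1 by blast
    fix T' assume "\<forall>\<xi> c. ell2_apply (op_apply T' \<xi>) c =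
      (\<Sum>\<^sub>\<infinity>(a, b) \<in> {(a, b) \<in> composable G. a \<odot> b = c}. f a * ell2_apply \<xi> b)"
    then show "T' = T" by (intro op_eqI ell2_eqI) (simp add: 1)
  qed
qed

end

section \<open>Bump functions\<close>

lemma Cc_I:
  fixes f :: "'a :: t2_space \<Rightarrow> complex"
  assumes "continuous_on UNIV f" "compact K" "\<And>a. f a \<noteq> 0 \<Longrightarrow> a \<in> K" "K \<subseteq> U"
  shows "f \<in> Cc U"
proof -
  have "closure {a. f a \<noteq> 0} \<subseteq> K"
    using assms(2,3) by (intro closure_minimal compact_imp_closed) auto
  then have "compact (closure {a. f a \<noteq> 0})"
    using compact_Int_closed[OF assms(2) closed_closure, of "{a. f a \<noteq> 0}"] by (simp add: Int_absorb1)
  with \<open>closure _ \<subseteq> K\<close> assms show ?thesis by (auto simp: Cc_def)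
qed

lemma Cc_mono: "f \<in> Cc U \<Longrightarrow> U \<subseteq> V \<Longrightarrow> f \<in> Cc V"
  by (auto simp: Cc_def)

lemma Cc_D:
  assumes "f \<in> Cc U"
  shows "continuous_on UNIV f" "compact (closure {a. f a \<noteq> 0})" "closure {a. f a \<noteq> 0} \<subseteq> U"
    "f a \<noteq> 0 \<Longrightarrow> a \<in> closure {a. f a \<noteq> 0}" "f a \<noteq> 0 \<Longrightarrow> a \<in> U"
  using assms closure_subset[of "{a. f a \<noteq> 0}"] by (auto simp: Cc_def)

lemma Cc_zero: "(\<lambda>_. 0) \<in> Cc U"
  by (simp add: Cc_def)

lemma Cc_add:
  fixes f g :: "'a :: t2_space \<Rightarrow> complex"
  assumes f: "f \<in> Cc U" and g: "g \<in> Cc U" shows "(\<lambda>a. f a + g a) \<in> Cc U"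
proof (rule Cc_I)
  show "compact (closure {a. f a \<noteq> 0} \<union> closure {a. g a \<noteq> 0})"
    by (intro compact_Un Cc_D(2)[OF f] Cc_D(2)[OF g])
  show "a \<in> closure {a. f a \<noteq> 0} \<union> closure {a. g a \<noteq> 0}" if "f a + g a \<noteq> 0" for a
    using that Cc_D(4)[OF f, of a] Cc_D(4)[OF g, of a] by (cases "f a = 0") auto
qed (use Cc_D(3)[OF f] Cc_D(3)[OF g] in \<open>auto intro!: continuous_intros Cc_D(1)[OF f] Cc_D(1)[OF g]\<close>)

lemma Cc_mult:
  fixes f g :: "'a :: t2_space \<Rightarrow> complex"
  assumes f: "f \<in> Cc U" and g: "continuous_on UNIV g" shows "(\<lambda>a. f a * g a) \<in> Cc U"
proof (rule Cc_I[OF _ Cc_D(2)[OF f] _ Cc_D(3)[OF f]])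
  show "a \<in> closure {a. f a \<noteq> 0}" if "f a * g a \<noteq> 0" for a
    using that Cc_D(4)[OF f, of a] by simp
qed (intro continuous_intros Cc_D(1)[OF f] g)

lemma Cc_bounded: assumes "f \<in> Cc U" obtains M where "\<And>a. cmod (f a) \<le> M" "M \<ge> 0"
proof -
  have "compact (f ` closure {a. f a \<noteq> 0})"
    by (intro compact_continuous_image Cc_D(2)[OF assms] continuous_on_subset[OF Cc_D(1)[OF assms]]) simp
  then have "bounded (f ` closure {a. f a \<noteq> 0})" by (rule compact_imp_bounded)
  then obtain M where "\<forall>z \<in> f ` closure {a. f a \<noteq> 0}. norm z \<le> M" unfolding bounded_iff by blast
  then have M: "\<And>a. a \<in> closure {a. f a \<noteq> 0} \<Longrightarrow> cmod (f a) \<le> M" by blast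
  show thesis
  proof (rule that[of "max M 0"])
    fix a
    show "cmod (f a) \<le> max M 0"
    proof (cases "f a = 0")
      case False
      then show ?thesis using M[OF Cc_D(4)[OF assms False]] by simp
    qed simp
  qed simp
qed

text \<open>
  A locally compact Hausdorff space is completely regular; a function separating a point from the
  complement of a relatively compact neighbourhood is a bump function.
\<close>

lemma exists_bump:
  fixes a :: "'a :: t2_space"
  assumes lc: "locally compact (UNIV :: 'a set)" and V: "open V" "a \<in> V"
  obtains \<beta> :: "'a \<Rightarrow> real" and K where "continuous_on UNIV \<beta>" "\<And>b. 0 \<le> \<beta> b" "\<beta> a = 1"
    "compact K" "K \<subseteq> V" "\<And>b. \<beta> b \<noteq> 0 \<Longrightarrow> b \<in> K"
proof -
  have nbh: "\<exists>U K. open U \<and> compact K \<and> x \<in> U \<and> U \<subseteq> K \<and> K \<subseteq> W" if "open W" "x \<in> W" for x and W :: "'a set"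
  proof -
    have "openin (top_of_set UNIV) W \<and> x \<in> W" using that by simp
    from lc[unfolded locally_def, THEN spec, THEN spec, THEN mp, OF this]
    obtain U K where "openin (top_of_set UNIV) U" "compact K" "x \<in> U" "U \<subseteq> K" "K \<subseteq> W"
      by (elim exE conjE)
    then show ?thesis by (intro exI[of _ U] exI[of _ K]) simp
  qed
  have "locally_compact_space (euclidean :: 'a topology)"
    unfolding locally_compact_space_def
  proof
    fix x :: 'a
    from nbh[OF open_UNIV UNIV_I, of x] obtain U K where "open U" "compact K" "x \<in> U" "U \<subseteq> K"
      by (elim exE conjE)
    then show "\<exists>U K. openin euclidean U \<and> compactin euclidean K \<and> x \<in> U \<and> U \<subseteq> K"
      by (intro exI[of _ U] exI[of _ K]) simp
  qed
  moreover have "Hausdorff_space (euclidean :: 'a topology)"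
    unfolding Hausdorff_space_def unfolding disjnt_def using hausdorff by auto
  ultimately have cr: "completely_regular_space (euclidean :: 'a topology)"
    using locally_compact_Hausdorff_imp_regular_space completely_regular_eq_regular_space by blast
  obtain U K where UK: "open U" "compact K" "a \<in> U" "U \<subseteq> K" "K \<subseteq> V" using nbh[OF V] by blast
  obtain f where f: "continuous_map (euclidean :: 'a topology) euclideanreal f" "f a = 0" "f ` (- U) \<subseteq> {1}"
    using cr[unfolded completely_regular_space_alt', rule_format, of U a] UK
    by (auto simp: Compl_eq_Diff_UNIV)
  show thesis
  proof
    show "continuous_on UNIV (\<lambda>x. max 0 (1 - f x))"
      using f(1) by (intro continuous_intros) simp
    show "b \<in> K" if "max 0 (1 - f b) \<noteq> 0" for b
      using that f(3) UK(4) by (cases "b \<in> U") auto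
  qed (use f UK in auto)
qed

text \<open>
  The source of all partitions of unity below: dividing the functions by the maximum of their sum
  and \<open>\<epsilon>\<close> is continuous everywhere and makes them add up to \<open>1\<close> on the compact set. The property \<open>Q\<close>
  carries whatever else is needed about each function, such as its support, and the index \<open>i\<close> the data
  which this property refers to.
\<close>

lemma exists_bump_cover:
  fixes C :: "'a :: t2_space set" and Q :: "'i \<Rightarrow> ('a \<Rightarrow> real) \<Rightarrow> bool"
  assumes C: "compact C"
    and bump: "\<And>x. x \<in> C \<Longrightarrow> \<exists>i \<psi>. Q i \<psi> \<and> continuous_on UNIV \<psi> \<and> (\<forall>y. 0 \<le> \<psi> y) \<and> \<psi> x > 0"
  shows "\<exists>F i \<psi> \<epsilon>. finite F \<and> F \<subseteq> C \<and> \<epsilon> > 0 \<and>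
    (\<forall>x\<in>F. Q (i x) (\<psi> x) \<and> continuous_on UNIV (\<psi> x) \<and> (\<forall>y. 0 \<le> \<psi> x y)) \<and>
    (\<forall>y\<in>C. \<epsilon> \<le> (\<Sum>x\<in>F. \<psi> x y))"
proof -
  obtain i \<psi> where \<psi>: "\<And>x. x \<in> C \<Longrightarrow> Q (i x) (\<psi> x) \<and> continuous_on UNIV (\<psi> x) \<and> (\<forall>y. 0 \<le> \<psi> x y) \<and> \<psi> x x > 0"
    using bump by metis
  have "open {y. 0 < \<psi> x y}" if "x \<in> C" for x
    using \<psi>[OF that] by (intro open_Collect_less) auto
  moreover have "C \<subseteq> (\<Union>x\<in>C. {y. 0 < \<psi> x y})" using \<psi> by blast
  ultimately obtain F where F: "F \<subseteq> C" "finite F" "C \<subseteq> (\<Union>x\<in>F. {y. 0 < \<psi> x y})"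
    by (rule compactE_image[OF C])
  let ?S = "\<lambda>y. \<Sum>x\<in>F. \<psi> x y"
  have pos: "0 < ?S y" if y: "y \<in> C" for y
  proof -
    obtain x where "x \<in> F" "0 < \<psi> x y" using F(3) y by blast
    then show ?thesis using F \<psi> by (intro sum_pos2[of F x]) auto
  qed
  have "continuous_on C ?S"
    by (intro continuous_intros) (use F \<psi> in \<open>auto intro: continuous_on_subset\<close>)
  then have "\<exists>\<epsilon>>0. \<forall>y\<in>C. \<epsilon> \<le> ?S y"
  proof (cases "C = {}")
    case False
    with continuous_attains_inf[OF C False \<open>continuous_on C ?S\<close>] pos show ?thesis by blast
  qed (auto intro: zero_less_one)
  then obtain \<epsilon> where "\<epsilon> > 0" "\<forall>y\<in>C. \<epsilon> \<le> ?S y" by blast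
  moreover have "\<forall>x\<in>F. Q (i x) (\<psi> x) \<and> continuous_on UNIV (\<psi> x) \<and> (\<forall>y. 0 \<le> \<psi> x y)"
    using F(1) \<psi> by blast
  ultimately show ?thesis using F(1,2) by (intro exI[of _ F] exI[of _ i] exI[of _ \<psi>] exI[of _ \<epsilon>] conjI)
qed

section \<open>Bisections of an etale groupoid\<close>

locale etale_graded = groupoid_laws G
  for G :: "'g :: t2_space groupoid" +
  fixes c :: "'g \<Rightarrow> 'p :: group_add"
  assumes etale: "etale_groupoid G"
    and lc: "locally compact (UNIV :: 'g set)"
    and cocycle: "cocycle G c"
    and c_continuous: "continuous_map euclidean (discrete_topology UNIV) c"
begin

lemma c_mult: "cmp a b \<Longrightarrow> c (a \<odot> b) = c a + c b"
  using cocycle by (auto simp: cocycle_def)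

lemma c_r: "c (r a) = 0"
proof -
  have "c (r a) = c (r a) + c (r a)"
    using c_mult[of "r a" "r a"] r_unit[of "r a"] by (simp add: cmp_iff)
  then have "c (r a) + c (r a) = c (r a) + 0" by simp
  then show ?thesis by (rule add_left_imp_eq)
qed

lemma c_inv: "c (iv a) = - c a"
  using c_mult[OF cmp_inv_left, of a] c_r[of "iv a"] by (simp add: grange_def eq_neg_iff_add_eq_0)

lemma open_grade: "open (c -` S)"
proof -
  have "openin euclidean {x \<in> topspace euclidean. c x \<in> S}"
    using c_continuous by (rule openin_continuous_map_preimage) simp
  then have "open {x. c x \<in> S}" by simp
  then show ?thesis by (simp only: vimage_def)
qed

lemma continuous_inv: "continuous_on S iv"
proof -
  have "continuous_on UNIV iv" using etale by (simp add: etale_groupoid_def topological_groupoid_def)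
  then show ?thesis by (rule continuous_on_subset) simp
qed

lemma continuous_mult:
  assumes "continuous_on S f" "continuous_on S g" "\<And>x. x \<in> S \<Longrightarrow> cmp (f x) (g x)"
  shows "continuous_on S (\<lambda>x. f x \<odot> g x)"
proof -
  have "continuous_on (composable G) (\<lambda>(a, b). a \<odot> b)"
    using etale by (simp add: etale_groupoid_def topological_groupoid_def)
  from continuous_on_compose2[OF this continuous_on_Pair[OF assms(1,2)]] assms(3) show ?thesis by auto
qed

lemma continuous_r: "continuous_on S r"
  unfolding r_eq[abs_def]
  by (intro continuous_mult continuous_inv continuous_on_id) (rule cmp_inv_right)

lemma continuous_s: "continuous_on S s"
  by (rule continuous_on_compose2[OF continuous_r continuous_inv]) auto

lemma closed_composable: "closed (composable G)"
proof -
  have eq: "composable G = {x. s (fst x) = r (snd x)}" by (auto simp: cmp_iff)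
  show ?thesis
    unfolding eq
    by (intro closed_Collect_eq continuous_on_compose2[OF continuous_r] continuous_on_compose2[OF continuous_s]
        continuous_intros) auto
qed

text \<open>
  The function \<open>inv_into U r\<close> is the section of the range map with values in \<open>U\<close>, so the arrow of \<open>U\<close>
  with the same range as \<open>d\<close> is \<open>inv_into U r (r d)\<close>.
\<close>

definition bisection :: "'g set \<Rightarrow> bool"
  where "bisection U \<longleftrightarrow> open U \<and> inj_on r U \<and> inj_on s U \<and>
    openin (top_of_set (range r)) (r ` U) \<and> continuous_on (r ` U) (inv_into U r)"

text \<open>
  Intersecting a neighbourhood on which the range map is injective with the inverse of such a
  neighbourhood of \<open>a\<^sup>-\<^sup>1\<close> makes the source map injective as well.
\<close>

lemma exists_bisection:
  assumes V: "open V" "a \<in> V" obtains U where "bisection U" "a \<in> U" "U \<subseteq> V"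
proof -
  have loc: "\<exists>U h. open U \<and> a \<in> U \<and> openin (top_of_set (range r)) (r ` U) \<and> homeomorphism U (r ` U) r h" for a
    using etale unfolding etale_groupoid_def by blast
  obtain U h where U: "open U" "a \<in> U" "openin (top_of_set (range r)) (r ` U)" "homeomorphism U (r ` U) r h"
    using loc by blast
  obtain U' h' where U': "open U'" "iv a \<in> U'" "homeomorphism U' (r ` U') r h'"
    using loc[of "iv a"] by blast
  define W where "W = U \<inter> V \<inter> iv -` U'"
  have oW: "open W" unfolding W_def
    using U(1) V(1) open_vimage[OF U'(1) continuous_inv] by (intro open_Int)
  have inj: "inj_on r U" using U(4) by (metis homeomorphism_def inj_on_inverseI)
  have "inj_on r U'" using U'(3) by (metis homeomorphism_def inj_on_inverseI)
  then have "inj_on s W" unfolding W_def inj_on_def by (metis IntE inv_inv vimageE)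
  moreover have "openin (top_of_set (r ` U)) (r ` W)"
  proof -
    have "openin (top_of_set U) W" using oW by (auto simp: W_def openin_open_eq[OF U(1)])
    then show ?thesis using homeomorphism_imp_open_map[OF U(4)] by blast
  qed
  then have "openin (top_of_set (range r)) (r ` W)" using U(3) openin_trans by blast
  moreover have "continuous_on (r ` W) (inv_into W r)"
  proof (rule continuous_on_eq)
    show "continuous_on (r ` W) h"
      using U(4) by (auto simp: homeomorphism_def W_def intro: continuous_on_subset)
    fix x assume "x \<in> r ` W"
    then obtain b where b: "b \<in> W" "x = r b" by blast
    have "inv_into W r x = b" using b inj by (auto simp: W_def intro: inv_into_f_f inj_on_subset)
    moreover have "h x = b" using b U(4) by (auto simp: W_def homeomorphism_def)
    ultimately show "h x = inv_into W r x" by simp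
  qed
  moreover have "inj_on r W" using inj by (auto simp: W_def intro: inj_on_subset)
  ultimately show thesis using oW U(2) U'(2) V(2) by (intro that[of W]) (auto simp: bisection_def W_def)
qed

lemma bisection_inv_r: assumes "bisection U" "a \<in> U" shows "inv_into U r (r a) = a"
  using assms by (auto simp: bisection_def intro: inv_into_f_f)

lemma bisection_r_inv: "x \<in> r ` U \<Longrightarrow> inv_into U r x \<in> U" "x \<in> r ` U \<Longrightarrow> r (inv_into U r x) = x"
  by (auto intro: inv_into_into f_inv_into_f)

lemma open_bisection_range: assumes "bisection U" shows "open {d. r d \<in> r ` U}"
proof -
  obtain W where W: "open W" "r ` U = range r \<inter> W"
    using assms by (auto simp: bisection_def openin_open)
  have "{d. r d \<in> r ` U} = r -` W" using W(2) by auto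
  then show ?thesis using open_vimage[OF W(1) continuous_r] by simp
qed

text \<open>
  The two definitions of the function fit together continuously: it is \<open>0\<close> at arrows with range
  outside of \<open>r (supp f)\<close>, which is compact and hence closed, it is a composition of continuous maps
  at arrows with range in \<open>r U\<close>, and these two open sets cover the groupoid.
\<close>

lemma continuous_along_bisection:
  assumes U: "bisection U" and f: "f \<in> Cc U"
    and g: "continuous_on {(a, d). r a = r d} (\<lambda>(a, d). g a d :: complex)"
  shows "continuous_on UNIV (\<lambda>d. if r d \<in> r ` U then f (inv_into U r (r d)) * g (inv_into U r (r d)) d else 0)"
    (is "continuous_on UNIV ?F")
proof -
  let ?K = "closure {a. f a \<noteq> 0}" and ?R = "{d. r d \<in> r ` U}" and ?h = "\<lambda>d. inv_into U r (r d)"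
  have "compact (r ` ?K)" by (intro compact_continuous_image continuous_r Cc_D[OF f])
  then have "open (- (r ` ?K))" by (rule open_Compl[OF compact_imp_closed])
  from open_vimage[OF this continuous_r] have oV: "open {d. r d \<notin> r ` ?K}" by (simp add: vimage_def)
  have h: "continuous_on ?R ?h"
    using U by (intro continuous_on_compose2[OF _ continuous_r]) (auto simp: bisection_def)
  have 1: "continuous_on ?R ?F"
  proof (rule continuous_on_eq)
    have "continuous_on ?R (\<lambda>d. g (?h d) d)"
      using continuous_on_compose2[OF g continuous_on_Pair[OF h continuous_on_id]] bisection_r_inv(2) by auto
    moreover have "continuous_on ?R (\<lambda>d. f (?h d))"
      by (rule continuous_on_compose2[OF Cc_D(1)[OF f] h]) simp
    ultimately show "continuous_on ?R (\<lambda>d. f (?h d) * g (?h d) d)" by (intro continuous_intros)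
  qed auto
  have 2: "continuous_on {d. r d \<notin> r ` ?K} ?F"
  proof (rule continuous_on_eq[OF continuous_on_const[of _ 0]])
    fix d assume d: "d \<in> {d. r d \<notin> r ` ?K}"
    show "0 = ?F d"
    proof (cases "r d \<in> r ` U")
      case True
      have "f (?h d) = 0"
      proof (rule ccontr)
        assume "f (?h d) \<noteq> 0"
        from imageI[OF Cc_D(4)[OF f this], of r] bisection_r_inv(2)[OF True] d show False by simp
      qed
      then show ?thesis by simp
    qed simp
  qed
  have "?R \<union> {d. r d \<notin> r ` ?K} = UNIV" using Cc_D(3)[OF f] by blast
  then show ?thesis
    using continuous_on_open_Un[OF open_bisection_range[OF U] oV 1 2] by simp
qed

text \<open>
  A partition of unity on the support, subordinate to bisections, writes every compactly supported
  function as a finite sum of functions supported in bisections.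
\<close>

lemma Cc_induct [consumes 2, case_names zero add bisection]:
  assumes f: "f \<in> Cc V" and V: "open V"
    and zero: "Q (\<lambda>_. 0)"
    and add: "\<And>f g. f \<in> Cc V \<Longrightarrow> g \<in> Cc V \<Longrightarrow> Q f \<Longrightarrow> Q g \<Longrightarrow> Q (\<lambda>a. f a + g a)"
    and bis: "\<And>U f. bisection U \<Longrightarrow> U \<subseteq> V \<Longrightarrow> f \<in> Cc U \<Longrightarrow> Q f"
  shows "Q f"
proof -
  let ?supp = "closure {a. f a \<noteq> 0}"
  define bump where "bump U \<psi> \<longleftrightarrow> bisection U \<and> U \<subseteq> V \<and>
      (\<exists>K. compact K \<and> K \<subseteq> U \<and> (\<forall>b. \<psi> b \<noteq> 0 \<longrightarrow> b \<in> K))" for U and \<psi> :: "'g \<Rightarrow> real"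
  have bumps: "\<exists>U \<psi>. bump U \<psi> \<and> continuous_on UNIV \<psi> \<and> (\<forall>y. 0 \<le> \<psi> y) \<and> \<psi> a > (0 :: real)" if "a \<in> ?supp" for a
  proof -
    have "a \<in> V" using that Cc_D(3)[OF f] by blast
    then obtain U where U: "bisection U" "a \<in> U" "U \<subseteq> V" by (rule exists_bisection[OF V])
    then have "open U" by (simp add: bisection_def)
    then obtain \<beta> :: "'g \<Rightarrow> real" and K where "continuous_on UNIV \<beta>" "\<And>b. 0 \<le> \<beta> b" "\<beta> a = 1"
      "compact K" "K \<subseteq> U" "\<And>b. \<beta> b \<noteq> 0 \<Longrightarrow> b \<in> K" by (rule exists_bump[OF lc _ U(2)]) blast
    with U show ?thesis
      unfolding bump_def by (intro exI[of _ U] exI[of _ \<beta>]) (simp, blast)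
  qed
  have "\<exists>F U \<psi> \<epsilon>. finite F \<and> F \<subseteq> ?supp \<and> \<epsilon> > 0 \<and>
      (\<forall>x\<in>F. bump (U x) (\<psi> x) \<and> continuous_on UNIV (\<psi> x) \<and> (\<forall>y. 0 \<le> \<psi> x y)) \<and>
      (\<forall>y\<in>?supp. \<epsilon> \<le> (\<Sum>x\<in>F. \<psi> x y))"
    by (rule exists_bump_cover[OF Cc_D(2)[OF f] bumps])
  then obtain F :: "'g set" and U \<psi> \<epsilon> where F: "finite F" "(\<epsilon> :: real) > 0"
    and \<Psi>: "\<forall>x\<in>F. bump (U x) (\<psi> x) \<and> continuous_on UNIV (\<psi> x) \<and> (\<forall>y. 0 \<le> \<psi> x y)"
    and lower: "\<forall>y\<in>?supp. \<epsilon> \<le> (\<Sum>x\<in>F. \<psi> x y)"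
    by (elim exE conjE)
  have bump: "bump (U x) (\<psi> x)" and \<psi>: "continuous_on UNIV (\<psi> x)" "0 \<le> \<psi> x y" if "x \<in> F" for x y
    using \<Psi> that by simp_all
  have U: "bisection (U x)" "U x \<subseteq> V" "\<exists>K. compact K \<and> K \<subseteq> U x \<and> (\<forall>b. \<psi> x b \<noteq> 0 \<longrightarrow> b \<in> K)"
    if "x \<in> F" for x using bump[OF that] by (simp_all add: bump_def)
  define m where "m y = max (\<Sum>x\<in>F. \<psi> x y) \<epsilon>" for y
  have m: "m y > 0" for y using F by (simp add: m_def)
  define q where "q x a = f a * complex_of_real (\<psi> x a / m a)" for x a
  have q: "q x \<in> Cc (U x)" if x: "x \<in> F" for x
  proof -
    obtain K where K: "compact K" "K \<subseteq> U x" "\<And>b. \<psi> x b \<noteq> 0 \<Longrightarrow> b \<in> K" using U(3)[OF x] by blast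
    have "continuous_on UNIV m" unfolding m_def by (intro continuous_intros \<psi>)
    from continuous_on_divide[OF \<psi>(1)[OF x] this] have "continuous_on UNIV (\<lambda>a. \<psi> x a / m a)"
      using m by (metis less_irrefl)
    then have "continuous_on UNIV (q x)"
      unfolding q_def by (intro continuous_on_mult continuous_on_of_real Cc_D(1)[OF f])
    then show ?thesis by (rule Cc_I[OF _ K(1) _ K(2)]) (auto simp: q_def intro: K(3))
  qed
  have "Q (\<lambda>a. \<Sum>x\<in>F'. q x a) \<and> (\<lambda>a. \<Sum>x\<in>F'. q x a) \<in> Cc V" if "F' \<subseteq> F" "finite F'" for F'
    using that(2,1)
  proof (induction F' rule: finite_induct)
    case (insert x F')
    have "q x \<in> Cc V" using q[of x] U(2)[of x] insert(4) by (intro Cc_mono[of "q x" "U x" V]) simp_all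
    moreover have "Q (q x)" using bis[of "U x" "q x"] q[of x] U(1,2)[of x] insert(4) by simp
    ultimately show ?case using insert add[of "q x" "\<lambda>a. \<Sum>x\<in>F'. q x a"] Cc_add[of "q x" V "\<lambda>a. \<Sum>x\<in>F'. q x a"] by simp
  qed (simp add: zero Cc_zero)
  then have "Q (\<lambda>a. \<Sum>x\<in>F. q x a)" using F by blast
  moreover have "(\<Sum>x\<in>F. q x a) = f a" for a
  proof (cases "f a = 0")
    case False
    then have "m a = (\<Sum>x\<in>F. \<psi> x a)" using bspec[OF lower Cc_D(4)[OF f False]] by (simp add: m_def)
    then have "(\<Sum>x\<in>F. \<psi> x a / m a) = 1" using m[of a] by (simp add: sum_divide_distrib[symmetric])
    then show ?thesis
      by (simp add: q_def sum_distrib_left[symmetric] of_real_sum[symmetric] del: of_real_divide of_real_sum)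
  qed (simp add: q_def)
  ultimately show ?thesis by simp
qed

section \<open>The reduced C*-algebra and its grading\<close>

text \<open>
  For every \<open>d\<close> at most one arrow \<open>a\<close> in the bisection can be divided off from the left, so the
  convolution sum at \<open>d\<close> has at most the single term \<open>f a * \<xi> (a\<^sup>-\<^sup>1d)\<close>. The map \<open>d \<mapsto> a\<^sup>-\<^sup>1d\<close> is injective because
  the range of \<open>a\<^sup>-\<^sup>1d\<close> is the source of \<open>a\<close>, which determines \<open>a\<close>.
\<close>

lemma bisection_kernel_exists:
  assumes U: "bisection U" and f: "f \<in> Cc U"
  shows "\<exists>T. has_kernel f T \<and> (\<forall>\<xi> d. ell2_apply (op_apply T \<xi>) d =
    (if r d \<in> r ` U then f (inv_into U r (r d)) * ell2_apply \<xi> (iv (inv_into U r (r d)) \<odot> d) else 0))"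
proof -
  let ?h = "\<lambda>d. inv_into U r (r d)"
  define w where "w d = (if r d \<in> r ` U then f (?h d) else 0)" for d
  obtain M where M: "\<And>a. cmod (f a) \<le> M" "M \<ge> 0" by (rule Cc_bounded[OF f]) blast
  have inj: "inj_on (\<lambda>d. iv (?h d) \<odot> d) {d. w d \<noteq> 0}"
  proof (rule inj_onI)
    fix d e assume d: "d \<in> {d. w d \<noteq> 0}" and e: "e \<in> {d. w d \<noteq> 0}" and eq: "iv (?h d) \<odot> d = iv (?h e) \<odot> e"
    have rd: "r d \<in> r ` U" and re: "r e \<in> r ` U" using d e by (auto simp: w_def split: if_splits)
    note ld = left_div[OF bisection_r_inv(2)[OF rd]] and le = left_div[OF bisection_r_inv(2)[OF re]]
    have "s (?h d) = s (?h e)" using ld(5) le(5) eq by simp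
    then have "?h d = ?h e"
      by (rule inj_onD[OF _ _ bisection_r_inv(1)[OF rd] bisection_r_inv(1)[OF re], rotated])
        (use U in \<open>simp add: bisection_def\<close>)
    then show "d = e" using ld(3) le(3) eq by metis
  qed
  have "cmod (w d) \<le> M" for d using M by (simp add: w_def)
  from weighted_composition_operator[of w, OF this inj]
  obtain T where T: "\<And>\<xi> d. ell2_apply (op_apply T \<xi>) d = w d * ell2_apply \<xi> (iv (?h d) \<odot> d)" by blast
  have "has_kernel f T"
    unfolding has_kernel_def
  proof (intro allI)
    fix b d
    have entry: "ell2_apply (op_apply T (ket b)) d = w d * of_bool (b = iv (?h d) \<odot> d)"
      by (simp add: T ket.rep_eq)
    show "ell2_apply (op_apply T (ket b)) d = (if s d = s b then f (d \<odot> iv b) else 0)"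
    proof (cases "r d \<in> r ` U \<and> b = iv (?h d) \<odot> d")
      case True
      note ld = left_div[OF bisection_r_inv(2)[of "r d" U]]
      have "s b = s d" "d \<odot> iv b = ?h d" using True ld(4,6) by blast+
      then show ?thesis using True unfolding entry w_def by simp
    next
      case False
      have "f (d \<odot> iv b) = 0" if sd: "s d = s b"
      proof (rule ccontr)
        assume "f (d \<odot> iv b) \<noteq> 0"
        then have a: "d \<odot> iv b \<in> U" by (rule Cc_D(5)[OF f])
        have "r d = r (d \<odot> iv b)" using right_div(4)[OF sd] by simp
        then have "r d \<in> r ` U" "?h d = d \<odot> iv b" using a bisection_inv_r[OF U a] by auto
        then show False using False right_div(6)[OF sd] by simp
      qed
      then show ?thesis unfolding entry w_def using False by auto
    qed
  qed
  then show ?thesis using T by (intro exI[of _ T]) (simp add: w_def)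
qed

lemma bisection_kernel_apply:
  assumes "bisection U" "f \<in> Cc U" "has_kernel f T"
  shows "ell2_apply (op_apply T \<xi>) d =
    (if r d \<in> r ` U then f (inv_into U r (r d)) * ell2_apply \<xi> (iv (inv_into U r (r d)) \<odot> d) else 0)"
  using bisection_kernel_exists[OF assms(1,2)] has_kernel_unique[OF assms(3)] by metis

lemma Cc_kernel_exists: assumes "f \<in> Cc UNIV" shows "\<exists>T. has_kernel f T"
  using assms open_UNIV
proof (induction rule: Cc_induct)
  case (bisection U f)
  then show ?case using bisection_kernel_exists by blast
qed (use has_kernel_zero has_kernel_add in blast)+

definition graded_part :: "'p \<Rightarrow> 'g ell2_op set"
  where "graded_part g = {T. \<exists>f \<in> Cc (c -` {g}). has_kernel f T}"

definition spectral :: "'p \<Rightarrow> 'g ell2_op set"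
  where "spectral g = closure (graded_part g)"

lemma left_regular_image:
  "left_regular G ` Cc U = {T. \<exists>f \<in> Cc U. has_kernel f T}"
proof (intro equalityI subsetI)
  fix T assume "T \<in> left_regular G ` Cc U"
  then obtain f where f: "f \<in> Cc U" "T = left_regular G f" by blast
  obtain S where S: "has_kernel f S" using Cc_kernel_exists[OF Cc_mono[OF f(1)]] by blast
  then have "T = S" using f(2) left_regular_eq by blast
  then show "T \<in> {T. \<exists>f \<in> Cc U. has_kernel f T}" using S f(1) by blast
next
  fix T assume "T \<in> {T. \<exists>f \<in> Cc U. has_kernel f T}"
  then obtain f where f: "f \<in> Cc U" "has_kernel f T" by blast
  then have "T = left_regular G f" using left_regular_eq by simp
  then show "T \<in> left_regular G ` Cc U" using f(1) by blast
qed

lemma graded_part_add: "S \<in> graded_part g \<Longrightarrow> T \<in> graded_part g \<Longrightarrow> S + T \<in> graded_part g"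
  unfolding graded_part_def using Cc_add has_kernel_add by blast

lemma graded_part_scaleC: "S \<in> graded_part g \<Longrightarrow> z *\<^sub>C S \<in> graded_part g"
proof -
  assume "S \<in> graded_part g"
  then obtain f where f: "f \<in> Cc (c -` {g})" "has_kernel f S" unfolding graded_part_def by blast
  have "(\<lambda>a. f a * z) \<in> Cc (c -` {g})" by (rule Cc_mult[OF f(1) continuous_on_const])
  then have "(\<lambda>a. z * f a) \<in> Cc (c -` {g})" by (simp add: mult.commute)
  with has_kernel_scaleC[OF f(2)] show ?thesis unfolding graded_part_def by blast
qed

lemma graded_part_zero: "0 \<in> graded_part g"
  unfolding graded_part_def using Cc_zero has_kernel_zero by blast

lemma graded_part_star: assumes "S \<in> graded_part g" shows "S\<^sup>\<star> \<in> graded_part (- g)"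
proof -
  obtain f where f: "f \<in> Cc (c -` {g})" "has_kernel f S" using assms unfolding graded_part_def by blast
  have "(\<lambda>a. cnj (f (iv a))) \<in> Cc (c -` {- g})"
  proof (rule Cc_I)
    show "continuous_on UNIV (\<lambda>a. cnj (f (iv a)))"
      by (intro continuous_on_cnj continuous_on_compose2[OF Cc_D(1)[OF f(1)] continuous_inv]) simp
    show "compact (iv ` closure {a. f a \<noteq> 0})"
      by (intro compact_continuous_image continuous_inv Cc_D(2)[OF f(1)])
    show "a \<in> iv ` closure {a. f a \<noteq> 0}" if "cnj (f (iv a)) \<noteq> 0" for a
      by (rule image_eqI[of _ _ "iv a"]) (use that Cc_D(4)[OF f(1), of "iv a"] in simp_all)
    show "iv ` closure {a. f a \<noteq> 0} \<subseteq> c -` {- g}" using Cc_D(3)[OF f(1)] by (auto simp: c_inv)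
  qed
  with has_kernel_star[OF f(2)] show ?thesis unfolding graded_part_def by blast
qed

text \<open>
  The convolution of \<open>f\<close> and \<open>f'\<close> has at most one term at every arrow if \<open>f\<close> is supported in a bisection,
  so its continuity is a special case of continuity along a bisection. Its support is contained in the
  image of a compact set of composable pairs. The general case follows by decomposing \<open>f\<close>.
\<close>

lemma graded_part_mult:
  assumes S: "S \<in> graded_part g" and T: "T \<in> graded_part h"
  shows "S * T \<in> graded_part (g + h)"
proof -
  obtain f where f: "f \<in> Cc (c -` {g})" "has_kernel f S" using S unfolding graded_part_def by blast
  obtain f' where f': "f' \<in> Cc (c -` {h})" "has_kernel f' T" using T unfolding graded_part_def by blast
  have "\<exists>S. has_kernel f S \<and> S * T \<in> graded_part (g + h)"
    using f(1) open_grade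
  proof (induction rule: Cc_induct)
    case zero
    show ?case using has_kernel_zero graded_part_zero by (intro exI[of _ 0]) simp
  next
    case (add f1 f2)
    then obtain S1 S2 where "has_kernel f1 S1" "S1 * T \<in> graded_part (g + h)"
      "has_kernel f2 S2" "S2 * T \<in> graded_part (g + h)" by blast
    then show ?case using has_kernel_add graded_part_add by (intro exI[of _ "S1 + S2"]) (simp add: distrib_right)
  next
    case (bisection U f)
    let ?h = "\<lambda>d. inv_into U r (r d)"
    obtain S where S: "has_kernel f S" using bisection_kernel_exists bisection by blast
    define F where "F d = (if r d \<in> r ` U then f (?h d) * f' (iv (?h d) \<odot> d) else 0)" for d
    have "has_kernel F (S * T)"
      unfolding has_kernel_def
    proof (intro allI)
      fix b d
      show "ell2_apply (op_apply (S * T) (ket b)) d = (if s d = s b then F (d \<odot> iv b) else 0)"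
      proof (cases "r d \<in> r ` U")
        case True
        note ld = left_div[OF bisection_r_inv(2)[OF True]]
        have "ell2_apply (op_apply (S * T) (ket b)) d =
            f (?h d) * (if s d = s b then f' (iv (?h d) \<odot> d \<odot> iv b) else 0)"
          using f'(2) True ld(4)
          by (simp add: op_apply_mult bisection_kernel_apply[OF bisection(1,3) S] has_kernel_def)
        moreover have "iv (?h d) \<odot> d \<odot> iv b = iv (?h d) \<odot> (d \<odot> iv b)" if "s d = s b"
          by (rule mult_assoc[OF ld(1) right_div(1)[OF that]])
        ultimately show ?thesis using True right_div(4)[of d b] by (simp add: F_def)
      next
        case False
        then show ?thesis using right_div(4)[of d b]
          by (simp add: op_apply_mult bisection_kernel_apply[OF bisection(1,3) S] F_def)
      qed
    qed
    moreover have "F \<in> Cc (c -` {g + h})"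
    proof (rule Cc_I)
      let ?K = "closure {a. f a \<noteq> 0} \<times> closure {a. f' a \<noteq> 0} \<inter> composable G"
      have "continuous_on {(a, d). r a = r d} (\<lambda>(a, d). f' (iv a \<odot> d))"
      proof -
        have "continuous_on {(a, d). r a = r d} (\<lambda>x. iv (fst x) \<odot> snd x)"
          by (intro continuous_mult continuous_on_compose2[OF continuous_inv] continuous_on_fst
              continuous_on_snd continuous_on_id) (auto simp: cmp_iff)
        from continuous_on_compose2[OF Cc_D(1)[OF f'(1)] this] show ?thesis by (simp add: case_prod_beta)
      qed
      then show "continuous_on UNIV F"
        unfolding F_def by (rule continuous_along_bisection[OF bisection(1,3)])
      have "compact ?K"
        by (intro compact_Int_closed compact_Times closed_composable Cc_D(2)[OF f'(1)] Cc_D(2)[OF bisection(3)])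
      then show "compact ((\<lambda>(a, b). a \<odot> b) ` ?K)"
      proof (rule compact_continuous_image[rotated])
        have "continuous_on ?K (\<lambda>x. fst x \<odot> snd x)"
          by (intro continuous_mult continuous_on_fst continuous_on_snd continuous_on_id) auto
        then show "continuous_on ?K (\<lambda>(a, b). a \<odot> b)" by (simp add: case_prod_beta)
      qed
      show "(\<lambda>(a, b). a \<odot> b) ` ?K \<subseteq> c -` {g + h}"
        using Cc_D(3)[OF bisection(3)] bisection(2) Cc_D(3)[OF f'(1)] c_mult by fastforce
      show "d \<in> (\<lambda>(a, b). a \<odot> b) ` ?K" if "F d \<noteq> 0" for d
      proof -
        have rd: "r d \<in> r ` U" and ne: "f (?h d) \<noteq> 0" "f' (iv (?h d) \<odot> d) \<noteq> 0"
          using that by (auto simp: F_def split: if_splits)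
        note ld = left_div[OF bisection_r_inv(2)[OF rd]]
        show ?thesis
          by (rule image_eqI[of _ _ "(?h d, iv (?h d) \<odot> d)"])
            (use ld(2,3) Cc_D(4)[OF bisection(3) ne(1)] Cc_D(4)[OF f'(1) ne(2)] in simp_all)
      qed
    qed
    ultimately show ?case using S unfolding graded_part_def by blast
  qed
  then show ?thesis using has_kernel_unique[OF f(2)] by blast
qed

sublocale graded_subspaces spectral
proof
  fix g h x y
  show "closed (spectral g)" by (simp add: spectral_def)
  show "0 \<in> spectral g" unfolding spectral_def using graded_part_zero closure_subset by blast
  have "subspace (graded_part g)"
    by (intro subspaceI graded_part_zero graded_part_add) (simp_all add: scaleR_scaleC graded_part_scaleC)
  from subspace_add[OF subspace_closure[OF this]]
  show "x \<in> spectral g \<Longrightarrow> y \<in> spectral g \<Longrightarrow> x + y \<in> spectral g" by (simp add: spectral_def)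
  show "x \<in> spectral g \<Longrightarrow> z *\<^sub>C x \<in> spectral g" for z
    unfolding spectral_def
    by (erule bounded_linear_closure_in[OF bounded_linear_scaleC _ _ closed_closure])
      (rule subsetD[OF closure_subset], rule graded_part_scaleC)
  show "x \<in> spectral g \<Longrightarrow> x\<^sup>\<star> \<in> spectral (- g)"
    unfolding spectral_def
    by (erule bounded_linear_closure_in[OF bounded_linear_star _ _ closed_closure])
      (rule subsetD[OF closure_subset], rule graded_part_star)
  assume x: "x \<in> spectral g" and y: "y \<in> spectral h"
  have "u * y \<in> spectral (g + h)" if u: "u \<in> graded_part g" for u
    using y unfolding spectral_def
    by (rule bounded_linear_closure_in[OF bounded_linear_mult_right _ _ closed_closure])
      (rule subsetD[OF closure_subset], rule graded_part_mult[OF u])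
  with x show "x * y \<in> spectral (g + h)"
    unfolding spectral_def
    by (elim bounded_linear_closure_in[OF bounded_linear_mult_left _ _ closed_closure])
qed

lemma groupoid_product_system_eq: "groupoid_product_system G c = X"
  by (simp add: groupoid_product_system_def spectral_def[abs_def] graded_part_def left_regular_image)

section \<open>Local units\<close>

lemma has_kernel_apply_nonzero:
  assumes T: "has_kernel f T" and nz: "ell2_apply (op_apply T \<xi>) d \<noteq> 0"
  obtains a where "r a = r d" "f a \<noteq> 0"
proof -
  have "\<exists>b. s d = s b \<and> f (d \<odot> iv b) \<noteq> 0"
  proof (rule ccontr)
    assume "\<not> ?thesis"
    then have "(\<lambda>b. ell2_apply \<xi> b * ell2_apply (op_apply T (ket b)) d) = (\<lambda>_. 0)"
      using T by (auto simp: has_kernel_def)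
    then have "((\<lambda>_. 0) has_sum ell2_apply (op_apply T \<xi>) d) (UNIV :: 'g set)"
      using op_apply_has_sum[of \<xi> T d] by (simp only:)
    with nz show False using has_sum_unique[OF _ has_sum_0_simp] by blast
  qed
  then show thesis using right_div(4) that by blast
qed

lemma diagonal_apply:
  assumes "\<And>b d. ell2_apply (op_apply E (ket b)) d = (if b = d then e d else 0)"
  shows "ell2_apply (op_apply E \<xi>) d = e d * ell2_apply \<xi> d"
proof -
  have "((\<lambda>b. ell2_apply \<xi> b * (if b = d then e d else 0)) has_sum ell2_apply (op_apply E \<xi>) d) UNIV"
    using op_apply_has_sum[of \<xi> E d] unfolding assms .
  moreover have "((\<lambda>b. ell2_apply \<xi> b * (if b = d then e d else 0)) has_sum ell2_apply \<xi> d * e d) UNIV"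
    by (rule has_sum_cong_neutral[THEN iffD1, OF _ _ _ has_sum_finite[of "{d}" "\<lambda>b. ell2_apply \<xi> b * e d", simplified]])
      auto
  ultimately show ?thesis using has_sum_unique by (metis mult.commute)
qed

text \<open>
  An entry in row \<open>d\<close> and column \<open>b\<close> involves arrows \<open>a\<close> and \<open>a'\<close> of the bisection with
  \<open>a\<^sup>-\<^sup>1d = a'\<^sup>-\<^sup>1b\<close>. They have the same source and hence are equal, so \<open>b = d\<close>.
\<close>

lemma bisection_mult_star_entry:
  assumes U: "bisection U" and f: "f \<in> Cc U" and T: "has_kernel f T"
  shows "ell2_apply (op_apply (T * T\<^sup>\<star>) (ket b)) d =
    (if b = d then if r d \<in> r ` U then (cmod (f (inv_into U r (r d))))\<^sup>2 else 0 else 0)"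
proof (cases "r d \<in> r ` U")
  case True
  let ?a = "inv_into U r (r d)"
  let ?d = "iv ?a \<odot> d"
  have a: "?a \<in> U" "r ?a = r d" using bisection_r_inv[OF True] by auto
  note ld = left_div[OF a(2)]
  have entry: "ell2_apply (op_apply (T * T\<^sup>\<star>) (ket b)) d =
      f ?a * cnj (if s b = s d then f (b \<odot> iv ?d) else 0)"
    using True T ld(4) by (simp add: op_apply_mult bisection_kernel_apply[OF U f T] star_entry has_kernel_def)
  show ?thesis
  proof (cases "b = d")
    case True
    then show ?thesis
      unfolding entry using \<open>r d \<in> r ` U\<close> ld(6) by (simp add: complex_norm_square del: of_real_power)
  next
    case False
    have "f (b \<odot> iv ?d) = 0" if "s b = s d"
    proof (rule ccontr)
      assume "f (b \<odot> iv ?d) \<noteq> 0"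
      then have e: "b \<odot> iv ?d \<in> U" by (rule Cc_D(5)[OF f])
      have sb: "s b = s ?d" using that ld(4) by simp
      have "s (b \<odot> iv ?d) = s ?a" using right_div(5)[OF sb] ld(5) by simp
      then have "b \<odot> iv ?d = ?a" using U e a(1) unfolding bisection_def by (metis inj_onD)
      then have "b = d" using right_div(3)[OF sb] ld(3) by simp
      with False show False by simp
    qed
    then show ?thesis using False unfolding entry by simp
  qed
next
  case False
  then show ?thesis by (simp add: op_apply_mult bisection_kernel_apply[OF U f T])
qed

text \<open>
  If \<open>\<phi>\<close> is supported in a bisection \<open>U\<close> of degree \<open>p\<close>, then \<open>\<phi>\<phi>\<^sup>\<star>\<close> is the multiplication operator by
  the function \<open>\<bar>\<phi>\<bar>\<^sup>2\<close> transported from \<open>U\<close> to the unit space along the range map. With a partition of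
  unity this gives elements of \<open>finite_K p\<close> that are multiplication by a function on the unit space
  with value \<open>1\<close> on a prescribed compact set of ranges of arrows of degree \<open>p\<close>.
\<close>

lemma local_unit:
  assumes C: "compact C" "C \<subseteq> r ` (c -` {p})"
  shows "\<exists>E e. E \<in> finite_K p \<and> (\<forall>\<xi> d. ell2_apply (op_apply E \<xi>) d = e d * ell2_apply \<xi> d) \<and>
    (\<forall>d. r d \<in> C \<longrightarrow> e d = 1)"
proof -
  define transport where "transport U \<beta> d = (if r d \<in> r ` U then \<beta> (inv_into U r (r d)) else 0)"
    for U and \<beta> :: "'g \<Rightarrow> real" and d
  define good where "good = (\<lambda>(U, \<beta>) \<psi>. bisection U \<and> U \<subseteq> c -` {p} \<and> (\<forall>b. 0 \<le> \<beta> b) \<and>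
    continuous_on UNIV \<beta> \<and> (\<exists>K. compact K \<and> K \<subseteq> U \<and> (\<forall>b. \<beta> b \<noteq> 0 \<longrightarrow> b \<in> K)) \<and> \<psi> = transport U \<beta>)"
  have bumps: "\<exists>i \<psi>. good i \<psi> \<and> continuous_on UNIV \<psi> \<and> (\<forall>y. 0 \<le> \<psi> y) \<and> \<psi> x > 0" if x: "x \<in> C" for x
  proof -
    obtain a where a: "c a = p" "x = r a" using C(2) x by blast
    then have "a \<in> c -` {p}" by simp
    then obtain U where U: "bisection U" "a \<in> U" "U \<subseteq> c -` {p}" by (rule exists_bisection[OF open_grade])
    then have "open U" by (simp add: bisection_def)
    then obtain \<beta> :: "'g \<Rightarrow> real" and K where \<beta>: "continuous_on UNIV \<beta>" "\<And>b. 0 \<le> \<beta> b" "\<beta> a = 1"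
      "compact K" "K \<subseteq> U" "\<And>b. \<beta> b \<noteq> 0 \<Longrightarrow> b \<in> K" by (rule exists_bump[OF lc _ U(2)]) blast
    have "good (U, \<beta>) (transport U \<beta>)"
      unfolding good_def using U \<beta> by (simp, blast)
    moreover have "continuous_on UNIV (transport U \<beta>)"
    proof -
      have "(\<lambda>a. complex_of_real (\<beta> a)) \<in> Cc U"
        by (rule Cc_I[OF continuous_on_of_real[OF \<beta>(1)] \<beta>(4) _ \<beta>(5)]) (simp add: \<beta>(6))
      from continuous_along_bisection[OF U(1) this, of "\<lambda>_ _. 1"]
      have "continuous_on UNIV (\<lambda>d. Re (if r d \<in> r ` U then complex_of_real (\<beta> (inv_into U r (r d))) * 1 else 0))"
        by (intro continuous_on_Re) (simp add: case_prod_beta)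
      then show ?thesis
        by (rule continuous_on_eq) (simp add: transport_def)
    qed
    moreover have "transport U \<beta> x > 0"
      using U(2) \<beta>(3) by (simp add: transport_def a(2) bisection_inv_r[OF U(1,2)])
    moreover have "0 \<le> transport U \<beta> y" for y using \<beta>(2) by (simp add: transport_def)
    ultimately show ?thesis by blast
  qed
  have "\<exists>F i \<psi> \<epsilon>. finite F \<and> F \<subseteq> C \<and> \<epsilon> > 0 \<and>
      (\<forall>x\<in>F. good (i x) (\<psi> x) \<and> continuous_on UNIV (\<psi> x) \<and> (\<forall>y. 0 \<le> \<psi> x y)) \<and>
      (\<forall>y\<in>C. \<epsilon> \<le> (\<Sum>x\<in>F. \<psi> x y))"
    by (rule exists_bump_cover[OF C(1) bumps])
  then obtain F :: "'g set" and i \<psi> \<epsilon> where F: "finite F" "(\<epsilon> :: real) > 0"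
    and good: "\<forall>x\<in>F. good (i x) (\<psi> x) \<and> continuous_on UNIV (\<psi> x) \<and> (\<forall>y. 0 \<le> \<psi> x y)"
    and lower: "\<forall>y\<in>C. \<epsilon> \<le> (\<Sum>x\<in>F. \<psi> x y)"
    by (elim exE conjE)
  define U where "U x = fst (i x)" for x
  define \<beta> where "\<beta> x = snd (i x)" for x
  have U: "bisection (U x)" "U x \<subseteq> c -` {p}" and \<beta>: "continuous_on UNIV (\<beta> x)" "\<And>b. 0 \<le> \<beta> x b"
    and supp: "\<exists>K. compact K \<and> K \<subseteq> U x \<and> (\<forall>b. \<beta> x b \<noteq> 0 \<longrightarrow> b \<in> K)"
    and \<psi>: "\<psi> x = transport (U x) (\<beta> x)" "continuous_on UNIV (\<psi> x)" if "x \<in> F" for x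
    using bspec[OF good that] unfolding good_def U_def \<beta>_def case_prod_beta by blast+
  define m where "m y = max (\<Sum>x\<in>F. \<psi> x y) \<epsilon>" for y
  have m: "m y > 0" for y using F by (simp add: m_def)
  have m_cong: "m d = m e" if "r d = r e" for d e
    unfolding m_def by (rule arg_cong[of _ _ "\<lambda>z. max z \<epsilon>"], rule sum.cong) (simp_all add: \<psi>(1) transport_def that)
  have m_cont: "continuous_on UNIV m" unfolding m_def by (intro continuous_intros \<psi>(2))
  \<comment> \<open>The square root makes \<open>\<phi> \<phi>\<^sup>\<star>\<close> the partition function itself.\<close>
  define \<phi> where "\<phi> x a = complex_of_real (sqrt (\<beta> x a / m a))" for x a
  have \<phi>: "\<phi> x \<in> Cc (U x)" if x: "x \<in> F" for x
  proof -
    obtain K where K: "compact K" "K \<subseteq> U x" "\<And>b. \<beta> x b \<noteq> 0 \<Longrightarrow> b \<in> K" using supp[OF x] by blast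
    from continuous_on_divide[OF \<beta>(1)[OF x] m_cont] have "continuous_on UNIV (\<lambda>a. \<beta> x a / m a)"
      using m by (metis less_irrefl)
    then have "continuous_on UNIV (\<phi> x)"
      unfolding \<phi>_def by (intro continuous_on_of_real continuous_on_real_sqrt)
    then show ?thesis by (rule Cc_I[OF _ K(1) _ K(2)]) (auto simp: \<phi>_def intro: K(3))
  qed
  have "\<exists>T. has_kernel (\<phi> x) T" if "x \<in> F" for x
    using bisection_kernel_exists[OF U(1)[OF that] \<phi>[OF that]] by blast
  then obtain T where T: "\<And>x. x \<in> F \<Longrightarrow> has_kernel (\<phi> x) (T x)" by metis
  define E where "E = (\<Sum>x\<in>F. T x * (T x)\<^sup>\<star>)"
  define e where "e d = complex_of_real (\<Sum>x\<in>F. \<psi> x d / m d)" for d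
  have "T x \<in> spectral p" if "x \<in> F" for x
  proof -
    have "T x \<in> graded_part p"
      unfolding graded_part_def using T[OF that] Cc_mono[OF \<phi>[OF that] U(2)[OF that]] by blast
    then show ?thesis unfolding spectral_def by (rule subsetD[OF closure_subset])
  qed
  then have "E \<in> finite_K p"
    unfolding E_def by (intro subspace_sum[OF subspace_finite_K] finite_K_base)
  moreover have "ell2_apply (op_apply E (ket b)) d = (if b = d then e d else 0)" for b d
  proof -
    have entry: "ell2_apply (op_apply (T x * (T x)\<^sup>\<star>) (ket b)) d = (if b = d then complex_of_real (\<psi> x d / m d) else 0)"
      if x: "x \<in> F" for x
    proof -
      have "(cmod (\<phi> x (inv_into (U x) r (r d))))\<^sup>2 = \<psi> x d / m d" if "r d \<in> r ` U x"
        using \<beta>(2)[OF x] m m_cong[of "inv_into (U x) r (r d)" d] bisection_r_inv(2)[OF that] that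
        by (simp add: \<phi>_def \<psi>(1)[OF x] transport_def less_imp_le)
      moreover have "\<psi> x d = 0" if "r d \<notin> r ` U x" using that by (simp add: \<psi>(1)[OF x] transport_def)
      ultimately show ?thesis
        by (simp add: bisection_mult_star_entry[OF U(1)[OF x] \<phi>[OF x] T[OF x]] del: of_real_divide)
    qed
    have "linear (\<lambda>S. ell2_apply (op_apply S (ket b)) d)"
      by (rule linearI) (simp_all add: op_apply_add_left plus_ell2.rep_eq op_apply_scaleR_left
          scaleR_ell2.rep_eq scaleR_conv_of_real)
    then have "ell2_apply (op_apply E (ket b)) d = (\<Sum>x\<in>F. ell2_apply (op_apply (T x * (T x)\<^sup>\<star>) (ket b)) d)"
      unfolding E_def by (rule linear_sum)
    also have "\<dots> = (\<Sum>x\<in>F. if b = d then complex_of_real (\<psi> x d / m d) else 0)"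
      by (rule sum.cong) (simp_all only: entry)
    also have "\<dots> = (if b = d then e d else 0)" by (simp add: e_def)
    finally show ?thesis .
  qed
  then have "ell2_apply (op_apply E \<xi>) d = e d * ell2_apply \<xi> d" for \<xi> d
    by (rule diagonal_apply)
  moreover have "e d = 1" if d: "r d \<in> C" for d
  proof -
    have "m d = m (r d)" by (rule m_cong) simp
    also have "\<dots> = (\<Sum>x\<in>F. \<psi> x (r d))" using bspec[OF lower d] by (simp add: m_def)
    also have "\<dots> = (\<Sum>x\<in>F. \<psi> x d)" by (rule sum.cong) (simp_all add: \<psi>(1) transport_def)
    finally have "(\<Sum>x\<in>F. \<psi> x d / m d) = 1" using m[of d] by (simp add: sum_divide_distrib[symmetric])
    then show ?thesis unfolding e_def by (simp only: of_real_1)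
  qed
  ultimately show ?thesis by blast
qed

lemma graded_part_subset: "graded_part g \<subseteq> spectral g"
  unfolding spectral_def by (rule closure_subset)

lemma local_unit_mult:
  assumes S: "has_kernel f S" and f: "f \<in> Cc (c -` {g})" and sub: "r ` (c -` {g}) \<subseteq> r ` (c -` {p})"
  obtains E where "E \<in> finite_K p" "E * S = S"
proof -
  let ?C = "r ` closure {a. f a \<noteq> 0}"
  have "compact ?C" by (intro compact_continuous_image continuous_r Cc_D(2)[OF f])
  moreover have "?C \<subseteq> r ` (c -` {p})" using Cc_D(3)[OF f] sub by blast
  ultimately obtain E e where E: "E \<in> finite_K p" "\<And>\<xi> d. ell2_apply (op_apply E \<xi>) d = e d * ell2_apply \<xi> d"
    "\<And>d. r d \<in> ?C \<Longrightarrow> e d = 1" using local_unit[of ?C p] by blast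
  have "E * S = S"
  proof (rule op_eqI, rule ell2_eqI)
    fix \<xi> d
    show "ell2_apply (op_apply (E * S) \<xi>) d = ell2_apply (op_apply S \<xi>) d"
    proof (cases "ell2_apply (op_apply S \<xi>) d = 0")
      case False
      then obtain a where a: "r a = r d" "f a \<noteq> 0" by (rule has_kernel_apply_nonzero[OF S])
      from imageI[OF Cc_D(4)[OF f a(2)], of r] have "e d = 1" unfolding a(1) by (rule E(3))
      then show ?thesis by (simp add: op_apply_mult E(2))
    qed (simp add: op_apply_mult E(2))
  qed
  with E(1) show thesis by (rule that)
qed

lemma unperforated_range:
  assumes "unperforated P G c" "p \<in> P" "q \<in> P"
  shows "r ` (c -` {p + q}) \<subseteq> r ` (c -` {p})"
proof
  fix u assume "u \<in> r ` (c -` {p + q})"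
  then obtain a where a: "c a = p + q" "u = r a" by blast
  then obtain a' a'' where "cmp a' a''" "c a' = p" "a = a' \<odot> a''"
    using assms unfolding unperforated_def by blast
  then show "u \<in> r ` (c -` {p})" using a r_mult by blast
qed

text \<open>
  A function of degree \<open>p + q\<close> is reproduced by a local unit in \<open>finite_K p\<close>, which factors it through
  degree \<open>p\<close>.
\<close>

lemma products_dense:
  assumes "unperforated P G c" "p \<in> P" "q \<in> P"
  shows "spectral (p + q) \<subseteq> closure (span {x * y | x y. x \<in> spectral p \<and> y \<in> spectral q})"
    (is "_ \<subseteq> closure ?S")
proof -
  have "graded_part (p + q) \<subseteq> ?S"
  proof
    fix S assume S: "S \<in> graded_part (p + q)"
    then obtain f where f: "f \<in> Cc (c -` {p + q})" "has_kernel f S" unfolding graded_part_def by blast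
    obtain E where E: "E \<in> finite_K p" "E * S = S" by (rule local_unit_mult[OF f(2,1) unperforated_range[OF assms]])
    have "E * S \<in> ?S"
      using E(1)
    proof (induction rule: finite_K_induct)
      case (base x y)
      have "y\<^sup>\<star> * S \<in> spectral (- p + (p + q))"
        by (intro mult_fibre star_fibre base subsetD[OF graded_part_subset S])
      then have "y\<^sup>\<star> * S \<in> spectral q" by (simp add: add.assoc[symmetric])
      then have "x * (y\<^sup>\<star> * S) \<in> ?S" using base(1) by (intro span_base) blast
      then show ?case by (simp add: mult.assoc)
    qed (simp_all add: span_zero span_add distrib_right)
    then show "S \<in> ?S" by (simp add: E(2))
  qed
  then show ?thesis unfolding spectral_def[of "p + q"] by (rule closure_mono)
qed

text \<open>
  Linear closed conditions on \<open>K p\<close> need to be checked only for products of compactly supported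
  functions, for which supports are available.
\<close>

lemma K_graded_induct:
  assumes k: "k \<in> K p" and \<Phi>: "bounded_linear \<Phi>" and W: "subspace W" "closed W"
    and base: "\<And>S T. S \<in> graded_part p \<Longrightarrow> T \<in> graded_part p \<Longrightarrow> \<Phi> (S * T\<^sup>\<star>) \<in> W"
  shows "\<Phi> k \<in> W"
proof (rule K_continuous_induct[OF \<Phi> k _ W(2)])
  fix k assume "k \<in> finite_K p"
  then show "\<Phi> k \<in> W"
  proof (induction rule: finite_K_induct)
    case (base x y)
    have 1: "\<Phi> (S * y\<^sup>\<star>) \<in> W" if "S \<in> graded_part p" for S
      using base(2) unfolding spectral_def
      by (rule bounded_linear_closure_in[OF
            bounded_linear_compose[OF \<Phi> bounded_linear_compose[OF bounded_linear_mult_right bounded_linear_star]] _ _ W(2)])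
        (rule assms(5)[OF that])
    show ?case
      using base(1) unfolding spectral_def
      by (rule bounded_linear_closure_in[OF bounded_linear_compose[OF \<Phi> bounded_linear_mult_left] _ 1 W(2)])
  qed (simp_all add: linear_simps[OF \<Phi>] subspace_0[OF W(1)] subspace_add[OF W(1)])
qed

lemma K_mult_coeff: "k \<in> K p \<Longrightarrow> a \<in> spectral 0 \<Longrightarrow> k * a \<in> K p"
proof -
  assume k: "k \<in> K p" and a: "a \<in> spectral 0"
  have "a\<^sup>\<star> * k\<^sup>\<star> \<in> K p"
    using coeff_mult_K[OF _ K_star[OF k], of "a\<^sup>\<star>"] star_fibre[OF a] by simp
  from K_star[OF this] show ?thesis by (simp add: star_mult star_star)
qed

text \<open>
  In a product \<open>f\<^sub>1f\<^sub>2\<^sup>\<star>g\<^sub>1g\<^sub>2\<^sup>\<star>\<close> with \<open>f\<^sub>i\<close> of degree \<open>p\<close> and \<open>g\<^sub>i\<close> of degree \<open>q\<close>, the factors in the middle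
  meet over units that are ranges both of arrows of degree \<open>p\<close> and of arrows of degree \<open>q\<close>. If all
  these units are ranges of arrows of degree \<open>t\<close>, then a local unit in \<open>finite_K t\<close> can be
  inserted in the middle.
\<close>

lemma K_mult_K:
  assumes sub: "r ` (c -` {p}) \<inter> r ` (c -` {q}) \<subseteq> r ` (c -` {t})"
    and k: "k \<in> K p" and l: "l \<in> K q"
  shows "k * l \<in> K t"
proof -
  have gen: "(S1 * S2\<^sup>\<star>) * (T1 * T2\<^sup>\<star>) \<in> K t"
    if S1: "S1 \<in> graded_part p" and S2: "S2 \<in> graded_part p" and T1: "T1 \<in> graded_part q" and T2: "T2 \<in> graded_part q"
    for S1 S2 T1 T2
  proof -
    obtain f where f: "f \<in> Cc (c -` {p})" "has_kernel f S2" using S2 unfolding graded_part_def by blast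
    obtain g where g: "g \<in> Cc (c -` {q})" "has_kernel g T1" using T1 unfolding graded_part_def by blast
    let ?C = "r ` closure {a. f a \<noteq> 0} \<inter> r ` closure {a. g a \<noteq> 0}"
    have "compact ?C"
      by (intro compact_Int compact_continuous_image continuous_r Cc_D(2)[OF f(1)] Cc_D(2)[OF g(1)])
    moreover have "?C \<subseteq> r ` (c -` {t})" using Cc_D(3)[OF f(1)] Cc_D(3)[OF g(1)] sub by blast
    ultimately obtain E e where E: "E \<in> finite_K t" "\<And>\<xi> d. ell2_apply (op_apply E \<xi>) d = e d * ell2_apply \<xi> d"
      "\<And>d. r d \<in> ?C \<Longrightarrow> e d = 1" using local_unit[of ?C t] by blast
    have "S2\<^sup>\<star> * T1 = S2\<^sup>\<star> * E * T1"
    proof (rule op_eqI, rule cinner_eqI)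
      fix x y
      have "cnj (ell2_apply (op_apply T1 x) d) * ell2_apply (op_apply S2 y) d =
          cnj (ell2_apply (op_apply E (op_apply T1 x)) d) * ell2_apply (op_apply S2 y) d" for d
      proof (cases "ell2_apply (op_apply T1 x) d = 0 \<or> ell2_apply (op_apply S2 y) d = 0")
        case False
        obtain a where a: "r a = r d" "f a \<noteq> 0" using False has_kernel_apply_nonzero[OF f(2)] by blast
        obtain b where b: "r b = r d" "g b \<noteq> 0" using False has_kernel_apply_nonzero[OF g(2)] by blast
        have "r d \<in> r ` closure {a. f a \<noteq> 0}" using imageI[OF Cc_D(4)[OF f(1) a(2)], of r] a(1) by simp
        moreover have "r d \<in> r ` closure {a. g a \<noteq> 0}" using imageI[OF Cc_D(4)[OF g(1) b(2)], of r] b(1) by simp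
        ultimately show ?thesis using E(3)[of d] by (simp add: E(2))
      qed (auto simp: E(2))
      then show "cinner (op_apply (S2\<^sup>\<star> * T1) x) y = cinner (op_apply (S2\<^sup>\<star> * E * T1) x) y"
        unfolding op_apply_mult cinner_star unfolding cinner_def by (simp only:)
    qed
    then have "(S1 * S2\<^sup>\<star>) * (T1 * T2\<^sup>\<star>) = (S1 * S2\<^sup>\<star>) * E * (T1 * T2\<^sup>\<star>)"
      by (metis mult.assoc)
    moreover have "(S1 * S2\<^sup>\<star>) * E * (T1 * T2\<^sup>\<star>) \<in> K t"
      by (intro K_mult_coeff coeff_mult_K mult_star_fibre subsetD[OF finite_K_subset_K E(1)]
          subsetD[OF graded_part_subset]) (fact S1 S2 T1 T2)+
    ultimately show ?thesis by simp
  qed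
  have "(S1 * S2\<^sup>\<star>) * l \<in> K t" if "S1 \<in> graded_part p" "S2 \<in> graded_part p" for S1 S2
    by (rule K_graded_induct[OF l bounded_linear_mult_right subspace_K closed_K gen[OF that]])
  then show ?thesis
    by (rule K_graded_induct[OF k bounded_linear_mult_left subspace_K closed_K])
qed

section \<open>Positivity of matrix entries\<close>

definition nonneg_entries :: "'g ell2_op \<Rightarrow> bool"
  where "nonneg_entries T \<longleftrightarrow> (\<forall>b d. \<exists>t\<ge>0. ell2_apply (op_apply T (ket b)) d = complex_of_real t)"

lemma nonneg_entries_star: "nonneg_entries T \<Longrightarrow> nonneg_entries (T\<^sup>\<star>)"
  unfolding nonneg_entries_def star_entry by (metis complex_cnj_complex_of_real)

text \<open>
  The sum for an entry of the product has nonnegative terms, so every single term is a lower bound.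
\<close>

lemma nonneg_entries_mult:
  assumes S: "nonneg_entries S" and T: "nonneg_entries T"
  shows "nonneg_entries (S * T)"
    and "Re (ell2_apply (op_apply S (ket i)) d) * Re (ell2_apply (op_apply T (ket b)) i)
      \<le> Re (ell2_apply (op_apply (S * T) (ket b)) d)"
proof -
  obtain \<sigma> where \<sigma>: "\<And>b d. 0 \<le> \<sigma> b d" "\<And>b d. ell2_apply (op_apply S (ket b)) d = complex_of_real (\<sigma> b d)"
    using S unfolding nonneg_entries_def by metis
  obtain \<tau> where \<tau>: "\<And>b d. 0 \<le> \<tau> b d" "\<And>b d. ell2_apply (op_apply T (ket b)) d = complex_of_real (\<tau> b d)"
    using T unfolding nonneg_entries_def by metis
  have sum: "((\<lambda>i. complex_of_real (\<tau> b i * \<sigma> i d)) has_sum ell2_apply (op_apply (S * T) (ket b)) d) UNIV" for b d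
    using op_apply_has_sum[of "op_apply T (ket b)" S d] by (simp add: op_apply_mult \<sigma> \<tau>)
  have re: "((\<lambda>i. \<tau> b i * \<sigma> i d) has_sum Re (ell2_apply (op_apply (S * T) (ket b)) d)) UNIV" for b d
    using has_sum_bounded_linear[OF bounded_linear_Re sum] by (simp add: o_def)
  have im: "((\<lambda>i. 0) has_sum Im (ell2_apply (op_apply (S * T) (ket b)) d)) (UNIV :: 'g set)" for b d
    using has_sum_bounded_linear[OF bounded_linear_Im sum] by (simp add: o_def)
  have "Im (ell2_apply (op_apply (S * T) (ket b)) d) = 0" for b d
    using has_sum_unique[OF im has_sum_0_simp] .
  moreover have "0 \<le> Re (ell2_apply (op_apply (S * T) (ket b)) d)" for b d
    by (rule has_sum_nonneg[OF re]) (simp add: \<sigma> \<tau>)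
  ultimately show "nonneg_entries (S * T)"
    unfolding nonneg_entries_def
    by (intro allI) (rule exI, rule conjI, assumption, simp add: complex_eq_iff)
  have "(\<Sum>i\<in>{i}. \<tau> b i * \<sigma> i d) \<le> Re (ell2_apply (op_apply (S * T) (ket b)) d)"
    by (rule finite_sum_le_has_sum[OF re]) (simp_all add: \<sigma> \<tau>)
  then show "Re (ell2_apply (op_apply S (ket i)) d) * Re (ell2_apply (op_apply T (ket b)) i)
      \<le> Re (ell2_apply (op_apply (S * T) (ket b)) d)"
    by (simp add: \<sigma> \<tau> mult.commute)
qed

text \<open>Such an element is \<open>f f\<^sup>\<star>\<close> for a nonnegative bump function \<open>f\<close> of degree \<open>p\<close> with \<open>f a = 1\<close>.\<close>

lemma positive_element_at_range:
  assumes a: "c a = p"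
  obtains k where "k \<in> K p" "nonneg_entries k" "1 \<le> Re (ell2_apply (op_apply k (ket (r a))) (r a))"
proof -
  have "a \<in> c -` {p}" using a by simp
  then obtain \<beta> :: "'g \<Rightarrow> real" and C where \<beta>: "continuous_on UNIV \<beta>" "\<And>b. 0 \<le> \<beta> b" "\<beta> a = 1"
    "compact C" "C \<subseteq> c -` {p}" "\<And>b. \<beta> b \<noteq> 0 \<Longrightarrow> b \<in> C" by (rule exists_bump[OF lc open_grade]) blast
  define f where "f b = complex_of_real (\<beta> b)" for b
  have f: "f \<in> Cc (c -` {p})"
    unfolding f_def by (rule Cc_I[OF continuous_on_of_real[OF \<beta>(1)] \<beta>(4) _ \<beta>(5)]) (simp add: \<beta>(6))
  then obtain S where S: "has_kernel f S" using Cc_kernel_exists[OF Cc_mono[OF f]] by blast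
  have "S \<in> graded_part p" using f S unfolding graded_part_def by blast
  then have K: "S * S\<^sup>\<star> \<in> K p" by (intro K_base subsetD[OF graded_part_subset])
  have nn: "nonneg_entries S"
    unfolding nonneg_entries_def
  proof (intro allI)
    fix b d
    show "\<exists>t\<ge>0. ell2_apply (op_apply S (ket b)) d = complex_of_real t"
      using S \<beta>(2) by (intro exI[of _ "if s d = s b then \<beta> (d \<odot> iv b) else 0"]) (simp add: has_kernel_def f_def)
  qed
  \<comment> \<open>The column of the arrow \<open>a\<^sup>-\<^sup>1\<close> of \<open>S\<close> has the entry \<open>f a\<close> in the row of the unit \<open>r a\<close>.\<close>
  have one: "ell2_apply (op_apply S (ket (iv a))) (r a) = 1"
    using S \<beta>(3) by (simp add: has_kernel_def f_def r_unit)
  have "Re (ell2_apply (op_apply S (ket (iv a))) (r a)) * Re (ell2_apply (op_apply (S\<^sup>\<star>) (ket (r a))) (iv a))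
      \<le> Re (ell2_apply (op_apply (S * S\<^sup>\<star>) (ket (r a))) (r a))"
    by (rule nonneg_entries_mult(2)[OF nn nonneg_entries_star[OF nn]])
  then have "1 \<le> Re (ell2_apply (op_apply (S * S\<^sup>\<star>) (ket (r a))) (r a))"
    by (simp add: star_entry one)
  with K nonneg_entries_mult(1)[OF nn nonneg_entries_star[OF nn]] show thesis by (intro that) auto
qed

text \<open>
  The row \<open>u\<close> of convolution by a function \<open>f\<close> involves only values of \<open>f\<close> at arrows with range \<open>u\<close>.
\<close>

lemma K_entry_zero:
  assumes k: "k \<in> K t" and u: "u \<notin> r ` (c -` {t})" "r u = u"
  shows "ell2_apply (op_apply k (ket u)) u = 0"
proof -
  have bl: "bounded_linear (\<lambda>k. ell2_apply (op_apply k (ket u)) u)"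
  proof (rule bounded_linear_intro[of _ "norm (ket u)"])
    show "norm (ell2_apply (op_apply k (ket u)) u) \<le> norm k * norm (ket u)" for k
      by (rule order_trans[OF ell2_apply_le_norm norm_op_apply])
  qed (simp_all add: op_apply_add_left plus_ell2.rep_eq op_apply_scaleR_left scaleR_ell2.rep_eq scaleR_conv_of_real)
  have "ell2_apply (op_apply k (ket u)) u \<in> {0}"
  proof (rule K_graded_induct[OF k bl])
    fix S T assume "S \<in> graded_part t"
    then obtain f where f: "f \<in> Cc (c -` {t})" "has_kernel f S" unfolding graded_part_def by blast
    have "ell2_apply (op_apply S (op_apply (T\<^sup>\<star>) (ket u))) u = 0"
    proof (rule ccontr)
      assume "\<not> ?thesis"
      then obtain a where "r a = r u" "f a \<noteq> 0" by (rule has_kernel_apply_nonzero[OF f(2)])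
      then show False using u Cc_D(5)[OF f(1), of a] by (metis imageI)
    qed
    then show "ell2_apply (op_apply (S * T\<^sup>\<star>) (ket u)) u \<in> {0}" by (simp add: op_apply_mult)
  qed (simp_all add: subspace_single_0)
  then show ?thesis by simp
qed

end

section \<open>Compact alignment and the range condition\<close>

lemma is_join_join:
  assumes P: "quasi_lattice_ordered P" and fin: "join_finite P p q"
  shows "is_join P p q (join P p q)"
proof -
  obtain t where t: "is_join P p q t"
    using P fin unfolding quasi_lattice_ordered_def join_finite_def by blast
  have "u = t" if u: "is_join P p q u" for u
  proof -
    have "- u + t \<in> P" "- t + u \<in> P" using t u unfolding is_join_def ple_def by blast+
    moreover have "- u + t = - (- t + u)" by (simp add: minus_add)
    ultimately have "- u + t \<in> P \<inter> uminus ` P" by blast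
    then have "- u + t = 0" using P unfolding quasi_lattice_ordered_def by blast
    then show "u = t" by (metis add.inverse_inverse minus_unique)
  qed
  with t show ?thesis unfolding join_def by (metis theI)
qed

lemma join_props:
  assumes "quasi_lattice_ordered P" "join_finite P p q"
  shows "join P p q \<in> P" "- p + join P p q \<in> P" "- q + join P p q \<in> P"
  using is_join_join[OF assms] by (auto simp: is_join_def common_upper_bounds_def ple_def)

context etale_graded
begin

lemma compactly_aligned_iff:
  assumes P: "quasi_lattice_ordered P" and unp: "unperforated P G c"
  shows "compactly_aligned P X \<longleftrightarrow>
    (\<forall>p\<in>P. \<forall>q\<in>P. join_finite P p q \<longrightarrow> (\<forall>k\<in>K p. \<forall>l\<in>K q.
      lmult (join P p q) (k * l) \<in> compacts X (join P p q)))"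
proof -
  have "iota_prod P X p q (lmult p k) (lmult q l) = lmult (join P p q) (k * l)"
    if "p \<in> P" "q \<in> P" "join_finite P p q" "k \<in> K p" "l \<in> K q" for p q k l
    by (rule iota_prod_lmult[OF products_dense[OF unp]]) (use that join_props[OF P] in auto)
  then show ?thesis
    unfolding compactly_aligned_def compacts_eq ball_simps by (simp cong: ball_cong imp_cong)
qed

theorem range_condition_imp_compactly_aligned:
  assumes P: "quasi_lattice_ordered P" and unp: "unperforated P G c" and range: "range_condition P G c"
  shows "compactly_aligned P X"
  unfolding compactly_aligned_iff[OF P unp]
proof (intro ballI impI)
  fix p q k l
  assume pq: "p \<in> P" "q \<in> P" "join_finite P p q" and kl: "k \<in> K p" "l \<in> K q"
  have "r ` (c -` {p}) \<inter> r ` (c -` {q}) = r ` (c -` {join P p q})"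
    using range pq unfolding range_condition_def by auto
  then have "k * l \<in> K (join P p q)" by (intro K_mult_K[OF _ kl]) simp
  then show "lmult (join P p q) (k * l) \<in> compacts X (join P p q)" by (simp add: compacts_eq)
qed

lemma K_subset_reduced_cstar: "K p \<subseteq> reduced_cstar G"
proof -
  have "graded_part 0 \<subseteq> left_regular G ` Cc UNIV"
    unfolding left_regular_image graded_part_def using Cc_mono by blast
  then have "spectral 0 \<subseteq> reduced_cstar G" unfolding spectral_def reduced_cstar_def by (rule closure_mono)
  then show ?thesis using K_subset_coeff by blast
qed

text \<open>
  Both sides of the covariance relation become elements of the algebra: the left side is \<open>k l\<close>, and
  compact alignment makes the right side an element of \<open>K (join P p q)\<close>.
\<close>

lemma nica_covariant_product:
  assumes P: "quasi_lattice_ordered P" and unp: "unperforated P G c"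
    and aligned: "compactly_aligned P X" and nica: "nica_covariant P X (reduced_cstar G) (\<lambda>p x. x)"
    and pq: "p \<in> P" "q \<in> P" and kl: "k \<in> K p" "l \<in> K q"
  shows "if join_finite P p q then k * l \<in> K (join P p q) else k * l = 0"
proof -
  have rep: "rep_compacts X (reduced_cstar G) (\<lambda>p x. x) p (lmult p k) = k" if "k \<in> K p" for p k
    by (rule rep_compacts_inclusion[OF K_subset_reduced_cstar that])
  have "lmult p k \<in> compacts X p" "lmult q l \<in> compacts X q" using kl by (simp_all add: compacts_eq)
  then have prod: "k * l = (if join_finite P p q
      then rep_compacts X (reduced_cstar G) (\<lambda>p x. x) (join P p q) (iota_prod P X p q (lmult p k) (lmult q l))
      else 0)"
    using nica pq rep[OF kl(1)] rep[OF kl(2)] unfolding nica_covariant_def by metis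
  show ?thesis
  proof (cases "join_finite P p q")
    case True
    have "iota_prod P X p q (lmult p k) (lmult q l) \<in> compacts X (join P p q)"
      using aligned pq True kl unfolding compactly_aligned_def compacts_eq by blast
    then obtain j where "j \<in> K (join P p q)" "iota_prod P X p q (lmult p k) (lmult q l) = lmult (join P p q) j"
      unfolding compacts_eq by blast
    then show ?thesis using prod True rep by simp
  qed (use prod in simp)
qed

theorem nica_covariant_imp_range_condition:
  assumes P: "quasi_lattice_ordered P" and unp: "unperforated P G c"
    and aligned: "compactly_aligned P X" and nica: "nica_covariant P X (reduced_cstar G) (\<lambda>p x. x)"
  shows "range_condition P G c"
  unfolding range_condition_def
proof (intro ballI)
  fix p q assume pq: "p \<in> P" "q \<in> P"
  have up: "r ` (c -` {t}) \<subseteq> r ` (c -` {p})" if "p \<in> P" "- p + t \<in> P" for p t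
    using unperforated_range[OF unp that] by (simp add: add.assoc[symmetric])
  have down: "join_finite P p q \<and> u \<in> r ` (c -` {join P p q})"
    if u: "u \<in> r ` (c -` {p}) \<inter> r ` (c -` {q})" for u
  proof -
    obtain a b where a: "c a = p" "u = r a" and b: "c b = q" "u = r b" using u by blast
    obtain k where k: "k \<in> K p" "nonneg_entries k" "1 \<le> Re (ell2_apply (op_apply k (ket u)) u)"
      using positive_element_at_range[OF a(1)] a(2) by blast
    obtain l where l: "l \<in> K q" "nonneg_entries l" "1 \<le> Re (ell2_apply (op_apply l (ket u)) u)"
      using positive_element_at_range[OF b(1)] b(2) by blast
    have "1 * 1 \<le> Re (ell2_apply (op_apply k (ket u)) u) * Re (ell2_apply (op_apply l (ket u)) u)"
      using k(3) l(3) by (intro mult_mono) auto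
    also have "\<dots> \<le> Re (ell2_apply (op_apply (k * l) (ket u)) u)"
      by (rule nonneg_entries_mult(2)[OF k(2) l(2)])
    finally have ne: "ell2_apply (op_apply (k * l) (ket u)) u \<noteq> 0" by auto
    note prod = nica_covariant_product[OF P unp aligned nica pq k(1) l(1)]
    have "join_finite P p q"
    proof (rule ccontr)
      assume "\<not> ?thesis"
      then have "k * l = 0" using prod by simp
      with ne show False by (simp add: op_apply_def zero_ell2_op.rep_eq zero_ell2.rep_eq)
    qed
    moreover have "u \<in> r ` (c -` {join P p q})"
      using prod calculation ne K_entry_zero[of "k * l" "join P p q" u] a(2) by auto
    ultimately show ?thesis ..
  qed
  show "r ` (c -` {p}) \<inter> r ` (c -` {q}) = (if join_finite P p q then r ` (c -` {join P p q}) else {})"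
  proof (cases "join_finite P p q")
    case True
    have "r ` (c -` {join P p q}) \<subseteq> r ` (c -` {p}) \<inter> r ` (c -` {q})"
      by (intro Int_greatest up pq join_props[OF P True])
    moreover have "r ` (c -` {p}) \<inter> r ` (c -` {q}) \<subseteq> r ` (c -` {join P p q})" using down by blast
    ultimately have "r ` (c -` {p}) \<inter> r ` (c -` {q}) = r ` (c -` {join P p q})" by (rule equalityI[rotated])
    with True show ?thesis by (simp only: if_True)
  qed (use down in auto)
qed

end

theorem lemma5p1:
  fixes P :: "'p :: group_add set"
    and G :: "'g :: {t2_space, second_countable_topology} groupoid"
    and c :: "'g \<Rightarrow> 'p"
  assumes "quasi_lattice_ordered P"
    and "etale_groupoid G"
    and "locally compact (UNIV :: 'g set)"
    and "cocycle G c"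
    and "continuous_map euclidean (discrete_topology UNIV) c"
    and "unperforated P G c"
  shows "(range_condition P G c \<longrightarrow> compactly_aligned P (groupoid_product_system G c)) \<and>
    (compactly_aligned P (groupoid_product_system G c) \<and>
      nica_covariant P (groupoid_product_system G c) (reduced_cstar G) (\<lambda>p x. x) \<longrightarrow>
      range_condition P G c)"
proof -
  interpret etale_graded G c
    by unfold_locales
      (use assms in \<open>simp_all add: etale_groupoid_def topological_groupoid_def\<close>)
  show ?thesis
    unfolding groupoid_product_system_eq
    using range_condition_imp_compactly_aligned[OF assms(1,6)]
      nica_covariant_imp_range_condition[OF assms(1,6)] by blast
qed

end
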